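(* Let $(r_n)_{n\ge1}$ be a sequence of positive numbers with $n r_n^m\to\lambda\in(0,\infty)$ as $n\to\infty$. Let $\beta_{k,n}$ be the $k$-th Betti number of $\mathcal{U}(\mathcal{P}_n,r_n)$. Then for every $1\le k\le m-1$, $$0<\liminf_{n\to\infty}n^{-1}\mathbb{E}\{\beta_{k,n}\}\le\limsup_{n\to\infty}n^{-1}\mathbb{E}\{\beta_{k,n}\}<\infty.$$
   Context: $\mathcal{M}\subset\mathbb{R}^d$ is a closed (compact, without boundary) smooth embedded $m$-dimensional manifold, $m<d$. $f:\mathcal{M}\to\mathbb{R}$ is a bounded measurable probability density with respect to the Riemannian volume form on $\mathcal{M}$. For each $n\ge 1$, $\mathcal{P}_n$ is a spatial Poisson process on $\mathcal{M}$ with intensity function $nf$. For finite $\mathcal{P}\subset\mathbb{R}^d$ and $\epsilon>0$, $\mathcal{U}(\mathcal{P},\epsilon)=\bigcup_{p\in\mathcal{P}}B_\epsilon(p)$, with $B_\epsilon(p)$ the closed $d$-dimensional ball of radius $\epsilon$ centered at $p$. $\beta_k(X)$ is the rank of the $k$-th homology group of $X$, and $\beta_{k,n}=\beta_k(\mathcal{U}(\mathcal{P}_n,r_n))$. *)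

theory Defs
  imports "HOL-Probability.Probability" "HOL-Homology.Homology"
begin

section \<open>Closed smooth submanifolds of Euclidean space\<close>

text \<open>
  On an open set: \<open>k\<close> times Frechet differentiable (by finite dimension, differentiating the
  derivative is differentiating its values in every fixed direction), with continuous derivatives.
\<close>

primrec Ck_on :: "nat \<Rightarrow> 'b::euclidean_space set \<Rightarrow> ('b \<Rightarrow> 'c::real_normed_vector) \<Rightarrow> bool" where
  "Ck_on 0 V \<phi> \<longleftrightarrow> continuous_on V \<phi>"
| "Ck_on (Suc k) V \<phi> \<longleftrightarrow> (\<forall>x\<in>V. \<phi> differentiable (at x)) \<and>
     (\<forall>v. Ck_on k V (\<lambda>x. frechet_derivative \<phi> (at x) v))"

definition smooth_on :: "'b::euclidean_space set \<Rightarrow> ('b \<Rightarrow> 'c::real_normed_vector) \<Rightarrow> bool" where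
  "smooth_on V \<phi> \<longleftrightarrow> (\<forall>k. Ck_on k V \<phi>)"

text \<open>A local parametrization is the inverse of a chart; its domain is open in \<open>real ^ 'm\<close>, so
  that no boundary points can occur.\<close>

definition local_parametrization ::
    "(real ^ 'd) set \<Rightarrow> (real ^ 'm) set \<Rightarrow> (real ^ 'm \<Rightarrow> real ^ 'd) \<Rightarrow> bool" where
  "local_parametrization M V \<phi> \<longleftrightarrow>
     open V \<and> smooth_on V \<phi> \<and>
     (\<forall>x\<in>V. inj (frechet_derivative \<phi> (at x))) \<and>
     openin (top_of_set M) (\<phi> ` V) \<and>
     (\<exists>\<psi>. homeomorphism V (\<phi> ` V) \<phi> \<psi>)"

definition closed_submanifold :: "'m::finite itself \<Rightarrow> (real ^ 'd) set \<Rightarrow> bool" where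
  "closed_submanifold (_ :: 'm itself) M \<longleftrightarrow> compact M \<and>
     (\<forall>p\<in>M. \<exists>V (\<phi> :: real ^ 'm \<Rightarrow> real ^ 'd). local_parametrization M V \<phi> \<and> p \<in> \<phi> ` V)"

text \<open>
  The Riemannian metric is the one induced by the Euclidean inner product. In the coordinates of a
  parametrization \<open>\<phi>\<close> with Jacobian matrix \<open>J\<close> its matrix is \<open>transpose J ** J\<close>, so the
  volume element is \<open>sqrt (det (transpose J ** J))\<close>. As \<open>M\<close> is covered by countably many
  parametrized pieces, at most one Borel measure on \<open>M\<close> has the property below.
\<close>

definition volume_element :: "(real ^ 'm \<Rightarrow> real ^ 'd) \<Rightarrow> real ^ 'm \<Rightarrow> real" where
  "volume_element \<phi> x =
     (let J = matrix (frechet_derivative \<phi> (at x)) in sqrt (det (transpose J ** J)))"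

definition riemannian_volume :: "'m::finite itself \<Rightarrow> (real ^ 'd) set \<Rightarrow> (real ^ 'd) measure \<Rightarrow> bool"
  where
  "riemannian_volume (_ :: 'm itself) M vol \<longleftrightarrow>
     sets vol = sets (restrict_space borel M) \<and>
     (\<forall>V (\<phi> :: real ^ 'm \<Rightarrow> real ^ 'd). local_parametrization M V \<phi> \<longrightarrow>
        (\<forall>A\<in>sets borel. A \<subseteq> \<phi> ` V \<longrightarrow>
           emeasure vol A = (\<integral>\<^sup>+x\<in>V \<inter> \<phi> -` A. ennreal (volume_element \<phi> x) \<partial>lborel)))"

definition bounded_probability_density :: "'a measure \<Rightarrow> ('a \<Rightarrow> real) \<Rightarrow> bool" where
  "bounded_probability_density \<mu> f \<longleftrightarrow>
     f \<in> borel_measurable \<mu> \<and> (\<forall>x\<in>space \<mu>. 0 \<le> f x) \<and> bounded (f ` space \<mu>) \<and>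
     (\<integral>\<^sup>+x. ennreal (f x) \<partial>\<mu>) = 1"

section \<open>Poisson processes\<close>

text \<open>
  A Poisson process with finite intensity measure \<open>\<Lambda>\<close>, as a random finite set of points. (For
  non-atomic \<open>\<Lambda>\<close> a Poisson process is almost surely simple, so multiplicities play no role.)
\<close>

definition poisson_process :: "'w measure \<Rightarrow> 'a measure \<Rightarrow> ('w \<Rightarrow> 'a set) \<Rightarrow> bool" where
  "poisson_process \<Omega> \<Lambda> P \<longleftrightarrow>
     prob_space \<Omega> \<and> finite_measure \<Lambda> \<and>
     (\<forall>\<omega>\<in>space \<Omega>. finite (P \<omega>) \<and> P \<omega> \<subseteq> space \<Lambda>) \<and>
     (\<forall>A\<in>sets \<Lambda>. (\<lambda>\<omega>. card (P \<omega> \<inter> A)) \<in> measurable \<Omega> (count_space UNIV) \<and>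
        distr \<Omega> (count_space UNIV) (\<lambda>\<omega>. card (P \<omega> \<inter> A)) =
          measure_pmf (poisson_pmf (measure \<Lambda> A))) \<and>
     (\<forall>(I :: nat set) A. finite I \<and> (\<forall>i\<in>I. A i \<in> sets \<Lambda>) \<and> disjoint_family_on A I \<longrightarrow>
        prob_space.indep_vars \<Omega> (\<lambda>_. count_space UNIV) (\<lambda>i \<omega>. card (P \<omega> \<inter> A i)) I)"

definition poisson_process_with_intensity ::
    "'w measure \<Rightarrow> 'a measure \<Rightarrow> ('a \<Rightarrow> real) \<Rightarrow> ('w \<Rightarrow> 'a set) \<Rightarrow> bool" where
  "poisson_process_with_intensity \<Omega> \<mu> g P \<longleftrightarrow>
     poisson_process \<Omega> (density \<mu> (\<lambda>x. ennreal (g x))) P"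

section \<open>Betti numbers of unions of balls\<close>

definition int_independent :: "('g, 'x) monoid_scheme \<Rightarrow> 'g set \<Rightarrow> bool" where
  "int_independent G S \<longleftrightarrow>
     (\<forall>c :: 'g \<Rightarrow> int. (\<Otimes>\<^bsub>G\<^esub>x\<in>S. x [^]\<^bsub>G\<^esub> c x) = \<one>\<^bsub>G\<^esub> \<longrightarrow> (\<forall>x\<in>S. c x = 0))"

definition abelian_rank :: "('g, 'x) monoid_scheme \<Rightarrow> enat" where
  "abelian_rank G = (SUP S\<in>{S. finite S \<and> S \<subseteq> carrier G \<and> int_independent G S}. enat (card S))"

text \<open>Singular homology with integer coefficients; extended values, so that an infinite rank is
  not confused with a finite one.\<close>

definition betti :: "nat \<Rightarrow> 'a::topological_space set \<Rightarrow> enat" where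
  "betti k X = abelian_rank (homology_group (int k) (top_of_set X))"

definition ball_union :: "'a::metric_space set \<Rightarrow> real \<Rightarrow> 'a set" where
  "ball_union P \<epsilon> = (\<Union>p\<in>P. cball p \<epsilon>)"

text \<open>The expectation of a nonnegative, possibly infinite quantity is its nonnegative Lebesgue
  integral; a divergent expectation is infinite rather than zero.\<close>

definition expected_betti :: "'w measure \<Rightarrow> nat \<Rightarrow> ('w \<Rightarrow> 'a::topological_space set) \<Rightarrow> ennreal" where
  "expected_betti \<Omega> k X = (\<integral>\<^sup>+\<omega>. ennreal_of_enat (betti k (X \<omega>)) \<partial>\<Omega>)"

end

theory Submission
  imports Defs
begin

text \<open>
  Upper bound: by Mayer-Vietoris and induction, every Betti number of a union of open convex sets is at
  most the number of nonempty index sets with a common point. For balls around the Poisson points such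
  index sets have diameter of order \<open>r\<^sub>n\<close>, so they lie in one of order \<open>r\<^sub>n powr (-m)\<close> balls,
  each containing a Poisson number of points of bounded mean; the expected number of subsets of a
  Poisson set of mean \<open>\<mu>\<close> is \<open>exp \<mu>\<close>.

  Lower bound: in a chart that is nearly affine, cut parameter space into blocks of side proportional to
  \<open>r\<^sub>n\<close>. If in a block exactly those subcubes contain Poisson points that meet a linearised \<open>k\<close>-sphere
  of radius \<open>2 r\<^sub>n\<close>, then the balls around these points form a union of components that contains the
  sphere and retracts onto it by projection, so every such block contributes an independent class.
  By outer regularity a positive proportion of the blocks carries enough mass in each subcube, and
  for those the event has probability bounded below.
\<close>

section \<open>Rank of abelian groups\<close>

text \<open>The homology of a union of components is never computed. Each class is detected by a map
  to the sphere that is constant on all other components, so independence follows from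
  functoriality, the vanishing homology of a point in positive degree and the infinite order of the
  class of a sphere. The density is merely bounded and measurable, so no open region where it is
  bounded below is at hand. Mass is located instead on a compact set \<open>K\<close> in parameter
  space where both density and volume element exceed a constant, and the chosen blocks miss so
  little of \<open>K\<close> that each of their subcubes is at least half filled by it. The
  constants follow from one budget: points within r/2 of a sphere of radius 2 r have r-balls within
  3 r/2 < 2 r of the sphere, where the projection to its span has no zero. The error r/2 is split
  into r/4 for the nonlinearity of the chart and r/4 for the size of a subcube. Betti numbers are
  compared pointwise with finite sums of functions of Poisson counts. The nonnegative integral is
  monotone for arbitrary integrands, so measurability is asked of those sums alone.\<close>

definition independent_family :: "('g, 'x) monoid_scheme \<Rightarrow> ('i \<Rightarrow> 'g) \<Rightarrow> 'i set \<Rightarrow> bool" where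
  "independent_family G g I \<longleftrightarrow>
     (\<forall>c :: 'i \<Rightarrow> int. (\<Otimes>\<^bsub>G\<^esub>i\<in>I. g i [^]\<^bsub>G\<^esub> c i) = \<one>\<^bsub>G\<^esub> \<longrightarrow> (\<forall>i\<in>I. c i = 0))"

context comm_group
begin

lemma finprod_int_pow:
  assumes "finite I" "g \<in> I \<rightarrow> carrier G"
  shows "(\<Otimes>i\<in>I. g i) [^] (d::int) = (\<Otimes>i\<in>I. g i [^] d)"
  using assms
proof (induction I rule: finite_induct)
  case (insert x F)
  then have "(\<Otimes>i\<in>F. g i) \<in> carrier G" "g x \<in> carrier G" by auto
  with insert show ?case
    by (subst finprod_insert; (subst finprod_insert)?) (auto simp: int_pow_distrib)
qed auto

lemma finprod_int_pow_sum:
  assumes "finite U" "x \<in> carrier G"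
  shows "x [^] (\<Sum>u\<in>U. c u :: int) = (\<Otimes>u\<in>U. x [^] c u)"
  using assms
proof (induction U rule: finite_induct)
  case (insert u F)
  then show ?case
    by (subst finprod_insert) (auto simp: int_pow_mult)
qed auto

lemma finprod_swap:
  assumes "finite U" "finite S" "\<And>u s. u \<in> U \<Longrightarrow> s \<in> S \<Longrightarrow> h u s \<in> carrier G"
  shows "(\<Otimes>u\<in>U. \<Otimes>s\<in>S. h u s) = (\<Otimes>s\<in>S. \<Otimes>u\<in>U. h u s)"
  using assms(1,3)
proof (induction U rule: finite_induct)
  case empty
  then show ?case by (simp add: finprod_one_eqI)
next
  case (insert u F)
  have "(\<Otimes>u\<in>insert u F. \<Otimes>s\<in>S. h u s) = (\<Otimes>s\<in>S. h u s) \<otimes> (\<Otimes>s\<in>S. \<Otimes>u\<in>F. h u s)"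
    using insert by (subst finprod_insert) (auto intro!: finprod_closed)
  also have "\<dots> = (\<Otimes>s\<in>S. h u s \<otimes> (\<Otimes>u\<in>F. h u s))"
    using insert by (subst finprod_multf) (auto intro!: finprod_closed)
  also have "\<dots> = (\<Otimes>s\<in>S. \<Otimes>u\<in>insert u F. h u s)"
    using insert by (intro finprod_cong') (auto simp: finprod_insert Pi_def intro!: finprod_closed)
  finally show ?case .
qed

text \<open>A repeated value would give a relation with coefficients 1 and -1. Hence no element is
  lost in passing from a family to the set of its values, the form in which
  \<open>abelian_rank\<close> counts.\<close>

lemma independent_family_inj_on:
  assumes "finite I" "g \<in> I \<rightarrow> carrier G" "independent_family G g I"
  shows "inj_on g I"
proof (rule inj_onI, rule ccontr)
  fix i j assume ij: "i \<in> I" "j \<in> I" "g i = g j" "i \<noteq> j"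
  define c :: "_ \<Rightarrow> int" where "c = (\<lambda>l. if l = i then 1 else if l = j then -1 else 0)"
  have gi: "g i \<in> carrier G" "g j \<in> carrier G" using assms ij by auto
  have "(\<Otimes>l\<in>I. g l [^] c l) = (\<Otimes>l\<in>{i,j}. g l [^] c l)"
    using assms ij gi
    by (intro finprod_mono_neutral_cong_right) (auto simp: c_def Pi_iff)
  also have "\<dots> = g i [^] c i \<otimes> g j [^] c j"
    using ij gi by (subst finprod_insert) auto
  also have "\<dots> = \<one>"
    using ij gi by (simp add: c_def int_pow_neg)
  finally have "c i = 0"
    using assms(3) ij(1) unfolding independent_family_def by blast
  then show False by (simp add: c_def)
qed

lemma card_le_abelian_rank:
  assumes "finite I" "g \<in> I \<rightarrow> carrier G" "independent_family G g I"
  shows "enat (card I) \<le> abelian_rank G"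
proof -
  have inj: "inj_on g I" using independent_family_inj_on assms .
  have "int_independent G (g ` I)"
    unfolding int_independent_def
  proof (intro allI impI ballI)
    fix c :: "'a \<Rightarrow> int" and x
    assume c: "(\<Otimes>x\<in>g ` I. x [^] c x) = \<one>" and x: "x \<in> g ` I"
    have "(\<Otimes>x\<in>g ` I. x [^] c x) = (\<Otimes>i\<in>I. g i [^] c (g i))"
      using assms inj by (intro finprod_reindex) (auto simp: Pi_iff)
    with c have "\<forall>i\<in>I. c (g i) = 0"
      using assms(3) unfolding independent_family_def by (metis (no_types))
    with x show "c x = 0" by auto
  qed
  then have "enat (card (g ` I)) \<le> abelian_rank G"
    unfolding abelian_rank_def using assms by (intro SUP_upper) auto
  then show ?thesis using card_image[OF inj] by simp
qed

end

lemma group_hom_finprod: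
  assumes "comm_group G" "comm_group H" "h \<in> hom G H" "finite I" "g \<in> I \<rightarrow> carrier G"
  shows "h (\<Otimes>\<^bsub>G\<^esub>i\<in>I. g i) = (\<Otimes>\<^bsub>H\<^esub>i\<in>I. h (g i))"
proof -
  interpret G: comm_group G by fact
  interpret H: comm_group H by fact
  interpret group_hom G H h by unfold_locales fact
  show ?thesis using assms(4,5)
  proof (induction I rule: finite_induct)
    case (insert x F)
    then show ?case
      by (subst G.finprod_insert, simp, simp, simp, simp, subst H.finprod_insert) (auto simp: Pi_iff)
  qed auto
qed

text \<open>A maximal subfamily of an independent set whose image stays independent accounts for the rank
  of the target; each remaining element has a combination with nonzero own coefficient in the kernel.\<close>

lemma abelian_rank_exact_le:
  assumes A: "comm_group A" and B: "comm_group B" and C: "comm_group C"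
    and i: "i \<in> hom A B" and p: "p \<in> hom B C"
    and exact: "kernel B C p \<subseteq> i ` carrier A"
  shows "abelian_rank B \<le> abelian_rank A + abelian_rank C"
  unfolding abelian_rank_def[of B]
proof (rule SUP_least)
  fix S assume "S \<in> {S. finite S \<and> S \<subseteq> carrier B \<and> int_independent B S}"
  then have S: "finite S" "S \<subseteq> carrier B" "int_independent B S" by auto
  interpret A: comm_group A by fact
  interpret B: comm_group B by fact
  interpret C: comm_group C by fact
  interpret i: group_hom A B i by unfold_locales fact
  interpret p: group_hom B C p by unfold_locales fact
  let ?\<T> = "{T. T \<subseteq> S \<and> independent_family C p T}"
  have "finite ?\<T>" using S(1) by auto
  moreover have "{} \<in> ?\<T>" by (auto simp: independent_family_def)
  ultimately obtain T where T: "T \<in> ?\<T>" and max: "\<And>T'. T' \<in> ?\<T> \<Longrightarrow> T \<subseteq> T' \<Longrightarrow> T' = T"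
    using finite_has_maximal[of ?\<T>] by (metis (no_types, lifting) empty_iff)
  have TS: "T \<subseteq> S" "finite T" using T S finite_subset by auto
  have rC: "enat (card T) \<le> abelian_rank C"
    using T TS S by (intro C.card_le_abelian_rank[of _ p]) auto
  have "\<exists>c :: 'c \<Rightarrow> int. (\<forall>t. t \<notin> insert x T \<longrightarrow> c t = 0) \<and> c x \<noteq> 0 \<and>
            (\<Otimes>\<^bsub>C\<^esub>t\<in>S. p t [^]\<^bsub>C\<^esub> c t) = \<one>\<^bsub>C\<^esub>" if x: "x \<in> S - T" for x
  proof -
    have "\<not> independent_family C p (insert x T)"
      using max[of "insert x T"] x TS by auto
    then obtain c :: "'c \<Rightarrow> int" where c: "(\<Otimes>\<^bsub>C\<^esub>t\<in>insert x T. p t [^]\<^bsub>C\<^esub> c t) = \<one>\<^bsub>C\<^esub>"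
      and nz: "\<exists>t\<in>insert x T. c t \<noteq> 0"
      unfolding independent_family_def by blast
    have pT: "p t \<in> carrier C" if "t \<in> S" for t using that S by auto
    have "c x \<noteq> 0"
    proof
      assume "c x = 0"
      moreover have "(\<Otimes>\<^bsub>C\<^esub>t\<in>insert x T. p t [^]\<^bsub>C\<^esub> c t) = p x [^]\<^bsub>C\<^esub> c x \<otimes>\<^bsub>C\<^esub> (\<Otimes>\<^bsub>C\<^esub>t\<in>T. p t [^]\<^bsub>C\<^esub> c t)"
        using x TS pT by (subst C.finprod_insert) auto
      moreover have "(\<Otimes>\<^bsub>C\<^esub>t\<in>T. p t [^]\<^bsub>C\<^esub> c t) \<in> carrier C"
        using TS pT by (intro C.finprod_closed) auto
      ultimately have "(\<Otimes>\<^bsub>C\<^esub>t\<in>T. p t [^]\<^bsub>C\<^esub> c t) = \<one>\<^bsub>C\<^esub>" using c by simp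
      then have "\<forall>t\<in>T. c t = 0" using T unfolding independent_family_def by blast
      with nz \<open>c x = 0\<close> show False by auto
    qed
    \<comment> \<open>Extension by zero lets all these relations run over the same index set
      \<open>S\<close>.\<close>
    moreover define c' where "c' = (\<lambda>t. if t \<in> insert x T then c t else 0)"
    have "(\<Otimes>\<^bsub>C\<^esub>t\<in>S. p t [^]\<^bsub>C\<^esub> c' t) = (\<Otimes>\<^bsub>C\<^esub>t\<in>insert x T. p t [^]\<^bsub>C\<^esub> c t)"
      using S(1) TS x pT by (intro C.finprod_mono_neutral_cong_right) (auto simp: c'_def)
    ultimately show ?thesis
      using c by (intro exI[of _ c']) (auto simp: c'_def)
  qed
  then obtain c :: "'c \<Rightarrow> 'c \<Rightarrow> int" where
    c0: "\<And>x t. x \<in> S - T \<Longrightarrow> t \<notin> insert x T \<Longrightarrow> c x t = 0" and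
    cx: "\<And>x. x \<in> S - T \<Longrightarrow> c x x \<noteq> 0" and
    c1: "\<And>x. x \<in> S - T \<Longrightarrow> (\<Otimes>\<^bsub>C\<^esub>t\<in>S. p t [^]\<^bsub>C\<^esub> c x t) = \<one>\<^bsub>C\<^esub>"
    by metis
  define y where "y x = (\<Otimes>\<^bsub>B\<^esub>t\<in>S. t [^]\<^bsub>B\<^esub> c x t)" for x
  have Scar: "t \<in> carrier B" if "t \<in> S" for t using that S by auto
  have ycar: "y x \<in> carrier B" for x
    unfolding y_def using Scar by (intro B.finprod_closed) auto
  have "\<exists>a \<in> carrier A. i a = y x" if x: "x \<in> S - T" for x
  proof -
    have "p (y x) = (\<Otimes>\<^bsub>C\<^esub>t\<in>S. p (t [^]\<^bsub>B\<^esub> c x t))"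
      unfolding y_def using S Scar by (intro group_hom_finprod[OF B C p]) auto
    also have "\<dots> = (\<Otimes>\<^bsub>C\<^esub>t\<in>S. p t [^]\<^bsub>C\<^esub> c x t)"
      using Scar by (intro C.finprod_cong') (auto simp: p.hom_int_pow)
    finally have "y x \<in> kernel B C p" using c1[OF x] ycar by (simp add: kernel_def)
    then show ?thesis using exact by fastforce
  qed
  then obtain a where a: "\<And>x. x \<in> S - T \<Longrightarrow> a x \<in> carrier A" "\<And>x. x \<in> S - T \<Longrightarrow> i (a x) = y x"
    by metis
  \<comment> \<open>Restricted to \<open>S - T\<close>, the coefficients \<open>c\<close> form a
    diagonal matrix with nonzero diagonal. In a relation among the \<open>a x\<close>, the exponent
    of \<open>x\<close> therefore reduces to \<open>c x x * d x\<close>.\<close>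
  have "independent_family A a (S - T)"
    unfolding independent_family_def
  proof (intro allI impI ballI)
    fix d :: "'c \<Rightarrow> int" and x
    assume d: "(\<Otimes>\<^bsub>A\<^esub>x\<in>S-T. a x [^]\<^bsub>A\<^esub> d x) = \<one>\<^bsub>A\<^esub>" and x: "x \<in> S - T"
    have "\<one>\<^bsub>B\<^esub> = i (\<Otimes>\<^bsub>A\<^esub>x\<in>S-T. a x [^]\<^bsub>A\<^esub> d x)" using d by simp
    also have "\<dots> = (\<Otimes>\<^bsub>B\<^esub>x\<in>S-T. i (a x [^]\<^bsub>A\<^esub> d x))"
      using S a by (intro group_hom_finprod[OF A B i]) auto
    also have "\<dots> = (\<Otimes>\<^bsub>B\<^esub>x\<in>S-T. y x [^]\<^bsub>B\<^esub> d x)"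
      using a ycar by (intro B.finprod_cong') (auto simp: i.hom_int_pow)
    also have "\<dots> = (\<Otimes>\<^bsub>B\<^esub>x\<in>S-T. \<Otimes>\<^bsub>B\<^esub>t\<in>S. (t [^]\<^bsub>B\<^esub> c x t) [^]\<^bsub>B\<^esub> d x)"
      unfolding y_def using S Scar by (intro B.finprod_cong' B.finprod_int_pow) auto
    also have "\<dots> = (\<Otimes>\<^bsub>B\<^esub>t\<in>S. \<Otimes>\<^bsub>B\<^esub>x\<in>S-T. (t [^]\<^bsub>B\<^esub> c x t) [^]\<^bsub>B\<^esub> d x)"
      using S Scar by (intro B.finprod_swap) auto
    also have "\<dots> = (\<Otimes>\<^bsub>B\<^esub>t\<in>S. t [^]\<^bsub>B\<^esub> (\<Sum>x\<in>S-T. c x t * d x))"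
      using S Scar by (intro B.finprod_cong') (auto simp: B.finprod_int_pow_sum B.int_pow_pow intro!: B.finprod_cong')
    finally have "\<forall>t\<in>S. (\<Sum>x\<in>S-T. c x t * d x) = 0"
      using S(3) unfolding int_independent_def by metis
    then have "0 = (\<Sum>x'\<in>S-T. c x' x * d x')" using x by auto
    also have "\<dots> = (\<Sum>x'\<in>{x}. c x' x * d x')"
      using S x c0 by (intro sum.mono_neutral_right) auto
    finally show "d x = 0" using cx[OF x] by simp
  qed
  then have rA: "enat (card (S - T)) \<le> abelian_rank A"
    using S a by (intro A.card_le_abelian_rank[of _ a]) auto
  have "enat (card S) = enat (card (S - T)) + enat (card T)"
    using TS S by (simp add: card_Diff_subset card_mono)
  with rA rC show "enat (card S) \<le> abelian_rank A + abelian_rank C"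
    by (metis add_mono plus_enat_simps(1))
qed

lemma abelian_rank_mono:
  assumes A: "comm_group A" and B: "comm_group B" and h: "h \<in> hom A B" "inj_on h (carrier A)"
  shows "abelian_rank A \<le> abelian_rank B"
  unfolding abelian_rank_def[of A]
proof (rule SUP_least)
  fix S assume "S \<in> {S. finite S \<and> S \<subseteq> carrier A \<and> int_independent A S}"
  then have S: "finite S" "S \<subseteq> carrier A" "int_independent A S" by auto
  interpret A: comm_group A by fact
  interpret B: comm_group B by fact
  interpret h: group_hom A B h by unfold_locales fact
  have "independent_family B h S"
    unfolding independent_family_def
  proof (intro allI impI)
    fix c :: "'a \<Rightarrow> int" assume c: "(\<Otimes>\<^bsub>B\<^esub>x\<in>S. h x [^]\<^bsub>B\<^esub> c x) = \<one>\<^bsub>B\<^esub>"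
    have car: "(\<Otimes>\<^bsub>A\<^esub>x\<in>S. x [^]\<^bsub>A\<^esub> c x) \<in> carrier A"
      using S by (intro A.finprod_closed) auto
    have "h (\<Otimes>\<^bsub>A\<^esub>x\<in>S. x [^]\<^bsub>A\<^esub> c x) = (\<Otimes>\<^bsub>B\<^esub>x\<in>S. h (x [^]\<^bsub>A\<^esub> c x))"
      using S by (intro group_hom_finprod[OF A B h(1)]) auto
    also have "\<dots> = (\<Otimes>\<^bsub>B\<^esub>x\<in>S. h x [^]\<^bsub>B\<^esub> c x)"
      using S by (intro B.finprod_cong') (auto simp: h.hom_int_pow subset_iff)
    finally have "h (\<Otimes>\<^bsub>A\<^esub>x\<in>S. x [^]\<^bsub>A\<^esub> c x) = h \<one>\<^bsub>A\<^esub>"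
      using c by simp
    then have "(\<Otimes>\<^bsub>A\<^esub>x\<in>S. x [^]\<^bsub>A\<^esub> c x) = \<one>\<^bsub>A\<^esub>"
      using inj_onD[OF h(2) _ car] by blast
    then show "\<forall>x\<in>S. c x = 0" using S(3) unfolding int_independent_def by blast
  qed
  then show "enat (card S) \<le> abelian_rank B"
    using S by (intro B.card_le_abelian_rank[of _ h]) auto
qed

lemma abelian_rank_trivial:
  assumes "comm_group G" "trivial_group G"
  shows "abelian_rank G = 0"
proof -
  interpret comm_group G by fact
  have "S = {}" if S: "finite S" "S \<subseteq> carrier G" "int_independent G S" for S
  proof (rule ccontr)
    assume "S \<noteq> {}"
    then have "S = {\<one>\<^bsub>G\<^esub>}" using S(2) assms(2) by (auto simp: trivial_group_def)
    moreover have "(\<Otimes>\<^bsub>G\<^esub>x\<in>{\<one>\<^bsub>G\<^esub>}. x [^]\<^bsub>G\<^esub> (1::int)) = \<one>\<^bsub>G\<^esub>"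
      by (subst finprod_insert) auto
    ultimately show False
      using S(3) unfolding int_independent_def by (auto dest!: spec[of _ "\<lambda>_. 1"])
  qed
  then have "{S. finite S \<and> S \<subseteq> carrier G \<and> int_independent G S} \<subseteq> {{}}" by auto
  then have "abelian_rank G \<le> (SUP S\<in>{{}::'a set}. enat (card S))"
    unfolding abelian_rank_def by (rule SUP_subset_mono) simp
  then show ?thesis by (simp add: zero_enat_def[symmetric])
qed

lemma comm_group_integer_group: "comm_group integer_group"
  by (rule group.group_comm_groupI) auto

lemma abelian_rank_integer_group: "abelian_rank integer_group \<le> 1"
  unfolding abelian_rank_def
proof (rule SUP_least)
  interpret Z: comm_group integer_group by (rule comm_group_integer_group)
  fix S :: "int set" assume "S \<in> {S. finite S \<and> S \<subseteq> carrier integer_group \<and> int_independent integer_group S}"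
  then have S: "finite S" "int_independent integer_group S" by auto
  have "a = b" if ab: "a \<in> S" "b \<in> S" for a b
  proof (rule ccontr)
    assume ne: "a \<noteq> b"
    \<comment> \<open>The relation b * a - a * b = 0 between two integers; its coefficients all
      vanish only if a = b = 0.\<close>
    define c where "c = (\<lambda>x. if x = a then b else if x = b then - a else 0)"
    have "(\<Otimes>\<^bsub>integer_group\<^esub>x\<in>S. x [^]\<^bsub>integer_group\<^esub> c x) = (\<Otimes>\<^bsub>integer_group\<^esub>x\<in>{a,b}. x [^]\<^bsub>integer_group\<^esub> c x)"
      using ab S(1) by (intro Z.finprod_mono_neutral_cong_right) (auto simp: c_def)
    also have "\<dots> = 0"
      using ne by (subst Z.finprod_insert) (auto simp: c_def)
    finally have "\<forall>x\<in>S. c x = 0" using S(2) unfolding int_independent_def by auto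
    with ab ne have "b = 0" "c b = 0" by (auto simp: c_def split: if_splits)
    with ne show False by (auto simp: c_def)
  qed
  then have "card S \<le> 1" by (metis S(1) card_le_Suc0_iff_eq One_nat_def)
  then show "enat (card S) \<le> 1" by (simp add: one_enat_def)
qed

section \<open>Betti numbers of unions of convex sets\<close>

text \<open>Integer degrees, unlike those of \<open>betti\<close>, let the induction below pass from
  p to p - 1 without a lower limit.\<close>

abbreviation homology_rank :: "int \<Rightarrow> 'a::topological_space set \<Rightarrow> enat" where
  "homology_rank p S \<equiv> abelian_rank (homology_group p (top_of_set S))"

text \<open>The rank form of Mayer-Vietoris. The exact sequence of the pair of the union and
  \<open>U\<close> splits off the rank of \<open>U\<close>; excising \<open>U - V\<close> turns the
  relative group into that of \<open>V\<close> and \<open>U \<inter> V\<close>, whose own exact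
  sequence gives the other two terms.\<close>

lemma homology_rank_Un_le:
  fixes U V :: "'a::topological_space set"
  assumes "open U" "open V"
  shows "homology_rank p (U \<union> V) \<le> homology_rank p U + homology_rank p V + homology_rank (p - 1) (U \<inter> V)"
proof -
  let ?X = "top_of_set (U \<union> V)"
  let ?R = "relative_homology_group p ?X U"
  let ?Q = "relative_homology_group p (top_of_set V) (U \<inter> V)"
  have sub: "subtopology ?X U = top_of_set U" "subtopology ?X V = top_of_set V"
    "subtopology (top_of_set V) (U \<inter> V) = top_of_set (U \<inter> V)"
    by (simp_all add: subtopology_subtopology Int_absorb1 Int_absorb2 inf_sup_aci)
  have "exact_seq ([?R, homology_group p ?X, homology_group p (subtopology ?X U)],
              [hom_induced p ?X {} ?X U id, hom_induced p (subtopology ?X U) {} ?X {} id])"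
    by (rule homology_exactness_axiom_3)
  then have 1: "abelian_rank (homology_group p ?X) \<le> homology_rank p U + abelian_rank ?R"
    unfolding sub exact_seq_cons_iff exact_seq_end_iff
    by (intro abelian_rank_exact_le[where i="hom_induced p (top_of_set U) {} ?X {} id"
          and p="hom_induced p ?X {} ?X U id"])
       (auto simp: abelian_homology_group group_hom_def group_hom_axioms_def)
  have 2: "abelian_rank ?R \<le> abelian_rank ?Q"
  proof -
    \<comment> \<open>Excision asks for the closure of \<open>U - V\<close> inside the interior of
      \<open>U\<close>. Openness of \<open>V\<close> makes the first set closed in the union,
      openness of \<open>U\<close> makes the second equal to \<open>U\<close>.\<close>
    have "closedin ?X (U - V)"
    proof -
      have "U - V = (U \<union> V) \<inter> (- V)" by auto
      then show ?thesis using assms by (metis closed_Compl closedin_closed_Int)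
    qed
    moreover have "openin ?X U"
      using assms by (intro open_openin_trans) auto
    ultimately have "?X closure_of (U - V) \<subseteq> ?X interior_of U"
      by (simp add: closure_of_closedin interior_of_openin Diff_subset)
    then have "hom_induced p (subtopology ?X (U \<union> V - (U - V))) (U - (U - V)) (subtopology ?X (U \<union> V)) U id
       \<in> iso (relative_homology_group p (subtopology ?X (U \<union> V - (U - V))) (U - (U - V)))
          (relative_homology_group p (subtopology ?X (U \<union> V)) U)"
      by (rule homology_excision_axiom) auto
    moreover have "U \<union> V - (U - V) = V" "U - (U - V) = U \<inter> V" by auto
    ultimately obtain h where "h \<in> iso ?Q ?R"
      by (auto simp: sub subtopology_subtopology)
    then have "inv_into (carrier ?Q) h \<in> iso ?R ?Q"
      by (simp add: group.iso_set_sym)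
    then show ?thesis
      by (intro abelian_rank_mono[where h="inv_into (carrier ?Q) h"])
         (auto simp: iso_def bij_betw_def)
  qed
  have 3: "abelian_rank ?Q \<le> homology_rank p V + homology_rank (p - 1) (U \<inter> V)"
  proof -
    have "exact_seq ([homology_group (p-1) (subtopology (top_of_set V) (U \<inter> V)), ?Q, homology_group p (top_of_set V)],
              [hom_boundary p (top_of_set V) (U \<inter> V), hom_induced p (top_of_set V) {} (top_of_set V) (U \<inter> V) id])"
      by (rule homology_exactness_axiom_1)
    then show ?thesis
      unfolding sub exact_seq_cons_iff exact_seq_end_iff
      by (intro abelian_rank_exact_le[where i="hom_induced p (top_of_set V) {} (top_of_set V) (U \<inter> V) id"
            and p="hom_boundary p (top_of_set V) (U \<inter> V)"])
         (auto simp: abelian_homology_group group_hom_def group_hom_axioms_def)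
  qed
  show ?thesis
    using order_trans[OF 1 add_left_mono[OF order_trans[OF 2 3]]] by (simp add: add.assoc)
qed

section \<open>Nerve bound for finite families of open convex sets\<close>

lemma homology_rank_empty: "homology_rank p {} = 0"
  by (intro abelian_rank_trivial trivial_homology_group_empty abelian_homology_group) auto

lemma homology_rank_convex_le_1:
  fixes S :: "'a::real_normed_vector set"
  assumes "convex S"
  shows "homology_rank p S \<le> 1"
proof (cases "S = {} \<or> p \<noteq> 0")
  case True
  have "trivial_group (homology_group p (top_of_set S))"
  proof (cases "S = {}")
    case False
    with True have "p \<noteq> 0" by simp
    have "contractible_space (top_of_set S)"
      using convex_imp_contractible[OF assms] by (simp add: contractible_space_top_of_set)
    then show ?thesis
      using trivial_reduced_homology_group_contractible_space[of "top_of_set S" p]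
      by (simp add: un_reduced_homology_group[OF \<open>p \<noteq> 0\<close>])
  qed (simp add: trivial_homology_group_empty)
  then show ?thesis by (simp add: abelian_rank_trivial abelian_homology_group)
next
  case False
  then have "path_connected_space (top_of_set S)"
    using convex_imp_path_connected[OF assms] by (metis path_connectedin_def path_connectedin_euclidean)
  then have "homology_group 0 (top_of_set S) \<cong> integer_group"
    using False by (intro isomorphic_integer_zeroth_homology_group) auto
  then obtain h where "h \<in> iso (homology_group 0 (top_of_set S)) integer_group"
    by (auto simp: is_iso_def)
  then have "abelian_rank (homology_group 0 (top_of_set S)) \<le> abelian_rank integer_group"
    by (intro abelian_rank_mono[where h=h])
       (auto simp: iso_def bij_betw_def abelian_homology_group comm_group_integer_group)
  then show ?thesis using False abelian_rank_integer_group by auto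
qed

text \<open>Induction over all degrees and families at once, because Mayer-Vietoris meets the family
  \<open>C i \<inter> C j\<close>, again open and convex, in degree p - 1. The three terms count the
  index sets avoiding j, the singleton of j, and those containing j and further indices.\<close>

lemma homology_rank_UN_convex_le:
  fixes C :: "'i \<Rightarrow> 'a::euclidean_space set"
  assumes "finite I" "\<And>i. i \<in> I \<Longrightarrow> open (C i)" "\<And>i. i \<in> I \<Longrightarrow> convex (C i)"
  shows "homology_rank p (\<Union>i\<in>I. C i) \<le> enat (card {T. T \<subseteq> I \<and> T \<noteq> {} \<and> (\<Inter>i\<in>T. C i) \<noteq> {}})"
  using assms
proof (induction I arbitrary: C p rule: finite_induct)
  case empty
  then show ?case using homology_rank_empty[of p, where ?'a='a] by simp
next
  case (insert j I)
  let ?N = "\<lambda>I C. {T. T \<subseteq> I \<and> T \<noteq> {} \<and> (\<Inter>i\<in>T. C i) \<noteq> {}}"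
  show ?case
  \<comment> \<open>For an empty member the singleton of j is not among the counted index sets, but
    the union does not change either.\<close>
  proof (cases "C j = {}")
    case True
    have "homology_rank p (\<Union>i\<in>insert j I. C i) \<le> enat (card (?N I C))"
      using insert.IH[of C p] insert.prems True by simp
    also have "card (?N I C) \<le> card (?N (insert j I) C)"
      using insert.hyps by (intro card_mono) auto
    finally show ?thesis by simp
  next
    case False
    let ?D = "\<lambda>i. C i \<inter> C j"
    have fin: "finite (?N I C)" "finite (?N I ?D)" using insert.hyps by auto
    have "homology_rank p (\<Union>i\<in>insert j I. C i) = homology_rank p ((\<Union>i\<in>I. C i) \<union> C j)"
      by (simp add: Un_commute)
    also have "\<dots> \<le> homology_rank p (\<Union>i\<in>I. C i) + homology_rank p (C j)
         + homology_rank (p - 1) ((\<Union>i\<in>I. C i) \<inter> C j)"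
      using insert.prems by (intro homology_rank_Un_le) auto
    also have "\<dots> \<le> enat (card (?N I C)) + 1 + enat (card (?N I ?D))"
    proof (intro add_mono)
      show "homology_rank p (\<Union>i\<in>I. C i) \<le> enat (card (?N I C))"
        using insert.prems by (intro insert.IH) auto
      show "homology_rank p (C j) \<le> 1"
        using insert.prems by (intro homology_rank_convex_le_1) auto
      have "homology_rank (p-1) (\<Union>i\<in>I. ?D i) \<le> enat (card (?N I ?D))"
        using insert.prems by (intro insert.IH) (auto intro: convex_Int)
      then show "homology_rank (p - 1) ((\<Union>i\<in>I. C i) \<inter> C j) \<le> enat (card (?N I ?D))"
        by (simp add: Int_UN_distrib2 Int_commute)
    qed
    also have "\<dots> = enat (card (?N I C) + card {{j}} + card (insert j ` ?N I ?D))"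
    proof -
      have "inj_on (insert j) (?N I ?D)"
        using insert.hyps(2) by (auto simp: inj_on_def insert_ident)
      then show ?thesis by (simp add: card_image one_enat_def)
    qed
    also have "\<dots> = enat (card (?N I C \<union> {{j}} \<union> insert j ` ?N I ?D))"
    proof -
      have "?N I C \<inter> {{j}} = {}" "(?N I C \<union> {{j}}) \<inter> insert j ` ?N I ?D = {}"
        using insert.hyps(2) by auto
      then show ?thesis using fin by (simp add: card_Un_disjoint del: Un_insert_right)
    qed
    also have "\<dots> \<le> enat (card (?N (insert j I) C))"
    proof -
      have "insert j T \<in> ?N (insert j I) C" if "T \<in> ?N I ?D" for T
        using that by (auto split: if_splits)
      then have "?N I C \<union> {{j}} \<union> insert j ` ?N I ?D \<subseteq> ?N (insert j I) C"
        using False by auto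
      then show ?thesis using insert.hyps by (simp add: card_mono)
    qed
    finally show ?thesis .
  qed
qed

text \<open>Mayer-Vietoris is only available for open sets. The union of closed balls is a neighbourhood
  retract, hence a retract of the union of slightly larger open balls, which has the larger homology.\<close>

lemma betti_ball_union_le:
  fixes P :: "'a::euclidean_space set"
  assumes "finite P" "r > 0"
  shows "betti k (ball_union P r) \<le> enat (card {T. T \<subseteq> P \<and> T \<noteq> {} \<and> (\<Inter>p\<in>T. ball p (2*r)) \<noteq> {}})"
proof -
  let ?X = "ball_union P r"
  have X: "?X = \<Union>((\<lambda>p. cball p r) ` P)" by (auto simp: ball_union_def)
  have cX: "compact ?X" unfolding ball_union_def using assms by (intro compact_UN) auto
  have "ENR ?X" unfolding X using assms by (intro ENR_finite_Union_convex_closed) auto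
  then obtain U where U: "open U" "?X retract_of U" unfolding ENR_def by auto
  then have "?X \<subseteq> U" by (simp add: retract_of_imp_subset)
  then obtain d where d: "d > 0" "(\<Union>x\<in>?X. ball x d) \<subseteq> U"
    using compact_subset_open_imp_ball_epsilon_subset[OF cX U(1)] by blast
  \<comment> \<open>Below d the enlarged balls stay inside \<open>U\<close>; at most r, their radius
    stays within 2 r, so the final count is free of the unknown neighbourhood.\<close>
  define e where "e = min (d/2) r"
  let ?Y = "\<Union>p\<in>P. ball p (r + e)"
  have e: "e > 0" "e < d" "e \<le> r" using d assms by (auto simp: e_def)
  have "?Y \<subseteq> U"
  proof
    fix y assume "y \<in> ?Y"
    then obtain p where p: "p \<in> P" "dist p y < r + e" by auto
    show "y \<in> U"
    proof (cases "dist p y \<le> r")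
      case True
      then have "y \<in> ?X" using p by (auto simp: ball_union_def)
      then show ?thesis using \<open>?X \<subseteq> U\<close> by blast
    next
      case False
      \<comment> \<open>The radial projection of y to the sphere of radius r about p; it moves y by
        the excess of its distance over r, which is less than e.\<close>
      define x where "x = p + (r / norm (y - p)) *\<^sub>R (y - p)"
      have n: "norm (y - p) > r" using False by (simp add: dist_norm norm_minus_commute)
      have "dist p x \<le> r" using n assms by (simp add: x_def dist_norm)
      then have "x \<in> ?X" using p by (auto simp: ball_union_def)
      have "y - x = (1 - r / norm (y - p)) *\<^sub>R (y - p)"
        by (simp add: x_def algebra_simps)
      then have "norm (y - x) = \<bar>1 - r / norm (y - p)\<bar> * norm (y - p)"
        by (simp only: norm_scaleR)
      moreover have np: "0 < norm (y - p)" using n assms by linarith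
      then have "0 \<le> 1 - r / norm (y - p)" using n by (simp only: diff_ge_0_iff_ge divide_le_eq_1_pos)
      ultimately have "norm (y - x) = (1 - r / norm (y - p)) * norm (y - p)" by simp
      then have "norm (y - x) = norm (y - p) - r"
        using np by (simp add: left_diff_distrib)
      then have "dist x y < d" using p e by (simp add: dist_norm norm_minus_commute)
      with \<open>x \<in> ?X\<close> show ?thesis using d(2) by (meson UN_I mem_ball subsetD)
    qed
  qed
  moreover have "?X \<subseteq> ?Y" using e by (auto simp: ball_union_def)
  ultimately have "?X retract_of ?Y" using U(2) retract_of_subset by blast
  then obtain f where f: "retraction ?Y ?X f" unfolding retract_of_def by auto
  have "section_map (top_of_set ?X) (top_of_set ?Y) id"
    unfolding section_map_def retraction_maps_def
    using f by (intro exI[of _ f]) (auto simp: retraction_def subset_iff)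
  then have "hom_induced (int k) (top_of_set ?X) {} (top_of_set ?Y) {} id
       \<in> mon (homology_group (int k) (top_of_set ?X)) (homology_group (int k) (top_of_set ?Y))"
    by (rule mon_hom_induced_section_map)
  then have "betti k ?X \<le> homology_rank (int k) ?Y"
    unfolding betti_def
    by (intro abelian_rank_mono[where h="hom_induced (int k) (top_of_set ?X) {} (top_of_set ?Y) {} id"])
       (auto simp: mon_def abelian_homology_group)
  also have "\<dots> \<le> enat (card {T. T \<subseteq> P \<and> T \<noteq> {} \<and> (\<Inter>p\<in>T. ball p (r+e)) \<noteq> {}})"
    using assms by (intro homology_rank_UN_convex_le) auto
  also have "card {T. T \<subseteq> P \<and> T \<noteq> {} \<and> (\<Inter>p\<in>T. ball p (r+e)) \<noteq> {}} \<le>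
     card {T. T \<subseteq> P \<and> T \<noteq> {} \<and> (\<Inter>p\<in>T. ball p (2*r)) \<noteq> {}}"
  proof (intro card_mono)
    have "ball p (r+e) \<subseteq> ball p (2*r)" for p :: 'a using e by auto
    then have "(\<Inter>p\<in>T. ball p (r+e)) \<subseteq> (\<Inter>p\<in>T. ball p (2*r))" for T :: "'a set" by blast
    then show "{T. T \<subseteq> P \<and> T \<noteq> {} \<and> (\<Inter>p\<in>T. ball p (r+e)) \<noteq> {}} \<subseteq> {T. T \<subseteq> P \<and> T \<noteq> {} \<and> (\<Inter>p\<in>T. ball p (2*r)) \<noteq> {}}"
      by blast
  qed (use assms in auto)
  finally show ?thesis by simp
qed

section \<open>Spherical classes\<close>

text \<open>A constant map factors through a one-point space, which has no homology outside degree
  0.\<close>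

lemma hom_induced_const_trivial:
  assumes "p \<noteq> 0" "a \<in> topspace Y" "z \<in> carrier (homology_group p X)"
    "\<And>x. x \<in> topspace X \<Longrightarrow> f x = a"
  shows "hom_induced p X {} Y {} f z = \<one>\<^bsub>homology_group p Y\<^esub>"
proof -
  let ?A = "subtopology Y {a}"
  have c1: "continuous_map X ?A (\<lambda>x. a)" using assms by (simp add: continuous_map_in_subtopology)
  have c2: "continuous_map ?A Y id" by (simp add: continuous_map_from_subtopology)
  have "hom_induced p X {} Y {} f z = hom_induced p X {} Y {} (\<lambda>x. a) z"
    using assms by (intro fun_cong[OF hom_induced_eq]) auto
  also have "\<dots> = hom_induced p ?A {} Y {} id (hom_induced p X {} ?A {} (\<lambda>x. a) z)"
    using hom_induced_compose_empty[OF c1 c2, of p] by (simp add: o_def fun_eq_iff)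
  also have "hom_induced p X {} ?A {} (\<lambda>x. a) z \<in> carrier (homology_group p ?A)"
    by (rule hom_induced_carrier)
  then have "hom_induced p X {} ?A {} (\<lambda>x. a) z = \<one>\<^bsub>homology_group p ?A\<^esub>"
    using homology_dimension_axiom[of ?A a p] assms by (auto simp: trivial_group_def)
  also have "hom_induced p ?A {} Y {} id \<one>\<^bsub>homology_group p ?A\<^esub> = \<one>\<^bsub>homology_group p Y\<^esub>"
    by (rule hom_one) (auto simp: hom_induced_empty_hom)
  finally show ?thesis .
qed

text \<open>For k >= 1 ordinary and reduced homology agree in degree k, and the group is infinite
  cyclic; z is a generator.\<close>

lemma nsphere_class_of_infinite_order:
  assumes "1 \<le> k"
  obtains z where "z \<in> carrier (homology_group (int k) (nsphere k))"
    "\<And>c::int. z [^]\<^bsub>homology_group (int k) (nsphere k)\<^esub> c = \<one>\<^bsub>homology_group (int k) (nsphere k)\<^esub> \<Longrightarrow> c = 0"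
proof -
  let ?H = "homology_group (int k) (nsphere k)"
  have "?H \<cong> integer_group"
    using reduced_homology_group_nsphere(1)[of k] assms by (simp add: un_reduced_homology_group)
  then obtain h where h: "h \<in> iso ?H integer_group" by (auto simp: is_iso_def)
  then obtain z where z: "z \<in> carrier ?H" "h z = 1"
    by (auto simp: iso_def bij_betw_def) (metis UNIV_I imageE)
  interpret h: group_hom ?H integer_group h
    using h by (auto simp: group_hom_def group_hom_axioms_def iso_def)
  show thesis
  proof (rule that[OF z(1)])
    fix c :: int assume "z [^]\<^bsub>?H\<^esub> c = \<one>\<^bsub>?H\<^esub>"
    then have "h z [^]\<^bsub>integer_group\<^esub> c = 0"
      using h.hom_int_pow[OF z(1), of c] h.hom_one by simp
    then show "c = 0" using z(2) by simp
  qed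
qed

text \<open>The maps \<open>p q\<close> act as coordinates: \<open>p q\<close> sends the class of
  the q-th sphere back to z and every other class to the identity. Applied to a relation, it
  isolates z raised to the power \<open>c q\<close>.\<close>

lemma betti_ge_card_spheres:
  assumes k: "1 \<le> k" and fin: "finite G"
    and i: "\<And>q. q \<in> G \<Longrightarrow> continuous_map (nsphere k) (top_of_set X) (i q)"
    and p: "\<And>q. q \<in> G \<Longrightarrow> continuous_map (top_of_set X) (nsphere k) (p q)"
    and id: "\<And>q s. q \<in> G \<Longrightarrow> s \<in> topspace (nsphere k) \<Longrightarrow> p q (i q s) = s"
    and a: "a \<in> topspace (nsphere k)"
    and const: "\<And>q q' s. q \<in> G \<Longrightarrow> q' \<in> G \<Longrightarrow> q \<noteq> q' \<Longrightarrow> s \<in> topspace (nsphere k) \<Longrightarrow> p q (i q' s) = a"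
  shows "enat (card G) \<le> betti k X"
proof -
  let ?S = "nsphere k" and ?X = "top_of_set X"
  let ?H = "homology_group (int k) ?S" and ?K = "homology_group (int k) ?X"
  obtain z where z: "z \<in> carrier ?H" "\<And>c::int. z [^]\<^bsub>?H\<^esub> c = \<one>\<^bsub>?H\<^esub> \<Longrightarrow> c = 0"
    using nsphere_class_of_infinite_order[OF k] by blast
  interpret H: comm_group ?H by (rule abelian_homology_group)
  interpret K: comm_group ?K by (rule abelian_homology_group)
  define g where "g q = hom_induced (int k) ?S {} ?X {} (i q) z" for q
  have gK: "g q \<in> carrier ?K" for q unfolding g_def by (rule hom_induced_carrier)
  have "independent_family ?K g G"
    unfolding independent_family_def
  proof (intro allI impI ballI)
    fix c :: "'a \<Rightarrow> int" and q
    assume c: "(\<Otimes>\<^bsub>?K\<^esub>q\<in>G. g q [^]\<^bsub>?K\<^esub> c q) = \<one>\<^bsub>?K\<^esub>" and q: "q \<in> G"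
    let ?h = "hom_induced (int k) ?X {} ?S {} (p q)"
    interpret h: group_hom ?K ?H ?h
      by (simp add: group_hom_def group_hom_axioms_def hom_induced_empty_hom)
    have hg: "?h (g q') = (if q' = q then z else \<one>\<^bsub>?H\<^esub>)" if q': "q' \<in> G" for q'
    proof -
      have "?h (g q') = hom_induced (int k) ?S {} ?S {} (p q \<circ> i q') z"
        unfolding g_def using hom_induced_compose_empty[OF i[OF q'] p[OF q], of "int k"] by simp
      also have "\<dots> = (if q' = q then z else \<one>\<^bsub>?H\<^esub>)"
      proof (cases "q' = q")
        case True
        have "hom_induced (int k) ?S {} ?S {} (p q \<circ> i q) z = z"
          using id[OF q] z(1) by (intro hom_induced_id_gen continuous_map_compose[OF i[OF q] p[OF q]]) auto
        then show ?thesis using True by simp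
      next
        case False
        have "hom_induced (int k) ?S {} ?S {} (p q \<circ> i q') z = \<one>\<^bsub>?H\<^esub>"
          using const[OF q q'] False k by (intro hom_induced_const_trivial[OF _ a z(1)]) auto
        then show ?thesis using False by simp
      qed
      finally show ?thesis .
    qed
    have "\<one>\<^bsub>?H\<^esub> = ?h (\<Otimes>\<^bsub>?K\<^esub>q\<in>G. g q [^]\<^bsub>?K\<^esub> c q)" by (simp only: c h.hom_one)
    also have "\<dots> = (\<Otimes>\<^bsub>?H\<^esub>q\<in>G. ?h (g q [^]\<^bsub>?K\<^esub> c q))"
      using fin gK by (intro group_hom_finprod H.comm_group_axioms K.comm_group_axioms h.homh) auto
    also have "\<dots> = (\<Otimes>\<^bsub>?H\<^esub>q'\<in>{q}. z [^]\<^bsub>?H\<^esub> c q')"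
      using fin q gK z(1) by (intro H.finprod_mono_neutral_cong_right) (auto simp: h.hom_int_pow hg simp del: one_relative_homology_group)
    also have "\<dots> = z [^]\<^bsub>?H\<^esub> c q" using z(1) by (subst H.finprod_insert) (auto simp del: one_relative_homology_group)
    finally show "c q = 0" using z(2) by metis
  qed
  then show ?thesis
    unfolding betti_def using fin gK by (intro K.card_le_abelian_rank[of _ g]) auto
qed

section \<open>Round spheres spanned by an orthonormal frame\<close>

lemma topspace_nsphere_iff:
  "s \<in> topspace (nsphere k) \<longleftrightarrow> (\<Sum>i\<le>k. (s i)\<^sup>2) = 1 \<and> (\<forall>i>k. s i = 0)"
  by (simp add: nsphere)

definition sphere_point :: "nat \<Rightarrow> (nat \<Rightarrow> 'a::euclidean_space) \<Rightarrow> (nat \<Rightarrow> real) \<Rightarrow> 'a" where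
  "sphere_point k e s = (\<Sum>i\<le>k. s i *\<^sub>R e i)"

text \<open>The indices 0, ..., k give the k + 1 vectors that a k-sphere requires. Finding them in
  the m-dimensional range of the derivative of a chart is where k <= m - 1 enters.\<close>

locale orthonormal_frame =
  fixes k :: nat and e :: "nat \<Rightarrow> 'a::euclidean_space"
  assumes orth: "\<And>i j. i \<le> k \<Longrightarrow> j \<le> k \<Longrightarrow> e i \<bullet> e j = (if i = j then 1 else 0)"
begin

lemma sphere_point_inner: "i \<le> k \<Longrightarrow> sphere_point k e s \<bullet> e i = s i"
  by (simp add: sphere_point_def inner_sum_left orth if_distrib cong: if_cong)

lemma norm_sphere_point:
  assumes "s \<in> topspace (nsphere k)"
  shows "norm (sphere_point k e s) = 1"
proof -
  have "sphere_point k e s \<bullet> sphere_point k e s = (\<Sum>i\<le>k. s i * (sphere_point k e s \<bullet> e i))"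
    by (subst (2) sphere_point_def) (simp add: inner_sum_right)
  also have "\<dots> = (\<Sum>i\<le>k. (s i)\<^sup>2)" by (simp add: sphere_point_inner power2_eq_square)
  also have "\<dots> = 1" using assms by (simp add: topspace_nsphere_iff)
  finally show ?thesis by (simp add: norm_eq_1)
qed

text \<open>If all frame coordinates of v vanished, v would be orthogonal to the unit vector
  \<open>sphere_point k e s\<close>, and its distance to t times that vector would be at least t. So
  frame coordinates can be normalised close to the sphere.\<close>

lemma near_sphere_point_coord_nonzero:
  assumes "s \<in> topspace (nsphere k)" "norm (v - t *\<^sub>R sphere_point k e s) < t"
  shows "(\<Sum>i\<le>k. (v \<bullet> e i)\<^sup>2) \<noteq> 0"
proof
  assume "(\<Sum>i\<le>k. (v \<bullet> e i)\<^sup>2) = 0"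
  then have z: "v \<bullet> e i = 0" if "i \<le> k" for i
    using that by (subst (asm) sum_nonneg_eq_0_iff) auto
  let ?s = "sphere_point k e s"
  have "v \<bullet> ?s = (\<Sum>i\<le>k. s i * (v \<bullet> e i))" by (simp add: sphere_point_def inner_sum_right)
  also have "\<dots> = 0" by (simp add: z)
  finally have "v \<bullet> ?s = 0" .
  then have "(v - t *\<^sub>R ?s) \<bullet> ?s = - t"
    using norm_sphere_point[OF assms(1)] by (simp add: inner_diff_left norm_eq_1)
  moreover have "\<bar>(v - t *\<^sub>R ?s) \<bullet> ?s\<bar> \<le> norm (v - t *\<^sub>R ?s) * norm ?s"
    by (rule Cauchy_Schwarz_ineq2)
  ultimately show False using norm_sphere_point[OF assms(1)] assms(2) by simp
qed

text \<open>\<open>B q\<close> is the cluster of points around one sphere. \<open>cover\<close> puts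
  the sphere into the union of balls, \<open>near\<close> keeps the balls of the cluster within r +
  r/2 < 2 r of the sphere, so that projecting onto it is possible, and \<open>far\<close> separates
  them from all other balls.\<close>

lemma betti_ball_union_ge:
  fixes P :: "'a set"
  assumes k: "1 \<le> k" and P: "finite P" and r: "r > 0" and G: "finite G"
    and sub: "\<And>q. q \<in> G \<Longrightarrow> B q \<subseteq> P"
    and cover: "\<And>q s. q \<in> G \<Longrightarrow> s \<in> topspace (nsphere k) \<Longrightarrow>
                  \<exists>x\<in>B q. dist x (c q + (2 * r) *\<^sub>R sphere_point k e s) \<le> r"
    and near: "\<And>q x. q \<in> G \<Longrightarrow> x \<in> B q \<Longrightarrow>
                  \<exists>s\<in>topspace (nsphere k). dist x (c q + (2 * r) *\<^sub>R sphere_point k e s) \<le> r / 2"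
    and far: "\<And>q x y. q \<in> G \<Longrightarrow> x \<in> B q \<Longrightarrow> y \<in> P - B q \<Longrightarrow> 2 * r < dist x y"
    and disj: "\<And>q q'. q \<in> G \<Longrightarrow> q' \<in> G \<Longrightarrow> q \<noteq> q' \<Longrightarrow> B q \<inter> B q' = {}"
  shows "enat (card G) \<le> betti k (ball_union P r)"
proof -
  let ?X = "ball_union P r"
  let ?Y = "\<lambda>q. ball_union (B q) r" and ?Z = "\<lambda>q. ball_union (P - B q) r"
  define a :: "nat \<Rightarrow> real" where "a = (\<lambda>n. if n = 0 then 1 else 0)"
  define i where "i q s = c q + (2 * r) *\<^sub>R sphere_point k e s" for q s
  define w where "w q y = sqrt (\<Sum>j\<le>k. ((y - c q) \<bullet> e j)\<^sup>2)" for q y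
  \<comment> \<open>On the balls of the cluster: normalised frame coordinates about
    \<open>c q\<close>. Elsewhere: the base point a. The two pieces are closed and disjoint, which
    makes the map continuous on the whole union.\<close>
  define p where "p q y = (if y \<in> ?Y q then (\<lambda>j. if j \<le> k then (y - c q) \<bullet> e j / w q y else 0) else a)" for q y
  have a: "a \<in> topspace (nsphere k)" unfolding a_def by (rule in_topspace_nsphere)
  have YZ: "?X = ?Y q \<union> ?Z q" "?Y q \<inter> ?Z q = {}" "closed (?Y q)" "closed (?Z q)" if q: "q \<in> G" for q
  proof -
    show "?X = ?Y q \<union> ?Z q" using sub[OF q] by (auto simp: ball_union_def)
    show "?Y q \<inter> ?Z q = {}"
    proof (rule ccontr)
      assume "?Y q \<inter> ?Z q \<noteq> {}"
      then obtain u where u: "u \<in> ?Y q" "u \<in> ?Z q" by blast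
      from u(1) obtain x where "x \<in> B q" "dist x u \<le> r" by (auto simp: ball_union_def)
      moreover from u(2) obtain y where "y \<in> P - B q" "dist y u \<le> r" by (auto simp: ball_union_def)
      ultimately show False using far[OF q, of x y] dist_triangle2[of x y u] by linarith
    qed
    have "finite (B q)" using sub[OF q] P finite_subset by blast
    then show "closed (?Y q)" "closed (?Z q)"
      using P by (auto simp: ball_union_def intro!: closed_UN)
  qed
  have wpos: "w q y > 0" if q: "q \<in> G" and y: "y \<in> ?Y q" for q y
  proof -
    from y obtain x where x: "x \<in> B q" "dist x y \<le> r" by (auto simp: ball_union_def)
    obtain s where s: "s \<in> topspace (nsphere k)" "dist x (c q + (2 * r) *\<^sub>R sphere_point k e s) \<le> r / 2"
      using near[OF q x(1)] by auto
    have "norm ((y - c q) - (2*r) *\<^sub>R sphere_point k e s) = dist y (c q + (2 * r) *\<^sub>R sphere_point k e s)"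
      by (simp add: dist_norm algebra_simps)
    also have "\<dots> \<le> dist y x + dist x (c q + (2 * r) *\<^sub>R sphere_point k e s)" by (rule dist_triangle)
    also have "\<dots> < 2 * r" using x s r by (simp add: dist_commute)
    finally have "(\<Sum>j\<le>k. ((y - c q) \<bullet> e j)\<^sup>2) \<noteq> 0"
      by (rule near_sphere_point_coord_nonzero[OF s(1)])
    moreover have "(\<Sum>j\<le>k. ((y - c q) \<bullet> e j)\<^sup>2) \<ge> 0" by (intro sum_nonneg) auto
    ultimately show ?thesis by (simp add: w_def)
  qed
  have iY: "i q s \<in> ?Y q" if "q \<in> G" "s \<in> topspace (nsphere k)" for q s
    using cover[OF that] by (auto simp: ball_union_def i_def)
  have ci: "continuous_map (nsphere k) (top_of_set ?X) (i q)" if q: "q \<in> G" for q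
  proof -
    have "continuous_map (nsphere k) euclidean (\<lambda>s. s j *\<^sub>R e j)" for j
      using continuous_map_compose[OF continuous_map_nsphere_projection,
          of euclidean "\<lambda>t. t *\<^sub>R e j" k j]
      by (simp add: o_def continuous_intros)
    then have "continuous_map (nsphere k) euclidean (\<lambda>s. \<Sum>j\<le>k. s j *\<^sub>R e j)"
      by (intro continuous_map_sum) auto
    then have "continuous_map (nsphere k) euclidean (\<lambda>s. c q + (2 * r) *\<^sub>R (\<Sum>j\<le>k. s j *\<^sub>R e j))"
      using continuous_map_compose[of _ euclidean _ euclidean "\<lambda>t. c q + (2 * r) *\<^sub>R t"]
      by (simp add: o_def continuous_intros)
    then have "continuous_map (nsphere k) euclidean (i q)"
      by (simp add: i_def[abs_def] sphere_point_def)
    then show ?thesis using iY[OF q] YZ(1)[OF q]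
      by (auto simp: continuous_map_in_subtopology)
  qed
  have cp: "continuous_map (top_of_set ?X) (nsphere k) (p q)" if q: "q \<in> G" for q
  proof -
    have "continuous_on ?X (\<lambda>y. p q y j)" for j
    proof -
      have 1: "continuous_on (?Y q) (\<lambda>y. if j \<le> k then (y - c q) \<bullet> e j / w q y else 0)"
      proof (cases "j \<le> k")
        case True
        have "continuous_on (?Y q) (w q)" unfolding w_def by (intro continuous_intros)
        then have "continuous_on (?Y q) (\<lambda>y. (y - c q) \<bullet> e j / w q y)"
          by (intro continuous_intros) (use wpos[OF q] in force)+
        then show ?thesis using True by simp
      qed simp
      have "continuous_on (?Y q \<union> ?Z q) (\<lambda>y. if y \<in> ?Y q then (if j \<le> k then (y - c q) \<bullet> e j / w q y else 0) else a j)"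
        using YZ(2)[OF q] by (intro continuous_on_cases[OF YZ(3,4)[OF q] 1]) auto
      then show ?thesis unfolding YZ(1)[OF q, symmetric]
        by (rule continuous_on_eq) (auto simp: p_def)
    qed
    moreover have "p q y \<in> topspace (nsphere k)" for y
    proof (cases "y \<in> ?Y q")
      case True
      have "(\<Sum>j\<le>k. ((y - c q) \<bullet> e j / w q y)\<^sup>2) = (\<Sum>j\<le>k. ((y - c q) \<bullet> e j)\<^sup>2) / (w q y)\<^sup>2"
        by (simp add: power_divide sum_divide_distrib)
      also have "(\<Sum>j\<le>k. ((y - c q) \<bullet> e j)\<^sup>2) = (w q y)\<^sup>2"
        unfolding w_def by (rule real_sqrt_pow2[symmetric]) (intro sum_nonneg; simp)
      also have "(w q y)\<^sup>2 / (w q y)\<^sup>2 = 1" using wpos[OF q True] by simp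
      finally show ?thesis using True by (simp add: p_def topspace_nsphere_iff)
    next
      case False
      then show ?thesis using a by (simp add: p_def)
    qed
    ultimately show ?thesis
      by (auto simp: nsphere continuous_map_in_subtopology continuous_map_componentwise_UNIV)
  qed
  show ?thesis
  proof (rule betti_ge_card_spheres[OF k G ci cp _ a])
    fix q s assume q: "q \<in> G" and s: "s \<in> topspace (nsphere k)"
    have "(i q s - c q) \<bullet> e j = 2 * r * s j" if "j \<le> k" for j
      using that by (simp add: i_def sphere_point_inner)
    moreover from this have "w q (i q s) = sqrt (\<Sum>j\<le>k. (2 * r * s j)\<^sup>2)" by (simp add: w_def)
    then have "w q (i q s) = 2 * r" using s r
      by (simp add: power_mult_distrib topspace_nsphere_iff real_sqrt_mult flip: sum_distrib_left)
    ultimately show "p q (i q s) = s"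
      using iY[OF q s] r s by (auto simp: p_def topspace_nsphere_iff)
  next
    fix q q' s assume q: "q \<in> G" "q' \<in> G" "q \<noteq> q'" and s: "s \<in> topspace (nsphere k)"
    have "B q' \<subseteq> P - B q" using disj[OF q] sub[OF q(2)] by auto
    then have "?Y q' \<subseteq> ?Z q" by (auto simp: ball_union_def)
    then have "i q' s \<notin> ?Y q" using iY[OF q(2) s] YZ(2)[OF q(1)] by auto
    then show "p q (i q' s) = a" by (simp add: p_def)
  qed
qed

end

section \<open>Cubical grids\<close>

definition grid_index :: "real \<Rightarrow> real ^ 'm \<Rightarrow> int ^ 'm" where
  "grid_index h x = (\<chi> i. \<lfloor>x $ i / h\<rfloor>)"

text \<open>As fibres of an index map the cubes are half-open and partition space, so the
  disjointness on which independence of Poisson counts rests is immediate.\<close>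

definition grid_cube :: "real \<Rightarrow> int ^ 'm \<Rightarrow> (real ^ 'm) set" where
  "grid_cube h z = {x. grid_index h x = z}"

definition grid_center :: "real \<Rightarrow> int ^ 'm \<Rightarrow> real ^ 'm" where
  "grid_center h z = (\<chi> i. (of_int (z $ i) + 1/2) * h)"

lemma mem_grid_cube_iff:
  assumes "h > 0"
  shows "x \<in> grid_cube h z \<longleftrightarrow> (\<forall>i. of_int (z $ i) * h \<le> x $ i \<and> x $ i < (of_int (z $ i) + 1) * h)"
  using assms by (simp add: grid_cube_def grid_index_def vec_eq_iff floor_eq_iff pos_le_divide_eq pos_divide_less_eq)

lemma grid_cube_disjoint: "z \<noteq> z' \<Longrightarrow> grid_cube h z \<inter> grid_cube h z' = {}"
  by (auto simp: grid_cube_def)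

lemma grid_cube_diameter:
  fixes x y :: "real ^ 'm"
  assumes "h > 0" "x \<in> grid_cube h z" "y \<in> grid_cube h z"
  shows "norm (x - y) \<le> real CARD('m) * h"
proof -
  \<comment> \<open>The sum norm gives the factor m instead of its square root, which affects
    constants only.\<close>
  have "norm (x - y) \<le> (\<Sum>i\<in>UNIV. \<bar>(x - y) $ i\<bar>)" by (rule norm_le_l1_cart)
  also have "\<dots> \<le> (\<Sum>i\<in>(UNIV::'m set). h)"
  proof (rule sum_mono)
    fix i
    have "of_int (z $ i) * h \<le> x $ i" "x $ i < (of_int (z $ i) + 1) * h"
      "of_int (z $ i) * h \<le> y $ i" "y $ i < (of_int (z $ i) + 1) * h"
      using assms by (auto simp: mem_grid_cube_iff)
    then show "\<bar>(x - y) $ i\<bar> \<le> h" by (simp add: algebra_simps abs_le_iff)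
  qed
  finally show ?thesis by simp
qed

text \<open>Read contrapositively: a point outside a cube is at least h/2 from its centre. This
  separates a sphere in the middle of a block from everything outside the block.\<close>

lemma near_grid_center_in_grid_cube:
  assumes "h > 0" "norm (x - grid_center h z) < h / 2"
  shows "x \<in> grid_cube h z"
  unfolding mem_grid_cube_iff[OF assms(1)]
proof
  fix i
  have "\<bar>(x - grid_center h z) $ i\<bar> < h / 2"
    using component_le_norm_cart[of "x - grid_center h z" i] assms(2) by linarith
  then have "\<bar>x $ i - (of_int (z $ i) * h + h / 2)\<bar> < h / 2"
    by (simp add: grid_center_def distrib_right)
  moreover have "(of_int (z $ i) + 1) * h = of_int (z $ i) * h + h" by (simp add: distrib_right)
  ultimately show "of_int (z $ i) * h \<le> x $ i \<and> x $ i < (of_int (z $ i) + 1) * h"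
    by linarith
qed

lemma grid_center_in_grid_cube: "h > 0 \<Longrightarrow> grid_center h z \<in> grid_cube h z"
  by (rule near_grid_center_in_grid_cube) auto

lemma borel_grid_cube [measurable]:
  fixes z :: "int ^ 'm"
  assumes "h > 0"
  shows "grid_cube h z \<in> sets borel"
proof -
  have "grid_cube h z = (\<Inter>i\<in>UNIV. {x::real^'m. of_int (z $ i) * h \<le> x $ i} \<inter> {x. x $ i < (of_int (z $ i) + 1) * h})"
    using assms by (auto simp: mem_grid_cube_iff)
  also have "\<dots> \<in> sets borel"
    by (intro sets.finite_INT borel_open borel_closed sets.Int open_halfspace_component_lt_cart)
       (auto simp: closed_halfspace_component_ge_cart)
  finally show ?thesis .
qed

text \<open>The half-open cube lies between an open and a closed box of equal volume.\<close>

lemma emeasure_grid_cube: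
  fixes z :: "int ^ 'm"
  assumes "h > 0"
  shows "emeasure lborel (grid_cube h z) = ennreal (h ^ CARD('m))"
proof -
  let ?a = "(\<chi> i. of_int (z $ i) * h) :: real ^ 'm" and ?b = "(\<chi> i. (of_int (z $ i) + 1) * h) :: real ^ 'm"
  have eq: "(\<Prod>b\<in>Basis. (?b - ?a) \<bullet> b) = h ^ CARD('m)"
  proof -
    have "(?b - ?a) \<bullet> b = h" if "b \<in> Basis" for b
      using that by (auto simp: Basis_vec_def inner_axis algebra_simps)
    then show ?thesis by simp
  qed
  have le: "?a \<bullet> b \<le> ?b \<bullet> b" if "b \<in> Basis" for b
    using that assms by (auto simp: Basis_vec_def inner_axis)
  have "emeasure lborel (grid_cube h z) \<le> emeasure lborel (cbox ?a ?b)"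
    using assms by (intro emeasure_mono) (auto simp: mem_grid_cube_iff cbox_def Basis_vec_def inner_axis less_imp_le)
  moreover have "emeasure lborel (box ?a ?b) \<le> emeasure lborel (grid_cube h z)"
    using assms by (intro emeasure_mono) (auto simp: mem_grid_cube_iff box_def Basis_vec_def inner_axis less_imp_le)
  ultimately show ?thesis
    using le eq by (simp add: emeasure_lborel_cbox emeasure_lborel_box)
qed

text \<open>Dividing and rounding down may be done in two stages, also for negative coordinates,
  since \<open>div\<close> by a positive integer rounds down as the floor does.\<close>

lemma grid_cube_subdivide:
  assumes "h > 0" "N > 0"
  shows "grid_cube (real N * h) z = (\<Union>z'\<in>{z'. \<forall>i. z' $ i div int N = z $ i}. grid_cube h z')"
proof -
  have "\<lfloor>x $ i / (real N * h)\<rfloor> = \<lfloor>x $ i / h\<rfloor> div int N" for x :: "real ^ 'a" and i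
    using floor_divide_real_eq_div[of "int N" "x $ i / h"] by (simp add: mult.commute)
  then have "grid_index (real N * h) x = z \<longleftrightarrow> (\<forall>i. grid_index h x $ i div int N = z $ i)" for x :: "real ^ 'a"
    by (simp add: grid_index_def vec_eq_iff)
  then show ?thesis by (auto simp: grid_cube_def)
qed

lemma grid_cube_children:
  fixes z :: "int ^ 'm"
  assumes "N > 0"
  shows "finite {z' :: int ^ 'm. \<forall>i. z' $ i div int N = z $ i}"
    "card {z' :: int ^ 'm. \<forall>i. z' $ i div int N = z $ i} \<le> N ^ CARD('m)"
proof -
  let ?S = "{z' :: int ^ 'm. \<forall>i. z' $ i div int N = z $ i}"
  let ?T = "PiE (UNIV :: 'm set) (\<lambda>i. {z $ i * int N ..< z $ i * int N + int N})"
  have sub: "vec_nth ` ?S \<subseteq> ?T"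
  proof (rule subsetI)
    fix g assume "g \<in> vec_nth ` ?S"
    then obtain z' :: "int ^ 'm" where z': "\<And>i. z' $ i div int N = z $ i" "g = vec_nth z'" by auto
    have "z $ i * int N \<le> z' $ i \<and> z' $ i < z $ i * int N + int N" for i
    proof -
      have "z' $ i = z $ i * int N + z' $ i mod int N" using z'(1) by (metis div_mult_mod_eq)
      moreover have "0 \<le> z' $ i mod int N" "z' $ i mod int N < int N" using assms by auto
      ultimately show ?thesis by linarith
    qed
    then show "g \<in> ?T" using z'(2) by (intro PiE_I) auto
  qed
  have fin: "finite ?T" by (intro finite_PiE) auto
  have inj: "inj_on vec_nth ?S" by (auto simp: inj_on_def vec_eq_iff)
  show "finite ?S" using finite_subset[OF sub fin] inj finite_imageD by blast
  have "card ?S = card (vec_nth ` ?S)" using card_image[OF inj] by simp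
  also have "\<dots> \<le> card ?T" using sub fin by (rule card_mono[rotated])
  also have "\<dots> = N ^ CARD('m)" by (simp add: card_PiE)
  finally show "card ?S \<le> N ^ CARD('m)" .
qed

text \<open>Disjoint cubes of volume h^m are packed into \<open>U\<close>. Finite sets of indices
  are treated first, because the uniform bound for them is what shows that the whole index set is
  finite.\<close>

lemma card_grid_index_le:
  fixes S U :: "(real ^ 'm) set"
  assumes h: "h > 0" and U: "U \<in> sets borel" "emeasure lborel U < \<infinity>"
    and sub: "\<And>z. z \<in> grid_index h ` S \<Longrightarrow> grid_cube h z \<subseteq> U"
  shows "finite (grid_index h ` S)" "real (card (grid_index h ` S)) * h ^ CARD('m) \<le> measure lborel U"
proof -
  have bound: "real (card F) * h ^ CARD('m) \<le> measure lborel U" if F: "finite F" "F \<subseteq> grid_index h ` S" for F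
  proof -
    have "ennreal (real (card F) * h ^ CARD('m)) = (\<Sum>z\<in>F. emeasure lborel (grid_cube h z))"
      using h by (simp add: emeasure_grid_cube ennreal_mult ennreal_of_nat_eq_real_of_nat)
    also have "\<dots> = emeasure lborel (\<Union>z\<in>F. grid_cube h z)"
      using h F by (intro sum_emeasure) (auto simp: disjoint_family_on_def grid_cube_disjoint)
    also have "\<dots> \<le> emeasure lborel U"
    proof (rule emeasure_mono)
      show "(\<Union>z\<in>F. grid_cube h z) \<subseteq> U" using sub F(2) by (intro UN_least) (rule sub, rule subsetD)
    qed (use U(1) in simp)
    also have "\<dots> = ennreal (measure lborel U)"
      using U by (simp add: emeasure_eq_ennreal_measure)
    finally show ?thesis by (simp add: ennreal_le_iff)
  qed
  have "finite (grid_index h ` S) \<and> card (grid_index h ` S) \<le> nat \<lceil>measure lborel U / h ^ CARD('m)\<rceil>"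
  proof (rule finite_if_finite_subsets_card_bdd)
    fix F assume "F \<subseteq> grid_index h ` S" "finite F"
    then have "real (card F) \<le> measure lborel U / h ^ CARD('m)"
      using bound[of F] h by (simp add: field_simps)
    then show "card F \<le> nat \<lceil>measure lborel U / h ^ CARD('m)\<rceil>" by linarith
  qed
  then show fin: "finite (grid_index h ` S)" ..
  show "real (card (grid_index h ` S)) * h ^ CARD('m) \<le> measure lborel U"
    using bound[OF fin] by simp
qed

lemma grid_cube_subset_cball:
  fixes x :: "real ^ 'm"
  assumes "h > 0" "x \<in> cball x0 \<rho>" "z = grid_index h x"
  shows "grid_cube h z \<subseteq> cball x0 (\<rho> + real CARD('m) * h)"
proof
  fix y assume y: "y \<in> grid_cube h z"
  have "x \<in> grid_cube h z" using assms by (simp add: grid_cube_def)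
  then have "dist x y \<le> real CARD('m) * h" using grid_cube_diameter[OF assms(1) _ y] by (simp add: dist_norm)
  then show "y \<in> cball x0 (\<rho> + real CARD('m) * h)"
    using assms(2) dist_triangle[of x0 y x] by simp
qed

text \<open>Most cubes meeting a compact set of positive measure are nearly filled by it, because the set
  has an open neighbourhood of only slightly larger measure.\<close>

lemma nearly_full_grid_cubes:
  fixes K U :: "(real ^ 'm) set"
  assumes K: "compact K" "measure lborel K > 0" and U: "open U" "K \<subseteq> U" and \<eta>: "\<eta> > 0"
  obtains h0 where "h0 > 0" "\<And>h. 0 < h \<Longrightarrow> h < h0 \<Longrightarrow>
     \<exists>G. finite G \<and> measure lborel K / 2 \<le> real (card G) * h ^ CARD('m) \<and>
       (\<forall>z\<in>G. grid_cube h z \<subseteq> U \<and> measure lborel (grid_cube h z - K) \<le> \<eta> * h ^ CARD('m))"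
proof -
  let ?k = "measure lborel K"
  have Kb: "K \<in> sets borel" using K(1) by (simp add: borel_compact)
  have Kfin: "emeasure lborel K < \<infinity>" using K(1) by (simp add: emeasure_compact_finite[unfolded infinity_ennreal_def])
  \<comment> \<open>The tolerance is set for the count below: every bad cube takes more than \<eta>
    h^m from \<open>U' - K\<close>, so the bad cubes have total volume below half the measure of
    \<open>K\<close>, whereas all cubes together have at least the measure of
    \<open>K\<close>.\<close>
  obtain U1 where U1: "open U1" "K \<subseteq> U1" "emeasure lborel (U1 - K) < ennreal (\<eta> * ?k / 2)"
    using outer_regular_lborel[of K "\<eta> * ?k / 2"] Kb K(2) \<eta> by auto
  define U' where "U' = U1 \<inter> U"
  have U': "open U'" "K \<subseteq> U'" "U' \<subseteq> U" using U U1 by (auto simp: U'_def)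
  have U'K: "emeasure lborel (U' - K) < ennreal (\<eta> * ?k / 2)"
    by (rule le_less_trans[OF emeasure_mono U1(3)]) (use U1 Kb in \<open>auto simp: U'_def\<close>)
  obtain e where e: "e > 0" "(\<Union>x\<in>K. ball x e) \<subseteq> U'"
    using compact_subset_open_imp_ball_epsilon_subset[OF K(1) U'(1,2)] by blast
  have Ufin: "emeasure lborel U' < \<infinity>"
  proof -
    have "emeasure lborel U' \<le> emeasure lborel K + emeasure lborel (U' - K)"
      using U' Kb by (subst plus_emeasure) (auto simp: Un_absorb1)
    also have "\<dots> < \<infinity>" using Kfin less_trans[OF U'K ennreal_less_top] by simp
    finally show ?thesis .
  qed
  show thesis
  \<comment> \<open>Cubes have diameter at most m h, so below this threshold a cube meeting
    \<open>K\<close> stays within distance e of it.\<close>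
  proof (rule that[of "e / real CARD('m)"])
    show "e / real CARD('m) > 0" using e by simp
    fix h assume h: "0 < h" "h < e / real CARD('m)"
    then have he: "real CARD('m) * h < e" by (simp add: field_simps)
    define I where "I = grid_index h ` K"
    have sub: "grid_cube h z \<subseteq> U'" if "z \<in> I" for z
    proof
      fix y assume y: "y \<in> grid_cube h z"
      from that obtain x where x: "x \<in> K" "x \<in> grid_cube h z" by (auto simp: I_def grid_cube_def)
      then have "dist x y < e" using grid_cube_diameter[OF h(1) x(2) y] he by (simp add: dist_norm)
      then have "y \<in> (\<Union>x\<in>K. ball x e)" using x(1) by auto
      then show "y \<in> U'" using e(2) by (rule subsetD[rotated])
    qed
    have fin: "finite I"
      unfolding I_def using sub U'(1) Ufin h(1) by (intro card_grid_index_le[of h U']) (auto simp: I_def)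
    have cov: "?k \<le> real (card I) * h ^ CARD('m)"
    proof -
      have "K \<subseteq> (\<Union>z\<in>I. grid_cube h z)" by (auto simp: I_def grid_cube_def)
      then have "emeasure lborel K \<le> emeasure lborel (\<Union>z\<in>I. grid_cube h z)"
        using h fin by (intro emeasure_mono) auto
      also have "\<dots> \<le> (\<Sum>z\<in>I. emeasure lborel (grid_cube h z))"
        using h fin by (intro emeasure_subadditive_finite) auto
      also have "\<dots> = ennreal (real (card I) * h ^ CARD('m))"
        using h by (simp add: emeasure_grid_cube ennreal_mult ennreal_of_nat_eq_real_of_nat)
      finally show ?thesis using Kfin h by (simp add: emeasure_eq_ennreal_measure ennreal_le_iff)
    qed
    define Bad where "Bad = {z\<in>I. measure lborel (grid_cube h z - K) > \<eta> * h ^ CARD('m)}"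
    have dfin: "emeasure lborel (grid_cube h z - K) < \<infinity>" for z
    proof -
      have "emeasure lborel (grid_cube h z - K) \<le> emeasure lborel (grid_cube h z)"
        using h(1) by (intro emeasure_mono Diff_subset) simp
      also have "\<dots> < \<infinity>" using h(1) by (simp add: emeasure_grid_cube)
      finally show ?thesis .
    qed
    have "ennreal (real (card Bad) * (\<eta> * h ^ CARD('m))) = (\<Sum>z\<in>Bad. ennreal (\<eta> * h ^ CARD('m)))"
      using h \<eta> by (simp add: ennreal_mult ennreal_of_nat_eq_real_of_nat)
    also have "\<dots> \<le> (\<Sum>z\<in>Bad. emeasure lborel (grid_cube h z - K))"
    proof (rule sum_mono)
      fix z assume "z \<in> Bad"
      then have "\<eta> * h ^ CARD('m) \<le> measure lborel (grid_cube h z - K)" by (simp add: Bad_def)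
      moreover have "emeasure lborel (grid_cube h z - K) \<noteq> \<infinity>" using dfin[of z] by simp
      ultimately show "ennreal (\<eta> * h ^ CARD('m)) \<le> emeasure lborel (grid_cube h z - K)"
        by (simp add: emeasure_eq_ennreal_measure ennreal_leI)
    qed
    also have "\<dots> = emeasure lborel (\<Union>z\<in>Bad. grid_cube h z - K)"
      using h fin Kb grid_cube_disjoint[of _ _ h]
      by (intro sum_emeasure) (auto simp: Bad_def disjoint_family_on_def)
    also have "\<dots> \<le> emeasure lborel (U' - K)"
      using sub U' Kb by (intro emeasure_mono) (auto simp: Bad_def)
    also have "\<dots> < ennreal (\<eta> * ?k / 2)" by (rule U'K)
    finally have "real (card Bad) * (\<eta> * h ^ CARD('m)) < \<eta> * ?k / 2"
      using h \<eta> by (subst (asm) ennreal_less_iff) auto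
    then have bad: "real (card Bad) * h ^ CARD('m) < ?k / 2" using \<eta> by (simp add: field_simps)
    have "card (I - Bad) = card I - card Bad" "card Bad \<le> card I"
      using fin by (auto simp: Bad_def card_Diff_subset card_mono)
    then have "real (card (I - Bad)) * h ^ CARD('m) = real (card I) * h ^ CARD('m) - real (card Bad) * h ^ CARD('m)"
      by (simp add: of_nat_diff left_diff_distrib)
    then have "?k / 2 \<le> real (card (I - Bad)) * h ^ CARD('m)" using bad cov by linarith
    moreover have "\<forall>z\<in>I - Bad. grid_cube h z \<subseteq> U \<and> measure lborel (grid_cube h z - K) \<le> \<eta> * h ^ CARD('m)"
      using sub U'(3) by (force simp: Bad_def)
    ultimately show "\<exists>G. finite G \<and> ?k / 2 \<le> real (card G) * h ^ CARD('m) \<and>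
       (\<forall>z\<in>G. grid_cube h z \<subseteq> U \<and> measure lborel (grid_cube h z - K) \<le> \<eta> * h ^ CARD('m))"
      using fin by (intro exI[of _ "I - Bad"]) auto
  qed
qed

section \<open>Charts and Riemannian volume\<close>

lemma smooth_on_differentiable: "smooth_on V \<phi> \<Longrightarrow> x \<in> V \<Longrightarrow> \<phi> differentiable (at x)"
  unfolding smooth_on_def by (drule spec[of _ "Suc 0"]) simp

lemma smooth_on_continuous_derivative:
  "smooth_on V \<phi> \<Longrightarrow> continuous_on V (\<lambda>x. frechet_derivative \<phi> (at x) v)"
  unfolding smooth_on_def by (drule spec[of _ "Suc 0"]) simp

lemma continuous_on_volume_element:
  assumes "smooth_on V \<phi>"
  shows "continuous_on V (volume_element \<phi>)"
proof -
  define J where "J i j x = matrix (frechet_derivative \<phi> (at x)) $ i $ j" for i j x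
  have "continuous_on V (J i j)" for i j
    unfolding J_def matrix_def using smooth_on_continuous_derivative[OF assms, of "axis j 1"]
    by (simp add: continuous_on_component)
  \<comment> \<open>The Leibniz formula: the Gram determinant is a polynomial in the entries of the
    Jacobian matrix.\<close>
  moreover have "volume_element \<phi> = (\<lambda>x. sqrt (\<Sum>p | p permutes UNIV.
      of_int (sign p) * (\<Prod>i\<in>UNIV. \<Sum>l\<in>UNIV. J l i x * J l (p i) x)))"
    by (simp add: fun_eq_iff volume_element_def det_def matrix_matrix_mult_def transpose_def J_def Let_def)
  ultimately show ?thesis by (auto intro!: continuous_intros)
qed

text \<open>\<open>L\<close> will be the derivative at the centre, but the estimate concerns
  arbitrary pairs of points. An error of \<sigma>/12 leaves more than \<sigma>/2 of the expansion of
  \<open>L\<close>, and over a distance of 3 r/\<sigma> it amounts to r/4, the share granted to the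
  nonlinearity.\<close>

locale flat_chart =
  fixes \<phi> :: "real ^ 'm \<Rightarrow> real ^ 'd" and W :: "(real ^ 'm) set"
    and L :: "real ^ 'm \<Rightarrow> real ^ 'd" and \<sigma> :: real
  assumes lin: "linear L" and \<sigma>: "\<sigma> > 0" and below: "\<And>v. \<sigma> * norm v \<le> norm (L v)"
    and approx: "\<And>x y. x \<in> W \<Longrightarrow> y \<in> W \<Longrightarrow> norm (\<phi> x - \<phi> y - L (x - y)) \<le> \<sigma> / 12 * norm (x - y)"
begin

lemma expand:
  assumes "x \<in> W" "y \<in> W"
  shows "\<sigma> / 2 * norm (x - y) \<le> norm (\<phi> x - \<phi> y)"
proof -
  have "norm (L (x - y)) - norm (\<phi> x - \<phi> y - L (x - y)) \<le> norm (\<phi> x - \<phi> y)"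
    using norm_triangle_ineq4[of "\<phi> x - \<phi> y" "\<phi> x - \<phi> y - L (x - y)"] by simp
  moreover have "\<sigma> / 12 * norm (x - y) \<le> \<sigma> / 2 * norm (x - y)"
    using \<sigma> by (intro mult_right_mono) auto
  ultimately show ?thesis using approx[OF assms] below[of "x - y"] by (simp add: field_simps)
qed

lemma inj_on_chart: "inj_on \<phi> W"
proof (rule inj_onI)
  fix x y assume "x \<in> W" "y \<in> W" "\<phi> x = \<phi> y"
  then have "\<sigma> / 2 * norm (x - y) \<le> 0" using expand[of x y] by simp
  then have "norm (x - y) \<le> 0" using \<sigma> by (simp add: mult_le_0_iff)
  then show "x = y" by simp
qed

lemma lipschitz:
  assumes "x \<in> W" "y \<in> W"
  shows "norm (\<phi> x - \<phi> y) \<le> (onorm L + \<sigma>) * norm (x - y)"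
proof -
  have "norm (\<phi> x - \<phi> y) \<le> norm (\<phi> x - \<phi> y - L (x - y)) + norm (L (x - y))"
    using norm_triangle_ineq[of "\<phi> x - \<phi> y - L (x - y)" "L (x - y)"] by simp
  also have "\<dots> \<le> \<sigma> * norm (x - y) + onorm L * norm (x - y)"
  proof (rule add_mono)
    have "\<sigma> / 12 * norm (x - y) \<le> \<sigma> * norm (x - y)" using \<sigma> by (intro mult_right_mono) auto
    then show "norm (\<phi> x - \<phi> y - L (x - y)) \<le> \<sigma> * norm (x - y)" using approx[OF assms] by linarith
    show "norm (L (x - y)) \<le> onorm L * norm (x - y)"
      using lin by (intro onorm) (simp add: linear_conv_bounded_linear)
  qed
  finally show ?thesis by (simp add: distrib_right)
qed

lemma onorm_nonneg: "0 \<le> onorm L"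
  using lin by (intro onorm_pos_le) (simp add: linear_conv_bounded_linear)

end

text \<open>Injectivity of the derivative gives \<sigma> by finite dimension. By continuity the
  derivative stays within \<sigma>/12 of its value at \<open>x0\<close> on a small ball, and the
  mean value inequality on this convex set turns that into an estimate for pairs of points.\<close>

lemma flat_chart_exists:
  fixes \<phi> :: "real ^ 'm \<Rightarrow> real ^ 'd"
  assumes smooth: "smooth_on V \<phi>" and V: "open V" "x0 \<in> V"
    and inj: "inj (frechet_derivative \<phi> (at x0))"
  obtains \<rho> L \<sigma> b where "\<rho> > 0" "ball x0 \<rho> \<subseteq> V" "flat_chart \<phi> (ball x0 \<rho>) L \<sigma>"
    "b > 0" "\<And>x. x \<in> ball x0 \<rho> \<Longrightarrow> volume_element \<phi> x \<le> b"
proof -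
  let ?D = "\<lambda>x. frechet_derivative \<phi> (at x)"
  have der: "(\<phi> has_derivative ?D x) (at x)" if "x \<in> V" for x
    using smooth_on_differentiable[OF smooth that] by (simp add: frechet_derivative_works)
  have bl: "bounded_linear (?D x)" if "x \<in> V" for x
    using der[OF that] by (rule has_derivative_bounded_linear)
  have lin: "linear (?D x0)" using bl[OF V(2)] by (rule bounded_linear.linear)
  obtain \<sigma> where \<sigma>: "\<sigma> > 0" "\<And>v. \<sigma> * norm v \<le> norm (?D x0 v)"
    using linear_inj_bounded_below_pos[OF lin inj] by metis
  \<comment> \<open>\<open>smooth_on\<close> yields continuity of the derivative in each fixed
    direction; the sum over a basis dominates the operator norm of the difference.\<close>
  define S where "S x = (\<Sum>b\<in>Basis. norm (?D x b - ?D x0 b))" for x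
  have "continuous_on V S"
    unfolding S_def by (intro continuous_intros smooth_on_continuous_derivative smooth)
  then have "isCont S x0" using V by (simp add: continuous_on_eq_continuous_at)
  moreover have "S x0 = 0" by (simp add: S_def)
  ultimately have "eventually (\<lambda>x. S x < \<sigma> / 12) (at x0)"
    using \<sigma> order_tendstoD(2)[of S 0 "at x0" "\<sigma> / 12"] by (simp add: isCont_def)
  then have ev1: "eventually (\<lambda>x. S x < \<sigma> / 12) (nhds x0)"
    using \<open>S x0 = 0\<close> \<sigma> by (simp add: eventually_nhds_conv_at)
  have "isCont (volume_element \<phi>) x0"
    using continuous_on_volume_element[OF smooth] V by (simp add: continuous_on_eq_continuous_at)
  then have "eventually (\<lambda>x. volume_element \<phi> x < \<bar>volume_element \<phi> x0\<bar> + 1) (at x0)"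
    by (auto simp: isCont_def intro!: order_tendstoD)
  then have ev2: "eventually (\<lambda>x. volume_element \<phi> x < \<bar>volume_element \<phi> x0\<bar> + 1) (nhds x0)"
    by (simp add: eventually_nhds_conv_at)
  have "eventually (\<lambda>x. x \<in> V) (nhds x0)" using V by (simp add: eventually_nhds_in_open)
  with ev1 ev2 have "eventually (\<lambda>x. S x < \<sigma> / 12 \<and> volume_element \<phi> x < \<bar>volume_element \<phi> x0\<bar> + 1 \<and> x \<in> V) (nhds x0)"
    by (intro eventually_conj)
  then obtain \<rho> where \<rho>: "\<rho> > 0"
    "\<And>x. dist x x0 < \<rho> \<Longrightarrow> S x < \<sigma> / 12 \<and> volume_element \<phi> x < \<bar>volume_element \<phi> x0\<bar> + 1 \<and> x \<in> V"
    unfolding eventually_nhds_metric by blast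
  have onorm_le: "onorm (\<lambda>v. ?D x v - ?D x0 v) \<le> \<sigma> / 12" if "x \<in> ball x0 \<rho>" for x
  proof -
    have x: "x \<in> V" "S x < \<sigma> / 12" using \<rho>(2)[of x] that by (auto simp: dist_commute)
    have "onorm (\<lambda>v. ?D x v - ?D x0 v) \<le> S x"
      unfolding S_def using bl[OF x(1)] bl[OF V(2)]
      by (intro onorm_componentwise bounded_linear_sub)
    then show ?thesis using x(2) by simp
  qed
  have "flat_chart \<phi> (ball x0 \<rho>) (?D x0) \<sigma>"
  proof
    fix x y assume xy: "x \<in> ball x0 \<rho>" "y \<in> ball x0 \<rho>"
    have "norm (\<phi> x - \<phi> y - ?D x0 (x - y)) \<le> norm (x - y) * (\<sigma> / 12)"
    proof (rule differentiable_bound_linearization[where S = "ball x0 \<rho>" and f' = ?D])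
      fix t :: real assume "t \<in> {0..1}"
      then have "(1 - t) *\<^sub>R y + t *\<^sub>R x \<in> ball x0 \<rho>"
        using xy by (intro convexD_alt[OF convex_ball]) auto
      then show "y + t *\<^sub>R (x - y) \<in> ball x0 \<rho>" by (simp add: algebra_simps)
    next
      fix z assume "z \<in> ball x0 \<rho>"
      then show "(\<phi> has_derivative ?D z) (at z within ball x0 \<rho>)"
        using \<rho>(2)[of z] der by (auto simp: dist_commute intro: has_derivative_at_withinI)
    next
      fix z assume "z \<in> ball x0 \<rho>"
      then show "onorm (?D z - ?D x0) \<le> \<sigma> / 12" using onorm_le by (simp add: fun_diff_def)
    qed (use \<rho>(1) in auto)
    then show "norm (\<phi> x - \<phi> y - ?D x0 (x - y)) \<le> \<sigma> / 12 * norm (x - y)" by (simp add: mult.commute)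
  qed (use lin \<sigma> in \<open>auto intro: linear_add linear_scale\<close>)
  moreover have "ball x0 \<rho> \<subseteq> V" using \<rho>(2) by (auto simp: dist_commute)
  moreover have "volume_element \<phi> x \<le> \<bar>volume_element \<phi> x0\<bar> + 1" if "x \<in> ball x0 \<rho>" for x
    using \<rho>(2)[of x] that by (auto simp: dist_commute)
  ultimately show thesis using that[of \<rho> "?D x0" \<sigma> "\<bar>volume_element \<phi> x0\<bar> + 1"] \<rho>(1) by auto
qed

locale good_chart = flat_chart \<phi> "ball x0 \<rho>" L \<sigma>
  for \<phi> :: "real ^ 'm \<Rightarrow> real ^ 'd" and x0 \<rho> L \<sigma> +
  fixes M :: "(real ^ 'd) set" and V :: "(real ^ 'm) set" and vol :: "(real ^ 'd) measure" and b :: real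
  assumes compact_M: "compact M" and param: "local_parametrization M V \<phi>"
    and volume: "riemannian_volume TYPE('m) M vol"
    and \<rho>: "\<rho> > 0" and sub: "ball x0 \<rho> \<subseteq> V"
    and b: "b > 0" and vol_le: "\<And>x. x \<in> ball x0 \<rho> \<Longrightarrow> volume_element \<phi> x \<le> b"
begin

section \<open>Borel sets and volume in a chart\<close>

lemma V_open: "open V" and V_smooth: "smooth_on V \<phi>" and image_open: "openin (top_of_set M) (\<phi> ` V)"
  using param by (auto simp: local_parametrization_def)

lemma homeo: obtains \<psi> where "homeomorphism V (\<phi> ` V) \<phi> \<psi>"
  using param by (auto simp: local_parametrization_def)

lemma continuous_on_chart: "continuous_on V \<phi>"
  using homeo by (metis homeomorphism_cont1)

lemma inj_on_V: "inj_on \<phi> V"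
  using homeo by (metis homeomorphism_apply1 inj_on_inverseI)

lemma image_V_subset: "\<phi> ` V \<subseteq> M"
  using image_open openin_imp_subset by blast

lemma sets_vol: "A \<in> sets vol \<longleftrightarrow> A \<subseteq> M \<and> A \<in> sets borel"
proof -
  have "M \<in> sets borel" using compact_M by (simp add: borel_compact)
  then show ?thesis using volume by (auto simp: riemannian_volume_def sets_restrict_space_iff)
qed

lemma space_vol: "space vol = M"
  using volume sets_eq_imp_space_eq[of vol "restrict_space borel M"]
  by (auto simp: riemannian_volume_def space_restrict_space)

lemma openin_image: "openin (top_of_set M) (\<phi> ` U)" if "open U" "U \<subseteq> V"
proof -
  obtain \<psi> where \<psi>: "homeomorphism V (\<phi> ` V) \<phi> \<psi>" by (rule homeo)
  have "openin (top_of_set V) U" using that by (simp add: open_openin_trans V_open)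
  then have "openin (top_of_set (\<phi> ` V)) (\<phi> ` U)"
    using homeomorphism_imp_open_map[OF \<psi>] by auto
  then show ?thesis using image_open by (rule openin_trans)
qed

lemma borel_vimage: "V \<inter> \<phi> -` A \<in> sets borel" if "A \<in> sets borel"
proof -
  have "\<phi> \<in> borel_measurable (restrict_space borel V)"
    using continuous_on_chart by (rule borel_measurable_continuous_on_restrict)
  from measurable_sets[OF this that] have "\<phi> -` A \<inter> V \<in> sets (restrict_space borel V)"
    by (simp add: space_restrict_space)
  then show ?thesis
    using V_open by (auto simp: sets_restrict_space_iff Int_commute)
qed

text \<open>Continuous images of Borel sets need not be Borel. Here the image is a preimage under
  the continuous inverse, taken inside the image of \<open>V\<close>, which is Borel as a relatively
  open part of the compact set \<open>M\<close>.\<close>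

lemma borel_image: "\<phi> ` B \<in> sets borel" if "B \<in> sets borel" "B \<subseteq> V"
proof -
  obtain \<psi> where \<psi>: "homeomorphism V (\<phi> ` V) \<phi> \<psi>" by (rule homeo)
  obtain U where "open U" "\<phi> ` V = M \<inter> U" using image_open by (auto simp: openin_open)
  then have bV: "\<phi> ` V \<in> sets borel"
    using borel_compact[OF compact_M] by (simp add: sets.Int borel_open)
  have "\<psi> \<in> borel_measurable (restrict_space borel (\<phi> ` V))"
    using homeomorphism_cont2[OF \<psi>] by (rule borel_measurable_continuous_on_restrict)
  from measurable_sets[OF this that(1)] have "\<psi> -` B \<inter> \<phi> ` V \<in> sets (restrict_space borel (\<phi> ` V))"
    by (simp add: space_restrict_space)
  then have "\<psi> -` B \<inter> \<phi> ` V \<in> sets borel" using bV by (auto simp: sets_restrict_space_iff)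
  also have "\<psi> -` B \<inter> \<phi> ` V = \<phi> ` B"
    using that(2) homeomorphism_apply1[OF \<psi>] by (auto simp: image_iff)
  finally show ?thesis .
qed

lemma image_in_sets_vol: "\<phi> ` B \<in> sets vol" if "B \<in> sets borel" "B \<subseteq> V"
  using borel_image[OF that] that(2) image_V_subset by (auto simp: sets_vol)

lemma emeasure_vol: "A \<in> sets borel \<Longrightarrow> A \<subseteq> \<phi> ` V \<Longrightarrow>
    emeasure vol A = (\<integral>\<^sup>+x\<in>V \<inter> \<phi> -` A. ennreal (volume_element \<phi> x) \<partial>lborel)"
  using volume param unfolding riemannian_volume_def by blast

lemma emeasure_vol_image: "emeasure vol (\<phi> ` B) = (\<integral>\<^sup>+x\<in>B. ennreal (volume_element \<phi> x) \<partial>lborel)"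
  if "B \<in> sets borel" "B \<subseteq> V"
proof -
  have "V \<inter> \<phi> -` (\<phi> ` B) = B" using inj_on_V that(2) by (auto simp: inj_on_def subset_iff)
  then show ?thesis using emeasure_vol[OF borel_image[OF that]] that(2) by (simp add: image_mono)
qed

lemma emeasure_vol_image_le: "emeasure vol (\<phi> ` B) \<le> ennreal b * emeasure lborel B"
  if "B \<in> sets borel" "B \<subseteq> ball x0 \<rho>"
proof -
  have "emeasure vol (\<phi> ` B) = (\<integral>\<^sup>+x. ennreal (volume_element \<phi> x) * indicator B x \<partial>lborel)"
    using that sub by (intro emeasure_vol_image) auto
  also have "\<dots> \<le> (\<integral>\<^sup>+x. ennreal b * indicator B x \<partial>lborel)"
    using that vol_le by (intro nn_integral_mono) (auto simp: indicator_def intro!: ennreal_leI)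
  also have "\<dots> = ennreal b * emeasure lborel B" using that by (simp add: nn_integral_cmult_indicator)
  finally show ?thesis .
qed

lemma emeasure_vol_image_ge: "ennreal c * emeasure lborel B \<le> emeasure vol (\<phi> ` B)"
  if "B \<in> sets borel" "B \<subseteq> ball x0 \<rho>" "\<And>x. x \<in> B \<Longrightarrow> c \<le> volume_element \<phi> x"
proof -
  have "ennreal c * emeasure lborel B = (\<integral>\<^sup>+x. ennreal c * indicator B x \<partial>lborel)"
    using that by (simp add: nn_integral_cmult_indicator)
  also have "\<dots> \<le> (\<integral>\<^sup>+x. ennreal (volume_element \<phi> x) * indicator B x \<partial>lborel)"
    using that by (intro nn_integral_mono) (auto simp: indicator_def intro!: ennreal_leI)
  also have "\<dots> = emeasure vol (\<phi> ` B)"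
    using that sub by (intro emeasure_vol_image[symmetric]) auto
  finally show ?thesis .
qed

text \<open>Pulling back along the chart enlarges distances at most by the factor 2/\<sigma>, so the
  preimage of a ball of radius R has diameter at most 4 R/\<sigma>. The constant does not depend on
  the centre y.\<close>

lemma emeasure_vol_cball_le:
  assumes "R \<ge> 0"
  shows "emeasure vol (\<phi> ` ball x0 \<rho> \<inter> cball y R)
           \<le> ennreal (b * (unit_ball_vol (real CARD('m)) * (4 / \<sigma>) ^ CARD('m)) * R ^ CARD('m))"
proof -
  define B where "B = ball x0 \<rho> \<inter> (V \<inter> \<phi> -` cball y R)"
  have eq: "\<phi> ` ball x0 \<rho> \<inter> cball y R = \<phi> ` B" using sub by (auto simp: B_def)
  have Bb: "B \<in> sets borel" "B \<subseteq> ball x0 \<rho>"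
    unfolding B_def using borel_vimage[of "cball y R"] by auto
  show ?thesis
  proof (cases "B = {}")
    case False
    \<comment> \<open>The centre y may lie off the image of the chart, so the preimage is enclosed
      in a ball about one of its own points.\<close>
    then obtain x1 where x1: "x1 \<in> B" by auto
    have "B \<subseteq> cball x1 (4 / \<sigma> * R)"
    proof
      fix x assume x: "x \<in> B"
      have "dist (\<phi> x) (\<phi> x1) \<le> 2 * R"
        using x x1 dist_triangle3[of "\<phi> x" "\<phi> x1" y] by (auto simp: B_def)
      then have "\<sigma> / 2 * norm (x - x1) \<le> 2 * R"
        using expand[of x x1] x x1 by (auto simp: B_def dist_norm)
      then show "x \<in> cball x1 (4 / \<sigma> * R)" using \<sigma> by (simp add: dist_norm field_simps norm_minus_commute)
    qed
    then have "emeasure lborel B \<le> emeasure lborel (cball x1 (4 / \<sigma> * R))"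
      by (intro emeasure_mono) auto
    also have "\<dots> = ennreal (unit_ball_vol (real CARD('m)) * (4 / \<sigma> * R) ^ CARD('m))"
      using assms \<sigma> by (subst emeasure_cball) auto
    finally have "ennreal b * emeasure lborel B \<le> ennreal b * ennreal (unit_ball_vol (real CARD('m)) * (4 / \<sigma> * R) ^ CARD('m))"
      by (rule mult_left_mono) simp
    also have "\<dots> = ennreal (b * (unit_ball_vol (real CARD('m)) * (4 / \<sigma>) ^ CARD('m)) * R ^ CARD('m))"
      using b by (subst ennreal_mult'[symmetric]) (simp_all only: power_mult_distrib mult.assoc less_imp_le)
    finally show ?thesis
      unfolding eq using emeasure_vol_image_le[OF Bb] by (rule order_trans[rotated])
  qed (simp add: eq)
qed

text \<open>One point is taken from each grid cube that meets the ball, and the Lipschitz bound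
  controls the image of the rest of the cube. The condition r <= 1 keeps all these cubes in one
  fixed ball, whose volume bounds their number.\<close>

lemma cover_image_by_cballs:
  assumes r: "0 < r" "r \<le> 1"
  shows "\<exists>F. finite F \<and> real (card F) * r ^ CARD('m) \<le> measure lborel (cball x0 (\<rho> + real CARD('m))) \<and>
           \<phi> ` ball x0 \<rho> \<subseteq> (\<Union>y\<in>F. cball y ((onorm L + \<sigma>) * real CARD('m) * r))"
proof -
  let ?I = "grid_index r ` ball x0 \<rho>"
  let ?U = "cball x0 (\<rho> + real CARD('m))"
  have "grid_cube r z \<subseteq> ?U" if "z \<in> ?I" for z
  proof -
    from that obtain x where "x \<in> ball x0 \<rho>" and x2: "z = grid_index r x" by blast
    then have x: "x \<in> cball x0 \<rho>" by simp
    have "real CARD('m) * r \<le> real CARD('m)" using r by (simp add: mult_left_le)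
    then have "cball x0 (\<rho> + real CARD('m) * r) \<subseteq> ?U" by (intro subset_cball) simp
    then show ?thesis using grid_cube_subset_cball[OF r(1) x x2] by blast
  qed
  then have fin: "finite ?I" and card: "real (card ?I) * r ^ CARD('m) \<le> measure lborel ?U"
    using card_grid_index_le[of r ?U "ball x0 \<rho>"] r emeasure_compact_finite[of ?U] by auto
  define pt where "pt z = (SOME x. x \<in> ball x0 \<rho> \<and> grid_index r x = z)" for z
  have pt: "pt z \<in> ball x0 \<rho> \<and> grid_index r (pt z) = z" if "z \<in> ?I" for z
    unfolding pt_def by (rule someI_ex) (use that in auto)
  let ?F = "\<phi> ` pt ` ?I"
  have "\<phi> ` ball x0 \<rho> \<subseteq> (\<Union>y\<in>?F. cball y ((onorm L + \<sigma>) * real CARD('m) * r))"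
  proof (rule image_subsetI)
    fix x assume x: "x \<in> ball x0 \<rho>"
    let ?y = "pt (grid_index r x)"
    have z: "grid_index r x \<in> ?I" using x by blast
    have "norm (?y - x) \<le> real CARD('m) * r"
      using pt[OF z] r by (intro grid_cube_diameter[of r _ "grid_index r x"]) (auto simp: grid_cube_def)
    then have "(onorm L + \<sigma>) * norm (?y - x) \<le> (onorm L + \<sigma>) * (real CARD('m) * r)"
      using onorm_nonneg \<sigma> by (intro mult_left_mono) auto
    then have "dist (\<phi> ?y) (\<phi> x) \<le> (onorm L + \<sigma>) * real CARD('m) * r"
      using lipschitz[of ?y x] pt[OF z] x by (simp add: dist_norm mult.assoc)
    then show "\<phi> x \<in> (\<Union>y\<in>?F. cball y ((onorm L + \<sigma>) * real CARD('m) * r))"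
      using z by auto
  qed
  moreover have "card ?F \<le> card ?I"
    using fin card_image_le[of "pt ` ?I" \<phi>] card_image_le[of ?I pt] by auto
  then have "real (card ?F) * r ^ CARD('m) \<le> real (card ?I) * r ^ CARD('m)"
    using r by (intro mult_right_mono) auto
  ultimately show ?thesis using fin card by (intro exI[of _ ?F]) auto
qed

end

text \<open>Compactness, applied to the images of the balls of half the radius. The outer part of
  each chart is a margin between the inner part and the remainder of \<open>M\<close>.\<close>

lemma finite_good_atlas:
  fixes M :: "(real ^ 'd) set"
  assumes M: "closed_submanifold TYPE('m::finite) M" and vol: "riemannian_volume TYPE('m) M vol"
  obtains I :: "(real ^ 'd) set" and \<Phi> :: "real ^ 'd \<Rightarrow> real ^ 'm \<Rightarrow> real ^ 'd" and X R L S V B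
  where "finite I" "\<And>p. p \<in> I \<Longrightarrow> good_chart (\<Phi> p) (X p) (R p) (L p) (S p) M (V p) vol (B p)"
    "M \<subseteq> (\<Union>p\<in>I. \<Phi> p ` ball (X p) (R p / 2))"
proof -
  have cM: "compact M" and charts: "\<forall>p\<in>M. \<exists>V (\<phi> :: real ^ 'm \<Rightarrow> real ^ 'd). local_parametrization M V \<phi> \<and> p \<in> \<phi> ` V"
    using M by (simp_all add: closed_submanifold_def)
  have "\<exists>\<phi> x0 \<rho> L \<sigma> V b. good_chart (\<phi> :: real ^ 'm \<Rightarrow> real ^ 'd) x0 \<rho> L \<sigma> M V vol b \<and> \<phi> x0 = p" if pM: "p \<in> M" for p
  proof -
    obtain V and \<phi> :: "real ^ 'm \<Rightarrow> real ^ 'd" where lp: "local_parametrization M V \<phi>" and p: "p \<in> \<phi> ` V"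
      using charts pM by blast
    then obtain x0 where x0: "x0 \<in> V" "\<phi> x0 = p" by auto
    obtain \<rho> L \<sigma> b where "\<rho> > 0" "ball x0 \<rho> \<subseteq> V" "flat_chart \<phi> (ball x0 \<rho>) L \<sigma>"
      "b > 0" "\<And>x. x \<in> ball x0 \<rho> \<Longrightarrow> volume_element \<phi> x \<le> b"
      using flat_chart_exists[of V \<phi> x0] lp x0 unfolding local_parametrization_def by metis
    then have "good_chart \<phi> x0 \<rho> L \<sigma> M V vol b"
      using lp cM vol by (simp add: good_chart_def good_chart_axioms_def)
    then show ?thesis using x0(2) by blast
  qed
  then obtain \<Phi> :: "real ^ 'd \<Rightarrow> real ^ 'm \<Rightarrow> real ^ 'd" and X R L S V B where
    gc: "\<And>p. p \<in> M \<Longrightarrow> good_chart (\<Phi> p) (X p) (R p) (L p) (S p) M (V p) vol (B p)"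
    and at: "\<And>p. p \<in> M \<Longrightarrow> \<Phi> p (X p) = p"
    by metis
  have Rpos: "R p > 0" and Rsub: "ball (X p) (R p / 2) \<subseteq> V p" if "p \<in> M" for p
    using good_chart.\<rho>[OF gc[OF that]] good_chart.sub[OF gc[OF that]] by auto
  have "\<exists>U. open U \<and> \<Phi> p ` ball (X p) (R p / 2) = M \<inter> U" if "p \<in> M" for p
    using good_chart.openin_image[OF gc[OF that] open_ball Rsub[OF that]] by (auto simp: openin_open)
  then obtain U where U: "\<And>p. p \<in> M \<Longrightarrow> open (U p)" "\<And>p. p \<in> M \<Longrightarrow> \<Phi> p ` ball (X p) (R p / 2) = M \<inter> U p"
    by metis
  have "M \<subseteq> (\<Union>p\<in>M. U p)"
  proof
    fix p assume p: "p \<in> M"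
    then have "p \<in> \<Phi> p ` ball (X p) (R p / 2)" using at[OF p] Rpos[OF p] by (metis centre_in_ball half_gt_zero imageI)
    then show "p \<in> (\<Union>p\<in>M. U p)" using U(2)[OF p] p by auto
  qed
  then obtain I where I: "I \<subseteq> M" "finite I" "M \<subseteq> (\<Union>p\<in>I. U p)"
    using compactE_image[OF cM, of M U] U(1) by metis
  have "M \<subseteq> (\<Union>p\<in>I. \<Phi> p ` ball (X p) (R p / 2))"
  proof
    fix x assume x: "x \<in> M"
    then obtain p where "p \<in> I" "x \<in> U p" using I(3) by auto
    then show "x \<in> (\<Union>p\<in>I. \<Phi> p ` ball (X p) (R p / 2))" using U(2)[of p] I(1) x by blast
  qed
  then show thesis using that[of I \<Phi> X R L S V B] I(1,2) gc by auto
qed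

section \<open>Poisson counts\<close>

lemma poisson_card_measurable:
  assumes "poisson_process \<Omega> \<Lambda> P" "A \<in> sets \<Lambda>"
  shows "(\<lambda>\<omega>. card (P \<omega> \<inter> A)) \<in> measurable \<Omega> (count_space UNIV)"
  using assms by (simp add: poisson_process_def)

lemma poisson_card_distr:
  assumes "poisson_process \<Omega> \<Lambda> P" "A \<in> sets \<Lambda>"
  shows "distr \<Omega> (count_space UNIV) (\<lambda>\<omega>. card (P \<omega> \<inter> A)) = measure_pmf (poisson_pmf (measure \<Lambda> A))"
  using assms by (simp add: poisson_process_def)

lemma poisson_prob_empty:
  assumes P: "poisson_process \<Omega> \<Lambda> P" and A: "A \<in> sets \<Lambda>" and pos: "measure \<Lambda> A > 0"
  shows "measure \<Omega> {\<omega> \<in> space \<Omega>. card (P \<omega> \<inter> A) = 0} = exp (- measure \<Lambda> A)"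
proof -
  have "measure \<Omega> {\<omega> \<in> space \<Omega>. card (P \<omega> \<inter> A) = 0}
      = measure (distr \<Omega> (count_space UNIV) (\<lambda>\<omega>. card (P \<omega> \<inter> A))) {0}"
    by (subst measure_distr[OF poisson_card_measurable[OF P A]]) (auto intro!: arg_cong[where f="measure \<Omega>"])
  also have "\<dots> = pmf (poisson_pmf (measure \<Lambda> A)) 0"
    by (simp add: poisson_card_distr[OF P A] measure_pmf_single)
  also have "\<dots> = exp (- measure \<Lambda> A)" using pos by (simp add: pmf_poisson)
  finally show ?thesis .
qed

lemma poisson_nn_integral_two_power:
  assumes P: "poisson_process \<Omega> \<Lambda> P" and A: "A \<in> sets \<Lambda>"
  shows "(\<integral>\<^sup>+\<omega>. ennreal (2 ^ card (P \<omega> \<inter> A)) \<partial>\<Omega>) = ennreal (exp (measure \<Lambda> A))"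
proof -
  let ?\<mu> = "measure \<Lambda> A"
  have distr: "(\<integral>\<^sup>+\<omega>. ennreal (2 ^ card (P \<omega> \<inter> B)) \<partial>\<Omega>)
      = (\<integral>\<^sup>+n. ennreal (2 ^ n) \<partial>measure_pmf (poisson_pmf (measure \<Lambda> B)))" if "B \<in> sets \<Lambda>" for B
    unfolding poisson_card_distr[OF P that, symmetric]
    by (subst nn_integral_distr[OF poisson_card_measurable[OF P that]]) auto
  show ?thesis
  proof (cases "?\<mu> = 0")
    case True
    \<comment> \<open>At rate zero the value of \<open>poisson_pmf\<close> is not specified by the library; the hypothesis for
      the empty region determines it.\<close>
    have "(\<integral>\<^sup>+n. ennreal (2 ^ n) \<partial>measure_pmf (poisson_pmf (measure \<Lambda> {})))
        = (\<integral>\<^sup>+\<omega>. ennreal (2 ^ card (P \<omega> \<inter> {})) \<partial>\<Omega>)"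
      using distr[of "{}"] by simp
    also have "\<dots> = 1" using P by (simp add: poisson_process_def prob_space.emeasure_space_1)
    finally show ?thesis using True distr[OF A] by simp
  next
    case False
    then have pos: "?\<mu> > 0" using measure_nonneg[of \<Lambda> A] by linarith
    \<comment> \<open>The generating function at 2: the series of exp (2 \<mu>), damped by the
      factor exp (-\<mu>) of the Poisson weights.\<close>
    have "(\<lambda>n. (2 * ?\<mu>) ^ n /\<^sub>R fact n) sums exp (2 * ?\<mu>)" by (rule exp_converges)
    then have "(\<lambda>n. (2 * ?\<mu>) ^ n /\<^sub>R fact n * exp (- ?\<mu>)) sums (exp (2 * ?\<mu>) * exp (- ?\<mu>))"
      by (rule sums_mult2)
    also have "exp (2 * ?\<mu>) * exp (- ?\<mu>) = exp ?\<mu>" by (simp add: exp_add[symmetric])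
    finally have sums: "(\<lambda>n. pmf (poisson_pmf ?\<mu>) n * 2 ^ n) sums exp ?\<mu>"
      using pos by (simp add: pmf_poisson power_mult_distrib field_simps)
    have "(\<integral>\<^sup>+n. ennreal (2 ^ n) \<partial>measure_pmf (poisson_pmf ?\<mu>))
        = suminf (\<lambda>n. ennreal (pmf (poisson_pmf ?\<mu>) n) * ennreal (2 ^ n))"
      by (simp add: nn_integral_measure_pmf nn_integral_count_space_nat)
    also have "\<dots> = suminf (\<lambda>n. ennreal (pmf (poisson_pmf ?\<mu>) n * 2 ^ n))"
      by (simp add: ennreal_mult')
    also have "\<dots> = ennreal (exp ?\<mu>)" using sums by (intro suminf_ennreal_eq) auto
    finally show ?thesis using distr[OF A] by simp
  qed
qed

text \<open>A cell is hit with probability at least 1 - exp (-c1) and missed with probability at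
  least exp (-c2); independence multiplies these bounds. The result is the same for every pattern
  \<open>occ\<close>, which will vary with the block and the radius.\<close>

lemma poisson_configuration_prob:
  fixes A :: "'z \<Rightarrow> 'a set" and occ :: "'z \<Rightarrow> bool"
  assumes P: "poisson_process \<Omega> \<Lambda> P" and Z: "finite Z" and A: "\<And>z. z \<in> Z \<Longrightarrow> A z \<in> sets \<Lambda>"
    and disj: "disjoint_family_on A Z" and c1: "c1 > 0"
    and lo: "\<And>z. z \<in> Z \<Longrightarrow> c1 \<le> measure \<Lambda> (A z)" and hi: "\<And>z. z \<in> Z \<Longrightarrow> measure \<Lambda> (A z) \<le> c2"
  defines "E \<equiv> {\<omega> \<in> space \<Omega>. \<forall>z\<in>Z. card (P \<omega> \<inter> A z) = 0 \<longleftrightarrow> \<not> occ z}"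
  shows "E \<in> sets \<Omega>" "min (1 - exp (- c1)) (exp (- c2)) ^ card Z \<le> measure \<Omega> E"
proof -
  interpret prob_space \<Omega> using P by (simp add: poisson_process_def)
  let ?q = "min (1 - exp (- c1)) (exp (- c2))"
  define S where "S z = {n::nat. n = 0 \<longleftrightarrow> \<not> occ z}" for z
  have meas: "(\<lambda>\<omega>. card (P \<omega> \<inter> A z)) \<in> measurable \<Omega> (count_space UNIV)" if "z \<in> Z" for z
    using poisson_card_measurable[OF P A[OF that]] .
  have E_eq: "E = {\<omega> \<in> space \<Omega>. \<forall>z\<in>Z. card (P \<omega> \<inter> A z) \<in> S z}" by (simp add: E_def S_def)
  have ev: "(\<lambda>\<omega>. card (P \<omega> \<inter> A z)) -` S z \<inter> space \<Omega> \<in> sets \<Omega>" if "z \<in> Z" for z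
    using measurable_sets[OF meas[OF that], of "S z"] by simp
  have E_Int: "E = (\<Inter>z\<in>Z. (\<lambda>\<omega>. card (P \<omega> \<inter> A z)) -` S z \<inter> space \<Omega>)" if "Z \<noteq> {}"
    using that unfolding E_eq by auto
  show "E \<in> sets \<Omega>"
  proof (cases "Z = {}")
    case False
    show ?thesis unfolding E_Int[OF False] using ev by (rule sets.finite_INT[OF Z False])
  qed (simp add: E_def)
  have q: "?q \<ge> 0" using c1 by simp
  have single: "?q \<le> prob ((\<lambda>\<omega>. card (P \<omega> \<inter> A z)) -` S z \<inter> space \<Omega>)" if z: "z \<in> Z" for z
  proof -
    let ?O = "{\<omega> \<in> space \<Omega>. card (P \<omega> \<inter> A z) = 0}"
    have pos: "measure \<Lambda> (A z) > 0" using lo[OF z] c1 by linarith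
    have p0: "prob ?O = exp (- measure \<Lambda> (A z))" by (rule poisson_prob_empty[OF P A[OF z] pos])
    have Oe: "?O \<in> sets \<Omega>" using measurable_sets[OF meas[OF z], of "{0}"] by (simp add: vimage_def Int_def conj_commute)
    show ?thesis
    proof (cases "occ z")
      case True
      then have "(\<lambda>\<omega>. card (P \<omega> \<inter> A z)) -` S z \<inter> space \<Omega> = space \<Omega> - ?O" by (auto simp: S_def)
      then have "prob ((\<lambda>\<omega>. card (P \<omega> \<inter> A z)) -` S z \<inter> space \<Omega>) = 1 - exp (- measure \<Lambda> (A z))"
        using prob_compl[OF Oe] p0 by simp
      moreover have "exp (- measure \<Lambda> (A z)) \<le> exp (- c1)" using lo[OF z] by simp
      ultimately show ?thesis by linarith
    next
      case False
      then have "(\<lambda>\<omega>. card (P \<omega> \<inter> A z)) -` S z \<inter> space \<Omega> = ?O" by (auto simp: S_def)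
      moreover have "exp (- c2) \<le> exp (- measure \<Lambda> (A z))" using hi[OF z] by simp
      ultimately show ?thesis using p0 by (simp add: min.coboundedI2)
    qed
  qed
  show "?q ^ card Z \<le> prob E"
  proof (cases "Z = {}")
    case True
    then show ?thesis using prob_space by (simp add: E_def)
  next
    case False
    \<comment> \<open>\<open>poisson_process\<close> states independence for cells indexed by
      natural numbers, hence the enumeration of \<open>Z\<close>.\<close>
    obtain h where h: "bij_betw h {0..<card Z} Z" using ex_bij_betw_nat_finite[OF Z] by blast
    then have hZ: "h i \<in> Z" if "i \<in> {0..<card Z}" for i using that by (auto simp: bij_betw_def)
    have "disjoint_family_on (\<lambda>i. A (h i)) {0..<card Z}"
      using disj h unfolding disjoint_family_on_def bij_betw_def inj_on_def by blast
    then have indep: "indep_vars (\<lambda>_. count_space UNIV) (\<lambda>i \<omega>. card (P \<omega> \<inter> A (h i))) {0..<card Z}"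
    proof -
      have "\<forall>(I :: nat set) A. finite I \<and> (\<forall>i\<in>I. A i \<in> sets \<Lambda>) \<and> disjoint_family_on A I \<longrightarrow>
          indep_vars (\<lambda>_. count_space UNIV) (\<lambda>i \<omega>. card (P \<omega> \<inter> A i)) I"
        using P unfolding poisson_process_def by (elim conjE)
      then show ?thesis
        using A hZ \<open>disjoint_family_on (\<lambda>i. A (h i)) {0..<card Z}\<close>
        by (elim allE[of _ "{0..<card Z}"] allE[of _ "\<lambda>i. A (h i)"]) auto
    qed
    have "E = (\<Inter>i\<in>{0..<card Z}. (\<lambda>\<omega>. card (P \<omega> \<inter> A (h i))) -` S (h i) \<inter> space \<Omega>)"
    proof -
      have "E = (\<Inter>z\<in>Z. (\<lambda>\<omega>. card (P \<omega> \<inter> A z)) -` S z \<inter> space \<Omega>)" by (rule E_Int[OF False])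
      also have "\<dots> = (\<Inter>z\<in>h ` {0..<card Z}. (\<lambda>\<omega>. card (P \<omega> \<inter> A z)) -` S z \<inter> space \<Omega>)"
        using h by (simp add: bij_betw_def)
      finally show ?thesis by simp
    qed
    then have "prob E = (\<Prod>i\<in>{0..<card Z}. prob ((\<lambda>\<omega>. card (P \<omega> \<inter> A (h i))) -` S (h i) \<inter> space \<Omega>))"
      using indep_varsD[OF indep, of "{0..<card Z}" "\<lambda>i. S (h i)"] False Z
      by (simp add: card_gt_0_iff)
    also have "\<dots> \<ge> (\<Prod>i\<in>{0..<card Z}. ?q)"
      using q single[OF hZ] by (intro prod_mono) auto
    finally show ?thesis by simp
  qed
qed

section \<open>The upper bound\<close>

lemma ennreal_of_enat_mono: "a \<le> b \<Longrightarrow> ennreal_of_enat a \<le> ennreal_of_enat b"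
  by (simp add: ennreal_of_enat_le_iff)

lemma expected_betti_le:
  fixes P :: "'w \<Rightarrow> (real ^ 'd) set"
  assumes P: "poisson_process \<Omega> \<Lambda> P" and r: "r > 0" and F: "finite F"
    and cover: "space \<Lambda> \<subseteq> (\<Union>y\<in>F. cball y D)"
    and sets: "\<And>y. y \<in> F \<Longrightarrow> space \<Lambda> \<inter> cball y (D + 4 * r) \<in> sets \<Lambda>"
    and bound: "\<And>y. y \<in> F \<Longrightarrow> measure \<Lambda> (space \<Lambda> \<inter> cball y (D + 4 * r)) \<le> C"
  shows "expected_betti \<Omega> k (\<lambda>\<omega>. ball_union (P \<omega>) r) \<le> ennreal (real (card F) * exp C)"
proof -
  let ?E = "\<lambda>y. space \<Lambda> \<inter> cball y (D + 4 * r)"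
  have pointwise: "ennreal_of_enat (betti k (ball_union (P \<omega>) r)) \<le> (\<Sum>y\<in>F. ennreal (2 ^ card (P \<omega> \<inter> ?E y)))"
    if \<omega>: "\<omega> \<in> space \<Omega>" for \<omega>
  proof -
    have fin: "finite (P \<omega>)" and sub: "P \<omega> \<subseteq> space \<Lambda>" using P \<omega> by (auto simp: poisson_process_def)
    let ?T = "{T. T \<subseteq> P \<omega> \<and> T \<noteq> {} \<and> (\<Inter>p\<in>T. ball p (2*r)) \<noteq> {}}"
    have "?T \<subseteq> (\<Union>y\<in>F. Pow (P \<omega> \<inter> ?E y))"
    proof
      fix T assume T: "T \<in> ?T"
      then obtain x where "x \<in> (\<Inter>p\<in>T. ball p (2*r))" by blast
      then have x: "dist q x < 2 * r" if "q \<in> T" for q using that by auto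
      from T obtain p where p: "p \<in> T" by auto
      with T sub cover obtain y where y: "y \<in> F" "dist y p \<le> D" by fastforce
      \<comment> \<open>All points of \<open>T\<close> are less than 2 r from the common point x,
        hence less than 4 r from each other; this is the 4 r added to the radius D.\<close>
      have "dist y q \<le> D + 4 * r" if q: "q \<in> T" for q
        using dist_triangle[of y q p] dist_triangle2[of p q x] y(2) x[OF p] x[OF q] by linarith
      then have "T \<in> Pow (P \<omega> \<inter> ?E y)" using T sub by auto
      then show "T \<in> (\<Union>y\<in>F. Pow (P \<omega> \<inter> ?E y))" using y(1) by blast
    qed
    then have "card ?T \<le> card (\<Union>y\<in>F. Pow (P \<omega> \<inter> ?E y))"
      using F fin by (intro card_mono) auto
    also have "\<dots> \<le> (\<Sum>y\<in>F. card (Pow (P \<omega> \<inter> ?E y)))" using F by (rule card_UN_le)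
    also have "\<dots> = (\<Sum>y\<in>F. 2 ^ card (P \<omega> \<inter> ?E y))"
      using fin by (intro sum.cong) (simp_all add: card_Pow del: Pow_Int_eq)
    finally have le: "card ?T \<le> (\<Sum>y\<in>F. 2 ^ card (P \<omega> \<inter> ?E y))" .
    have "ennreal_of_enat (betti k (ball_union (P \<omega>) r)) \<le> ennreal_of_enat (enat (card ?T))"
      using betti_ball_union_le[OF fin r] by (rule ennreal_of_enat_mono)
    also have "\<dots> \<le> of_nat (\<Sum>y\<in>F. 2 ^ card (P \<omega> \<inter> ?E y))"
      using le by (simp only: ennreal_of_enat_enat of_nat_le_iff)
    also have "\<dots> = (\<Sum>y\<in>F. ennreal (2 ^ card (P \<omega> \<inter> ?E y)))"
      by (simp add: ennreal_of_nat_eq_real_of_nat)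
    finally show ?thesis .
  qed
  have "expected_betti \<Omega> k (\<lambda>\<omega>. ball_union (P \<omega>) r) \<le> (\<integral>\<^sup>+\<omega>. (\<Sum>y\<in>F. ennreal (2 ^ card (P \<omega> \<inter> ?E y))) \<partial>\<Omega>)"
    unfolding expected_betti_def by (intro nn_integral_mono pointwise)
  also have "\<dots> = (\<Sum>y\<in>F. \<integral>\<^sup>+\<omega>. ennreal (2 ^ card (P \<omega> \<inter> ?E y)) \<partial>\<Omega>)"
  proof (rule nn_integral_sum)
    fix y assume "y \<in> F"
    from measurable_compose[OF poisson_card_measurable[OF P sets[OF this]], of "\<lambda>n. ennreal (2 ^ n)" borel]
    show "(\<lambda>\<omega>. ennreal (2 ^ card (P \<omega> \<inter> ?E y))) \<in> borel_measurable \<Omega>" by simp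
  qed
  also have "\<dots> \<le> (\<Sum>y\<in>F. ennreal (exp C))"
    using bound by (intro sum_mono) (simp add: poisson_nn_integral_two_power[OF P sets] ennreal_leI)
  also have "\<dots> = ennreal (real (card F) * exp C)"
    by (simp add: ennreal_mult ennreal_of_nat_eq_real_of_nat)
  finally show ?thesis .
qed

text \<open>The second bound involves a smaller set B because a lower bound for the density will be
  available on a part of each cell only.\<close>

lemma density_measure_bounds:
  fixes f :: "'a \<Rightarrow> real"
  assumes f: "f \<in> borel_measurable \<mu>" and A: "A \<in> sets \<mu>"
    and fin: "finite_measure (density \<mu> (\<lambda>x. ennreal (t * f x)))" and t: "t \<ge> 0"
  shows "(\<And>x. x \<in> A \<Longrightarrow> f x \<le> F) \<Longrightarrow> 0 \<le> F \<Longrightarrow> emeasure \<mu> A \<le> ennreal v \<Longrightarrow> 0 \<le> v \<Longrightarrow>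
      measure (density \<mu> (\<lambda>x. ennreal (t * f x))) A \<le> t * F * v"
    and "B \<in> sets \<mu> \<Longrightarrow> B \<subseteq> A \<Longrightarrow> (\<And>x. x \<in> B \<Longrightarrow> c \<le> f x) \<Longrightarrow> 0 \<le> c \<Longrightarrow> ennreal v \<le> emeasure \<mu> B \<Longrightarrow> 0 \<le> v \<Longrightarrow>
      t * c * v \<le> measure (density \<mu> (\<lambda>x. ennreal (t * f x))) A"
proof -
  let ?\<Lambda> = "density \<mu> (\<lambda>x. ennreal (t * f x))"
  interpret finite_measure ?\<Lambda> by fact
  have m: "(\<lambda>x. ennreal (t * f x)) \<in> borel_measurable \<mu>" using f by measurable
  have em: "emeasure ?\<Lambda> A = (\<integral>\<^sup>+x. ennreal (t * f x) * indicator A x \<partial>\<mu>)"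
    using m A by (rule emeasure_density)
  {
    assume F: "\<And>x. x \<in> A \<Longrightarrow> f x \<le> F" "0 \<le> F" and v: "emeasure \<mu> A \<le> ennreal v" "0 \<le> v"
    have "emeasure ?\<Lambda> A \<le> (\<integral>\<^sup>+x. ennreal (t * F) * indicator A x \<partial>\<mu>)"
      unfolding em using F t by (intro nn_integral_mono) (auto simp: indicator_def intro!: ennreal_leI mult_left_mono)
    also have "\<dots> = ennreal (t * F) * emeasure \<mu> A" using A by (simp add: nn_integral_cmult_indicator)
    also have "\<dots> \<le> ennreal (t * F) * ennreal v" using v by (intro mult_left_mono) auto
    also have "\<dots> = ennreal (t * F * v)" using F t v by (simp add: ennreal_mult)
    finally show "measure ?\<Lambda> A \<le> t * F * v"
      using F(2) t v(2) by (simp add: emeasure_eq_measure ennreal_le_iff)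
  }
  {
    assume B: "B \<in> sets \<mu>" "B \<subseteq> A" "\<And>x. x \<in> B \<Longrightarrow> c \<le> f x" "0 \<le> c" and v: "ennreal v \<le> emeasure \<mu> B" "0 \<le> v"
    have "ennreal (t * c * v) = ennreal (t * c) * ennreal v" using B t v by (simp add: ennreal_mult)
    also have "\<dots> \<le> ennreal (t * c) * emeasure \<mu> B" using v by (intro mult_left_mono) auto
    also have "\<dots> = (\<integral>\<^sup>+x. ennreal (t * c) * indicator B x \<partial>\<mu>)" using B by (simp add: nn_integral_cmult_indicator)
    also have "\<dots> \<le> emeasure ?\<Lambda> A"
      unfolding em using B t by (intro nn_integral_mono) (auto simp: indicator_def intro!: ennreal_leI mult_left_mono)
    finally show "t * c * v \<le> measure ?\<Lambda> A"
      using B(4) t v(2) by (simp add: emeasure_eq_measure ennreal_le_iff)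
  }
qed

section \<open>Isolated spheres in grid blocks\<close>

text \<open>The range of an injective linear map has dimension m > k. Spheres spanned by vectors in
  it have preimages under \<open>L\<close>, so points of the chart can follow them.\<close>

lemma orthonormal_frame_in_range:
  fixes L :: "real ^ 'm \<Rightarrow> real ^ 'd"
  assumes L: "linear L" "inj L" and k: "k < CARD('m)"
  obtains e where "orthonormal_frame k e" "\<And>i. i \<le> k \<Longrightarrow> e i \<in> range L"
proof -
  have "subspace (range L)" using L(1) by (rule linear_subspace_image) simp
  then obtain B where B: "B \<subseteq> range L" "pairwise orthogonal B" "\<And>x. x \<in> B \<Longrightarrow> norm x = 1"
    "independent B" "card B = dim (range L)"
    using orthonormal_basis_subspace by metis
  have "dim (range L) = CARD('m)"
    using dim_image_eq[OF L(1), of UNIV] L(2) by (simp add: inj_on_subset)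
  then have card: "card B = CARD('m)" using B(5) by simp
  then have "finite B" by (metis card.infinite zero_less_card_finite less_irrefl)
  then obtain e where e: "bij_betw e {0..<card B} B" using ex_bij_betw_nat_finite by blast
  have eB: "e i \<in> B" if "i \<le> k" for i using e k card that by (auto simp: bij_betw_def)
  have "e i \<bullet> e j = (if i = j then 1 else 0)" if ij: "i \<le> k" "j \<le> k" for i j
  proof (cases "i = j")
    case True
    then show ?thesis using B(3)[OF eB[OF ij(1)]] by (simp add: norm_eq_1)
  next
    case False
    then have "e i \<noteq> e j" using e ij k card by (auto simp: bij_betw_def inj_on_def)
    then show ?thesis using B(2) eB ij False by (auto simp: pairwise_def orthogonal_def)
  qed
  then have "orthonormal_frame k e" by unfold_locales
  moreover have "e i \<in> range L" if "i \<le> k" for i using eB[OF that] B(1) by blast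
  ultimately show thesis by (rule that)
qed

definition block_cubes :: "nat \<Rightarrow> int ^ 'm \<Rightarrow> (int ^ 'm) set" where
  "block_cubes N z = {z'. \<forall>i. z' $ i div int N = z $ i}"

text \<open>In units of r: a subcube has diameter at most 1/\<sigma>, and at most 1/4 after
  \<open>L\<close>. Half the side of a block is at least 8/\<sigma>, while points in occupied
  subcubes are within 2/\<sigma> + 1/\<sigma> of its centre. The remaining 5/\<sigma> become at
  least 5/2 > 2 under the chart, so balls around such points miss balls around points of the chart
  outside the block.\<close>

locale block_chart = good_chart \<phi> x0 \<rho> L \<sigma> M V vol b + orthonormal_frame k e
  for \<phi> :: "real ^ 'm \<Rightarrow> real ^ 'd" and x0 \<rho> L \<sigma> M V vol b k e +
  fixes \<beta> :: real and N :: nat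
  assumes e_range: "\<And>i. i \<le> k \<Longrightarrow> e i \<in> range L"
    and \<beta>: "\<beta> > 0" "real CARD('m) * \<beta> \<le> 1 / \<sigma>" "onorm L * (real CARD('m) * \<beta>) \<le> 1 / 4"
    and N: "16 / \<sigma> \<le> real N * \<beta>"
begin

text \<open>The subcubes hit by the linearised sphere of radius \<open>2 r\<close> about the centre of the block.\<close>

definition occupied :: "real \<Rightarrow> int ^ 'm \<Rightarrow> int ^ 'm \<Rightarrow> bool" where
  "occupied r z z' \<longleftrightarrow> (\<exists>s\<in>topspace (nsphere k). \<exists>w\<in>grid_cube (\<beta> * r) z'.
     L (w - grid_center (real N * (\<beta> * r)) z) = (2 * r) *\<^sub>R sphere_point k e s)"

lemma N_pos: "N > 0"
proof (rule ccontr)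
  assume "\<not> N > 0"
  then have "16 / \<sigma> \<le> 0" using N by simp
  then show False using \<sigma> by (simp add: divide_le_0_iff)
qed

lemma block_eq: "r > 0 \<Longrightarrow> grid_cube (real N * (\<beta> * r)) z = (\<Union>z'\<in>block_cubes N z. grid_cube (\<beta> * r) z')"
  using grid_cube_subdivide[of "\<beta> * r" N z] \<beta>(1) N_pos by (simp add: block_cubes_def)

lemma half_block: "r > 0 \<Longrightarrow> 8 * r / \<sigma> \<le> real N * (\<beta> * r) / 2"
  using mult_right_mono[OF N, of r] by (simp add: mult.assoc)

lemma sphere_preimage:
  assumes "s \<in> topspace (nsphere k)" "r > 0"
  obtains v where "L v = (2 * r) *\<^sub>R sphere_point k e s" "norm v \<le> 2 * r / \<sigma>"
proof -
  have "subspace (range L)" using lin by (rule linear_subspace_image) simp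
  then have "(2 * r) *\<^sub>R sphere_point k e s \<in> range L"
    unfolding sphere_point_def using e_range by (intro subspace_scale subspace_sum) auto
  then obtain v where v: "L v = (2 * r) *\<^sub>R sphere_point k e s" by auto
  have "\<sigma> * norm v \<le> 2 * r" using below[of v] v norm_sphere_point[OF assms(1)] assms(2) by simp
  then show thesis using that[OF v] \<sigma> by (simp add: field_simps)
qed

text \<open>Two errors of r/4 add up: the deviation of the chart from \<open>L\<close> over a
  distance of 3 r/\<sigma>, and the displacement from w to x inside one subcube, seen through
  \<open>L\<close>.\<close>

lemma occupied_near:
  assumes r: "r > 0" and Q: "grid_cube (real N * (\<beta> * r)) z \<subseteq> ball x0 \<rho>" and z': "z' \<in> block_cubes N z"
    and s: "s \<in> topspace (nsphere k)" and w: "w \<in> grid_cube (\<beta> * r) z'"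
    and Lw: "L (w - grid_center (real N * (\<beta> * r)) z) = (2 * r) *\<^sub>R sphere_point k e s"
    and x: "x \<in> grid_cube (\<beta> * r) z'"
  shows "norm (x - grid_center (real N * (\<beta> * r)) z) \<le> 3 * r / \<sigma>"
    and "dist (\<phi> x) (\<phi> (grid_center (real N * (\<beta> * r)) z) + (2 * r) *\<^sub>R sphere_point k e s) \<le> r / 2"
proof -
  let ?c = "grid_center (real N * (\<beta> * r)) z" and ?T = "(2 * r) *\<^sub>R sphere_point k e s"
  have br: "\<beta> * r > 0" using \<beta> r by simp
  have xw: "norm (x - w) \<le> real CARD('m) * \<beta> * r"
    using grid_cube_diameter[OF br x w] by (simp add: mult.assoc)
  have "real CARD('m) * \<beta> * r \<le> 1 / \<sigma> * r" using \<beta>(2) r by (intro mult_right_mono) auto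
  then have xw': "norm (x - w) \<le> r / \<sigma>" using xw by simp
  have "\<sigma> * norm (w - ?c) \<le> 2 * r" using below[of "w - ?c"] Lw norm_sphere_point[OF s] r by simp
  then have wc: "norm (w - ?c) \<le> 2 * r / \<sigma>" using \<sigma> by (simp add: field_simps)
  have "norm (x - ?c) \<le> norm (x - w) + norm (w - ?c)"
    using norm_triangle_ineq[of "x - w" "w - ?c"] by simp
  also have "\<dots> \<le> r / \<sigma> + 2 * r / \<sigma>" using xw' wc by (rule add_mono)
  finally show xc: "norm (x - ?c) \<le> 3 * r / \<sigma>" by simp
  have xW: "x \<in> ball x0 \<rho>" using Q x z' block_eq[OF r, of z] by blast
  have "0 < real N * (\<beta> * r)" using N_pos br by simp
  then have cW: "?c \<in> ball x0 \<rho>" using Q grid_center_in_grid_cube by blast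
  have split: "\<phi> x - (\<phi> ?c + ?T) = (\<phi> x - \<phi> ?c - L (x - ?c)) + L (x - w)"
    using Lw by (simp add: linear_diff[OF lin] algebra_simps)
  have "norm (\<phi> x - \<phi> ?c - L (x - ?c)) \<le> \<sigma> / 12 * (3 * r / \<sigma>)"
    using approx[OF xW cW] mult_left_mono[OF xc, of "\<sigma> / 12"] \<sigma> by simp
  also have "\<dots> = r / 4" using \<sigma> by simp
  finally have 1: "norm (\<phi> x - \<phi> ?c - L (x - ?c)) \<le> r / 4" .
  have "norm (L (x - w)) \<le> onorm L * norm (x - w)"
    using lin by (intro onorm) (simp add: linear_conv_bounded_linear)
  also have "\<dots> \<le> onorm L * (real CARD('m) * \<beta> * r)" using xw onorm_nonneg by (rule mult_left_mono)
  also have "\<dots> \<le> 1 / 4 * r" using mult_right_mono[OF \<beta>(3), of r] r by (simp add: mult.assoc)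
  finally have 2: "norm (L (x - w)) \<le> r / 4" by simp
  show "dist (\<phi> x) (\<phi> ?c + ?T) \<le> r / 2"
    unfolding dist_norm split using norm_triangle_ineq[of "\<phi> x - \<phi> ?c - L (x - ?c)" "L (x - w)"] 1 2 by simp
qed

text \<open>The event reproduces the sphere at the scale of subcubes. Occupied ones contain points,
  which gives \<open>cover\<close>; no others in the block do, which gives \<open>near\<close>. For
  \<open>far\<close>, points in the chart are kept away by the size of the block, and points of
  \<open>M\<close> beyond the chart by \<open>gap\<close>.\<close>

lemma betti_ge_card_blocks:
  assumes k: "1 \<le> k" and r: "r > 0" and P: "finite P" "P \<subseteq> M" and G: "finite G"
    and Q: "\<And>z. z \<in> G \<Longrightarrow> grid_cube (real N * (\<beta> * r)) z \<subseteq> ball x0 (\<rho> / 2)"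
    and gap: "\<And>x y. x \<in> ball x0 (\<rho> / 2) \<Longrightarrow> y \<in> M - \<phi> ` ball x0 \<rho> \<Longrightarrow> d0 \<le> dist (\<phi> x) y"
    and d0: "2 * r < d0"
    and event: "\<And>z z'. z \<in> G \<Longrightarrow> z' \<in> block_cubes N z \<Longrightarrow>
        card (P \<inter> \<phi> ` grid_cube (\<beta> * r) z') = 0 \<longleftrightarrow> \<not> occupied r z z'"
  shows "enat (card G) \<le> betti k (ball_union P r)"
proof -
  let ?h = "real N * (\<beta> * r)"
  let ?Q = "grid_cube ?h" and ?c = "grid_center ?h" and ?T = "\<lambda>s. (2 * r) *\<^sub>R sphere_point k e s"
  define B where "B z = P \<inter> \<phi> ` ?Q z" for z
  have Q': "?Q z \<subseteq> ball x0 \<rho>" if "z \<in> G" for z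
    using Q[OF that] \<rho> by (auto intro: order.strict_trans2)
  have h: "?h > 0" using N_pos \<beta>(1) r by simp
  have occ: "\<exists>x z' w s. y = \<phi> x \<and> z' \<in> block_cubes N z \<and> x \<in> grid_cube (\<beta> * r) z' \<and> w \<in> grid_cube (\<beta> * r) z'
      \<and> s \<in> topspace (nsphere k) \<and> L (w - ?c z) = ?T s" if z: "z \<in> G" and y: "y \<in> B z" for y z
  proof -
    from y obtain x where x: "y = \<phi> x" "x \<in> ?Q z" "y \<in> P" by (auto simp: B_def)
    then obtain z' where z': "z' \<in> block_cubes N z" "x \<in> grid_cube (\<beta> * r) z'"
      using block_eq[OF r] by auto
    have "card (P \<inter> \<phi> ` grid_cube (\<beta> * r) z') \<noteq> 0" using P x z'(2) by auto
    then have "occupied r z z'" using event[OF z z'(1)] by simp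
    then show ?thesis unfolding occupied_def using x(1) z' by blast
  qed
  show ?thesis
  proof (rule betti_ball_union_ge[OF k P(1) r G, where B = B and c = "\<lambda>z. \<phi> (?c z)"])
    fix z assume z: "z \<in> G"
    show "B z \<subseteq> P" by (simp add: B_def)
    fix s assume s: "s \<in> topspace (nsphere k)"
    obtain v where v: "L v = ?T s" "norm v \<le> 2 * r / \<sigma>" using sphere_preimage[OF s r] .
    have "2 * r / \<sigma> < 8 * r / \<sigma>" using r \<sigma> by (simp add: divide_strict_right_mono)
    then have "norm ((?c z + v) - ?c z) < ?h / 2" using v(2) half_block[OF r] by simp
    then have "?c z + v \<in> ?Q z" by (rule near_grid_center_in_grid_cube[OF h])
    then obtain z' where z': "z' \<in> block_cubes N z" "?c z + v \<in> grid_cube (\<beta> * r) z'"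
      using block_eq[OF r] by auto
    then have "occupied r z z'" unfolding occupied_def using s v(1) by force
    then have "card (P \<inter> \<phi> ` grid_cube (\<beta> * r) z') \<noteq> 0" using event[OF z z'(1)] by simp
    then obtain x where x: "x \<in> grid_cube (\<beta> * r) z'" "\<phi> x \<in> P"
      using card_gt_0_iff[of "P \<inter> \<phi> ` grid_cube (\<beta> * r) z'"] by auto
    have "dist (\<phi> x) (\<phi> (?c z) + ?T s) \<le> r / 2"
      using occupied_near(2)[OF r Q'[OF z] z'(1) s z'(2) _ x(1)] v(1) by simp
    moreover have "\<phi> x \<in> B z" using x z'(1) block_eq[OF r, of z] by (auto simp: B_def)
    ultimately show "\<exists>x\<in>B z. dist x (\<phi> (?c z) + ?T s) \<le> r" using r by force
  next
    fix z y assume z: "z \<in> G" and y: "y \<in> B z"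
    obtain x z' w s where *: "y = \<phi> x" "z' \<in> block_cubes N z" "x \<in> grid_cube (\<beta> * r) z'" "w \<in> grid_cube (\<beta> * r) z'"
      "s \<in> topspace (nsphere k)" "L (w - ?c z) = ?T s" using occ[OF z y] by blast
    show "\<exists>s\<in>topspace (nsphere k). dist y (\<phi> (?c z) + ?T s) \<le> r / 2"
      using occupied_near(2)[OF r Q'[OF z] *(2) *(5) *(4) *(6) *(3)] *(1,5) by blast
  next
    fix z y y' assume z: "z \<in> G" and y: "y \<in> B z" and y': "y' \<in> P - B z"
    obtain x z' w s where *: "y = \<phi> x" "z' \<in> block_cubes N z" "x \<in> grid_cube (\<beta> * r) z'" "w \<in> grid_cube (\<beta> * r) z'"
      "s \<in> topspace (nsphere k)" "L (w - ?c z) = ?T s" using occ[OF z y] by blast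
    have xc: "norm (x - ?c z) \<le> 3 * r / \<sigma>"
      by (rule occupied_near(1)[OF r Q'[OF z] *(2) *(5) *(4) *(6) *(3)])
    have xQ: "x \<in> ?Q z" using *(2,3) block_eq[OF r, of z] by auto
    show "2 * r < dist y y'"
    proof (cases "y' \<in> \<phi> ` ball x0 \<rho>")
      case True
      then obtain x' where x': "x' \<in> ball x0 \<rho>" "y' = \<phi> x'" by auto
      then have "x' \<notin> ?Q z" using y' by (auto simp: B_def)
      then have "?h / 2 \<le> norm (x' - ?c z)"
        using near_grid_center_in_grid_cube[OF h, of x' z] by linarith
      then have "8 * r / \<sigma> \<le> norm (x' - ?c z)" using half_block[OF r] by linarith
      moreover have "norm (x' - ?c z) \<le> norm (x - x') + norm (x - ?c z)"
        using norm_triangle_ineq[of "x' - x" "x - ?c z"] by (simp add: norm_minus_commute)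
      ultimately have "8 * r / \<sigma> - 3 * r / \<sigma> \<le> norm (x - x')" using xc by linarith
      then have "5 * r / \<sigma> \<le> norm (x - x')" by (simp add: diff_divide_distrib[symmetric])
      then have "\<sigma> / 2 * (5 * r / \<sigma>) \<le> \<sigma> / 2 * norm (x - x')" using \<sigma> by (intro mult_left_mono) auto
      also have "\<dots> \<le> dist y y'" using expand[of x x'] xQ Q'[OF z] x' *(1) by (auto simp: dist_norm)
      finally show ?thesis using \<sigma> r by simp
    next
      case False
      then show ?thesis using gap[of x y'] xQ Q[OF z] y' P(2) *(1) d0 by force
    qed
  next
    fix z z' assume z: "z \<in> G" "z' \<in> G" "z \<noteq> z'"
    then have "?Q z \<inter> ?Q z' = {}" by (intro grid_cube_disjoint)
    then have "\<phi> ` ?Q z \<inter> \<phi> ` ?Q z' = {}"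
      using inj_on_image_Int[OF inj_on_chart Q'[OF z(1)] Q'[OF z(2)]] by simp
    then show "B z \<inter> B z' = {}" by (auto simp: B_def)
  qed
qed

end

lemma (in good_chart) block_chart_exists:
  assumes "k < CARD('m)"
  obtains e \<beta> N where "block_chart \<phi> x0 \<rho> L \<sigma> M V vol b k e \<beta> N"
proof -
  let ?m = "real CARD('m)"
  have "inj L"
  proof (rule linear_injective_0[OF lin, THEN iffD2], intro allI impI)
    fix v assume "L v = 0"
    then have "\<sigma> * norm v \<le> 0" using below[of v] by simp
    then show "v = 0" using \<sigma> by (simp add: mult_le_0_iff)
  qed
  then obtain e where e: "orthonormal_frame k e" "\<And>i. i \<le> k \<Longrightarrow> e i \<in> range L"
    using orthonormal_frame_in_range[OF lin _ assms] by metis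
  \<comment> \<open>The first term limits the diameter of a subcube, the second that of its image
    under \<open>L\<close>; adding 1 to \<open>onorm L\<close> makes the denominator visibly
    positive.\<close>
  define \<beta> where "\<beta> = min (1 / (\<sigma> * ?m)) (1 / (4 * (onorm L + 1) * ?m))"
  have \<beta>: "\<beta> > 0" using \<sigma> onorm_nonneg by (simp add: \<beta>_def)
  have "?m * \<beta> \<le> ?m * (1 / (\<sigma> * ?m))" by (intro mult_left_mono) (auto simp: \<beta>_def)
  then have b1: "?m * \<beta> \<le> 1 / \<sigma>" by simp
  have "?m * \<beta> \<le> ?m * (1 / (4 * (onorm L + 1) * ?m))" by (intro mult_left_mono) (auto simp: \<beta>_def)
  then have "?m * \<beta> \<le> 1 / (4 * (onorm L + 1))" by simp
  then have "onorm L * (?m * \<beta>) \<le> onorm L * (1 / (4 * (onorm L + 1)))"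
    using onorm_nonneg by (rule mult_left_mono)
  also have "\<dots> \<le> 1 / 4" using onorm_nonneg by (simp add: divide_simps)
  finally have b2: "onorm L * (?m * \<beta>) \<le> 1 / 4" .
  obtain N :: nat where "16 / \<sigma> / \<beta> \<le> real N" using real_arch_simple by blast
  then have "16 / \<sigma> \<le> real N * \<beta>" using \<beta> by (simp only: pos_divide_le_eq)
  then have "block_chart \<phi> x0 \<rho> L \<sigma> M V vol b k e \<beta> N"
    using e \<beta> b1 b2 good_chart_axioms by (simp add: block_chart_def block_chart_axioms_def)
  then show thesis by (rule that)
qed

section \<open>A chart carrying mass\<close>

text \<open>If all level sets \<open>D p n\<close> were null, each set \<open>H p\<close> would have
  volume zero and the density could not integrate to 1. Some level set thus has positive Lebesgue
  measure, and a compact subset keeps part of it. Including the volume element in the levels allows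
  passing from Lebesgue measure back to volume.\<close>

lemma chart_with_mass:
  fixes M :: "(real ^ 'd) set"
  assumes M: "closed_submanifold TYPE('m::finite) M" and vol: "riemannian_volume TYPE('m) M vol"
    and f: "bounded_probability_density vol f"
  obtains \<phi> :: "real ^ 'm \<Rightarrow> real ^ 'd" and x0 \<rho> L \<sigma> V b K c
  where "good_chart \<phi> x0 \<rho> L \<sigma> M V vol b" "compact K" "K \<subseteq> ball x0 (\<rho> / 2)" "measure lborel K > 0"
    "c > 0 \<and> (\<forall>x\<in>K. c \<le> f (\<phi> x) \<and> c \<le> volume_element \<phi> x)"
proof -
  obtain I :: "(real ^ 'd) set" and \<Phi> :: "real ^ 'd \<Rightarrow> real ^ 'm \<Rightarrow> real ^ 'd" and X R L S V B
    where I: "finite I" and gc: "\<And>p. p \<in> I \<Longrightarrow> good_chart (\<Phi> p) (X p) (R p) (L p) (S p) M (V p) vol (B p)"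
    and cov: "M \<subseteq> (\<Union>p\<in>I. \<Phi> p ` ball (X p) (R p / 2))"
    by (rule finite_good_atlas[OF M vol], rule that, simp_all)
  have fm: "f \<in> borel_measurable vol" and int1: "(\<integral>\<^sup>+x. ennreal (f x) \<partial>vol) = 1"
    using f by (auto simp: bounded_probability_density_def)
  have "I \<noteq> {}"
  proof
    assume "I = {}"
    then have "M = {}" using cov by auto
    then have "space vol = {}"
      using vol sets_eq_imp_space_eq[of vol "restrict_space borel M"] by (auto simp: riemannian_volume_def space_restrict_space)
    then show False using int1 by (simp add: nn_integral_empty)
  qed
  then obtain p0 where p0: "p0 \<in> I" by auto
  define D where "D p n = {x \<in> ball (X p) (R p / 2). 1 / real (Suc n) \<le> f (\<Phi> p x) \<and> 1 / real (Suc n) \<le> volume_element (\<Phi> p) x}" for p n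
  define H where "H p = \<Phi> p ` ball (X p) (R p / 2) \<inter> {y \<in> space vol. 0 < f y}" for p
  have sub: "ball (X p) (R p / 2) \<subseteq> V p" if p: "p \<in> I" for p
    using good_chart.sub[OF gc[OF p]] good_chart.\<rho>[OF gc[OF p]] by auto
  \<comment> \<open>Continuity of the volume element is known on \<open>V p\<close>; the indicator
    makes it a Borel function on the whole space.\<close>
  have ve_meas: "(\<lambda>x. volume_element (\<Phi> p) x * indicator (V p) x) \<in> borel_measurable borel" if p: "p \<in> I" for p
  proof -
    have "continuous_on (V p) (volume_element (\<Phi> p))"
      using good_chart.V_smooth[OF gc[OF p]] by (rule continuous_on_volume_element)
    then have "(\<lambda>x. indicator (V p) x *\<^sub>R volume_element (\<Phi> p) x) \<in> borel_measurable borel"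
      using good_chart.V_open[OF gc[OF p]] by (intro borel_measurable_continuous_on_indicator) auto
    then show ?thesis by (simp add: mult.commute)
  qed
  have lev: "V p \<inter> \<Phi> p -` {y \<in> space vol. t \<le> f y} \<in> sets borel" if p: "p \<in> I" for p t
  proof -
    have "{y \<in> space vol. t \<le> f y} \<in> sets vol" using fm by measurable
    then show ?thesis using good_chart.sets_vol[OF gc[OF p]] by (intro good_chart.borel_vimage[OF gc[OF p]]) auto
  qed
  have Vsp: "\<Phi> p x \<in> space vol" if "p \<in> I" "x \<in> V p" for p x
    using good_chart.image_V_subset[OF gc[OF that(1)]] good_chart.space_vol[OF gc[OF that(1)]] that(2) by auto
  have Db: "D p n \<in> sets borel" if p: "p \<in> I" for p n
  proof -
    have "D p n = ball (X p) (R p / 2) \<inter> (V p \<inter> \<Phi> p -` {y \<in> space vol. 1 / real (Suc n) \<le> f y})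
        \<inter> {x. 1 / real (Suc n) \<le> volume_element (\<Phi> p) x * indicator (V p) x}"
      using sub[OF p] Vsp[OF p] by (auto simp: D_def)
    also have "\<dots> \<in> sets borel"
    proof -
      have "{x \<in> space borel. 1 / real (Suc n) \<le> volume_element (\<Phi> p) x * indicator (V p) x} \<in> sets borel"
        using ve_meas[OF p] by measurable
      then show ?thesis
        by (intro sets.Int[OF sets.Int[OF borel_open[OF open_ball] lev[OF p]]]) simp
    qed
    finally show ?thesis .
  qed
  have Hv: "H p \<in> sets vol" if p: "p \<in> I" for p
  proof -
    have "{y \<in> space vol. 0 < f y} \<in> sets vol" using fm by measurable
    moreover have "\<Phi> p ` ball (X p) (R p / 2) \<in> sets vol"
      using sub[OF p] by (intro good_chart.image_in_sets_vol[OF gc[OF p]]) auto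
    ultimately show ?thesis unfolding H_def by (rule sets.Int[rotated])
  qed
  have "\<exists>p\<in>I. \<exists>n. emeasure lborel (D p n) > 0"
  proof (rule ccontr)
    assume "\<not> ?thesis"
    then have null: "D p n \<in> null_sets lborel" if "p \<in> I" for p n
      using Db[OF that] that by (auto simp: null_sets_def not_gr_zero)
    have "H p \<in> null_sets vol" if p: "p \<in> I" for p
    proof -
      let ?B = "V p \<inter> \<Phi> p -` H p"
      have Hb: "H p \<in> sets borel" using Hv[OF p] good_chart.sets_vol[OF gc[OF p]] by auto
      have "H p \<subseteq> \<Phi> p ` V p" using sub[OF p] by (auto simp: H_def)
      then have "emeasure vol (H p) = (\<integral>\<^sup>+x. ennreal (volume_element (\<Phi> p) x) * indicator ?B x \<partial>lborel)"
        by (rule good_chart.emeasure_vol[OF gc[OF p] Hb])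
      also have "\<dots> = (\<integral>\<^sup>+x. 0 \<partial>(lborel :: (real ^ 'm) measure))"
      proof (rule nn_integral_cong_AE)
        have "(\<Union>n. D p n) \<in> null_sets lborel" using null[OF p] by (intro null_sets_UN) auto
        then have "AE x in lborel. x \<notin> (\<Union>n. D p n)" by (rule AE_not_in)
        then show "AE x in lborel. ennreal (volume_element (\<Phi> p) x) * indicator ?B x = 0"
        proof (rule AE_mp, intro AE_I2 impI)
          fix x assume x: "x \<notin> (\<Union>n. D p n)"
          show "ennreal (volume_element (\<Phi> p) x) * indicator ?B x = 0"
          proof (rule ccontr)
            assume "\<not> ?thesis"
            \<comment> \<open>Where the integrand is nonzero, density and volume element are
              positive, so both reach 1 / (n + 1) for some n; injectivity on \<open>V p\<close>
              places x in the smaller ball.\<close>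
            then have pos: "0 < volume_element (\<Phi> p) x" and xB: "x \<in> ?B"
              by (auto simp: indicator_def ennreal_eq_0_iff not_le split: if_splits)
            then obtain x' where x': "x' \<in> ball (X p) (R p / 2)" "\<Phi> p x' = \<Phi> p x" "0 < f (\<Phi> p x)" by (auto simp: H_def)
            then have "x' = x"
              using good_chart.inj_on_V[OF gc[OF p]] sub[OF p] xB by (auto simp: inj_on_def)
            obtain n where n: "1 / real (Suc n) < min (f (\<Phi> p x)) (volume_element (\<Phi> p) x)"
              using nat_approx_posE[of "min (f (\<Phi> p x)) (volume_element (\<Phi> p) x)"] pos x'(3)
              by (metis min_less_iff_conj of_nat_Suc)
            then have "x \<in> D p n" using x' \<open>x' = x\<close> by (simp add: D_def)
            then show False using x by blast
          qed
        qed
      qed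
      finally show ?thesis using Hv[OF p] by (simp add: null_sets_def)
    qed
    then have "(\<Union>p\<in>I. H p) \<in> null_sets vol" using I by (intro null_sets.finite_UN) auto
    then have "AE y in vol. y \<notin> (\<Union>p\<in>I. H p)" by (rule AE_not_in)
    then have "AE y in vol. ennreal (f y) = 0"
    proof (rule AE_mp, intro AE_I2 impI)
      fix y assume y: "y \<in> space vol" "y \<notin> (\<Union>p\<in>I. H p)"
      then have "y \<in> M" using good_chart.space_vol[OF gc[OF p0]] by simp
      then have "y \<in> (\<Union>p\<in>I. \<Phi> p ` ball (X p) (R p / 2))" using cov by (rule subsetD[rotated])
      then have "\<not> 0 < f y" using y by (auto simp: H_def)
      then show "ennreal (f y) = 0" by (simp add: ennreal_eq_0_iff)
    qed
    then have "(\<integral>\<^sup>+x. ennreal (f x) \<partial>vol) = (\<integral>\<^sup>+x. 0 \<partial>vol)" by (rule nn_integral_cong_AE)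
    then show False using int1 by simp
  qed
  then obtain p n where p: "p \<in> I" and pos: "emeasure lborel (D p n) > 0" by blast
  have Dfin: "emeasure lborel (D p n) < \<infinity>"
    by (intro emeasure_bounded_finite bounded_subset[OF bounded_ball[of "X p" "R p / 2"]]) (auto simp: D_def)
  then have mpos: "measure lborel (D p n) > 0"
    using pos by (simp add: emeasure_eq_ennreal_measure less_top[symmetric])
  have Dl: "D p n \<in> sets lebesgue" using Db[OF p] by (intro sets_completionI_sets) auto
  \<comment> \<open>The part lost has less than the full measure of \<open>D p n\<close>, which is
    why \<open>K\<close> cannot be null.\<close>
  obtain K where K: "closed K" "K \<subseteq> D p n" "emeasure lebesgue (D p n - K) < ennreal (measure lborel (D p n))"
    using sets_lebesgue_inner_closed[OF Dl mpos] by metis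
  have "bounded K" using K(2) by (intro bounded_subset[OF bounded_ball[of "X p" "R p / 2"]]) (auto simp: D_def)
  then have cK: "compact K" using K(1) by (simp add: compact_eq_bounded_closed)
  have "emeasure lborel K \<noteq> 0"
  proof
    assume "emeasure lborel K = 0"
    then have "K \<in> null_sets lborel" using K(1) by (auto simp: null_sets_def)
    then have "emeasure lborel (D p n - K) = emeasure lborel (D p n)"
      using Db[OF p] by (intro emeasure_Diff_null_set) auto
    moreover have "emeasure lebesgue (D p n - K) = emeasure lborel (D p n - K)"
    proof -
      have "D p n - K \<in> sets lborel" using Db[OF p] K(1) by (simp add: borel_closed sets.Diff)
      then show ?thesis by (simp add: sets_completionI_sets)
    qed
    ultimately show False using K(3) Dfin by (simp add: emeasure_eq_ennreal_measure)
  qed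
  then have "measure lborel K > 0"
    using emeasure_compact_finite[OF cK] by (simp add: emeasure_eq_ennreal_measure zero_less_measure_iff)
  moreover have "K \<subseteq> ball (X p) (R p / 2)" using K(2) by (auto simp: D_def)
  ultimately show thesis
    using K(2) by (intro that[OF gc[OF p] cK, of "1 / real (Suc n)"]) (auto simp: D_def)
qed

section \<open>Asymptotics\<close>

text \<open>Dividing the convergent sequence by n shows that the m-th powers of the radii tend to
  0.\<close>

lemma radius_tendsto_0:
  fixes r :: "nat \<Rightarrow> real"
  assumes lim: "(\<lambda>n. real n * r n ^ m) \<longlonglongrightarrow> lam" and pos: "\<And>n. n \<ge> 1 \<Longrightarrow> r n > 0" and t: "t > 0"
  shows "eventually (\<lambda>n. r n < t) sequentially"
proof -
  have "(\<lambda>n. real n * r n ^ m * inverse (real n)) \<longlonglongrightarrow> lam * 0"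
    by (intro tendsto_mult lim lim_inverse_n)
  then have "eventually (\<lambda>n. real n * r n ^ m * inverse (real n) < t ^ m) sequentially"
    using t by (intro order_tendstoD(2)) auto
  then show ?thesis using eventually_ge_at_top[of 1]
  proof eventually_elim
    case (elim n)
    moreover have "real n * r n ^ m * inverse (real n) = r n ^ m"
      using elim by (simp add: field_simps)
    ultimately have "r n ^ m < t ^ m" by simp
    then show "r n < t" using t by (intro power_less_imp_less_base[of "r n" m t]) auto
  qed
qed

lemma bounded_density_bound:
  assumes "bounded_probability_density \<mu> f"
  obtains F where "F > 0" "\<And>x. x \<in> space \<mu> \<Longrightarrow> f x \<le> F"
proof -
  have "bounded (f ` space \<mu>)" using assms by (simp add: bounded_probability_density_def)
  then obtain F where F: "F > 0" "\<forall>y\<in>f ` space \<mu>. norm y \<le> F" by (auto simp: bounded_pos)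
  have "f x \<le> F" if "x \<in> space \<mu>" for x using F(2) that by (auto simp: abs_le_iff)
  then show thesis by (rule that[OF F(1)])
qed

lemma expected_betti_upper:
  fixes M :: "(real ^ 'd) set"
  assumes M: "closed_submanifold TYPE('m::finite) M" and vol: "riemannian_volume TYPE('m) M vol"
    and f: "bounded_probability_density vol f"
    and P: "\<And>n. n \<ge> 1 \<Longrightarrow> poisson_process_with_intensity \<Omega> vol (\<lambda>x. real n * f x) (P n)"
    and r: "\<And>n. n \<ge> 1 \<Longrightarrow> r n > 0" and lam: "lam > 0"
    and lim: "(\<lambda>n. real n * r n ^ CARD('m)) \<longlonglongrightarrow> lam"
  shows "\<exists>C. eventually (\<lambda>n. expected_betti \<Omega> k (\<lambda>\<omega>. ball_union (P n \<omega>) (r n)) / of_nat n \<le> ennreal C) sequentially"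
proof -
  let ?m = "CARD('m)"
  obtain I :: "(real ^ 'd) set" and \<Phi> :: "real ^ 'd \<Rightarrow> real ^ 'm \<Rightarrow> real ^ 'd" and X R L S V B
    where I: "finite I" and gc: "\<And>p. p \<in> I \<Longrightarrow> good_chart (\<Phi> p) (X p) (R p) (L p) (S p) M (V p) vol (B p)"
    and cov: "M \<subseteq> (\<Union>p\<in>I. \<Phi> p ` ball (X p) (R p / 2))"
    by (rule finite_good_atlas[OF M vol], rule that, simp_all)
  have cov': "M \<subseteq> (\<Union>p\<in>I. \<Phi> p ` ball (X p) (R p))"
  proof
    fix y assume "y \<in> M"
    then obtain p x where p: "p \<in> I" "x \<in> ball (X p) (R p / 2)" "y = \<Phi> p x" using cov by blast
    then have "x \<in> ball (X p) (R p)" using good_chart.\<rho>[OF gc[OF p(1)]] by auto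
    then show "y \<in> (\<Union>p\<in>I. \<Phi> p ` ball (X p) (R p))" using p by blast
  qed
  have sets_vol: "sets vol = sets (restrict_space borel M)" using vol by (simp add: riemannian_volume_def)
  have sp: "space vol = M"
    using sets_eq_imp_space_eq[OF sets_vol] by (simp add: space_restrict_space)
  have Mb: "M \<in> sets borel" using M by (simp add: closed_submanifold_def borel_compact)
  have in_vol: "A \<in> sets borel \<Longrightarrow> A \<subseteq> M \<Longrightarrow> A \<in> sets vol" for A
    using Mb by (simp add: sets_vol sets_restrict_space_iff)
  obtain F where F: "F > 0" "\<And>x. x \<in> M \<Longrightarrow> f x \<le> F" using bounded_density_bound[OF f] sp by metis
  define q where "q p = B p * (unit_ball_vol (real ?m) * (4 / S p) ^ ?m)" for p
  have q: "q p \<ge> 0" if "p \<in> I" for p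
    using good_chart.b[OF gc[OF that]] flat_chart.\<sigma>[OF good_chart.axioms(1)[OF gc[OF that]]] by (simp add: q_def)
  define W where "W = (\<Sum>p\<in>I. q p)"
  have W: "W \<ge> 0" unfolding W_def using q by (rule sum_nonneg)
  have vol_ball: "emeasure vol (M \<inter> cball y t) \<le> ennreal (W * t ^ ?m)" if t: "t \<ge> 0" for y t
  proof -
    have img: "\<Phi> p ` ball (X p) (R p) \<inter> cball y t \<in> sets vol" if p: "p \<in> I" for p
    proof -
      have "\<Phi> p ` ball (X p) (R p) \<in> sets vol"
        using good_chart.sub[OF gc[OF p]] by (intro good_chart.image_in_sets_vol[OF gc[OF p]]) auto
      then show ?thesis using good_chart.sets_vol[OF gc[OF p]] by auto
    qed
    have "emeasure vol (M \<inter> cball y t) \<le> emeasure vol (\<Union>p\<in>I. \<Phi> p ` ball (X p) (R p) \<inter> cball y t)"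
    proof (rule emeasure_mono)
      show "M \<inter> cball y t \<subseteq> (\<Union>p\<in>I. \<Phi> p ` ball (X p) (R p) \<inter> cball y t)" using cov' by blast
      show "(\<Union>p\<in>I. \<Phi> p ` ball (X p) (R p) \<inter> cball y t) \<in> sets vol" using I img by (rule sets.finite_UN)
    qed
    also have "\<dots> \<le> (\<Sum>p\<in>I. emeasure vol (\<Phi> p ` ball (X p) (R p) \<inter> cball y t))"
      using img I by (intro emeasure_subadditive_finite) auto
    also have "\<dots> \<le> (\<Sum>p\<in>I. ennreal (q p * t ^ ?m))"
      unfolding q_def using t by (intro sum_mono good_chart.emeasure_vol_cball_le[OF gc])
    also have "\<dots> = ennreal (W * t ^ ?m)"
      using q t by (simp add: W_def sum_distrib_right)
    finally show ?thesis .
  qed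
  define D where "D p = (onorm (L p) + S p) * real ?m" for p
  \<comment> \<open>The sum serves as a common upper bound for the finitely many radii.\<close>
  define D0 where "D0 = (\<Sum>p\<in>I. D p)"
  have D: "D p \<ge> 0" if "p \<in> I" for p
    using flat_chart.\<sigma>[OF good_chart.axioms(1)[OF gc[OF that]]]
      flat_chart.onorm_nonneg[OF good_chart.axioms(1)[OF gc[OF that]]] by (simp add: D_def)
  have D_le: "D p \<le> D0" if "p \<in> I" for p unfolding D0_def using D I that by (intro member_le_sum) auto
  have D0: "D0 \<ge> 0" unfolding D0_def using D by (rule sum_nonneg)
  define N0 where "N0 = (\<Sum>p\<in>I. measure lborel (cball (X p) (R p + real ?m)))"
  have N0: "N0 \<ge> 0" unfolding N0_def by (intro sum_nonneg) auto
  have cover: "\<exists>G. finite G \<and> real (card G) * t ^ ?m \<le> N0 \<and> M \<subseteq> (\<Union>y\<in>G. cball y (D0 * t))"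
    if t: "0 < t" "t \<le> 1" for t
  proof -
    have "\<forall>p\<in>I. \<exists>G. finite G \<and> real (card G) * t ^ ?m \<le> measure lborel (cball (X p) (R p + real ?m)) \<and>
           \<Phi> p ` ball (X p) (R p) \<subseteq> (\<Union>y\<in>G. cball y (D p * t))"
      unfolding D_def using good_chart.cover_image_by_cballs[OF gc t] by blast
    then obtain G where G: "\<And>p. p \<in> I \<Longrightarrow> finite (G p)"
      "\<And>p. p \<in> I \<Longrightarrow> real (card (G p)) * t ^ ?m \<le> measure lborel (cball (X p) (R p + real ?m))"
      "\<And>p. p \<in> I \<Longrightarrow> \<Phi> p ` ball (X p) (R p) \<subseteq> (\<Union>y\<in>G p. cball y (D p * t))"
      by metis
    have "card (\<Union>p\<in>I. G p) \<le> (\<Sum>p\<in>I. card (G p))" using I by (rule card_UN_le)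
    then have "real (card (\<Union>p\<in>I. G p)) \<le> (\<Sum>p\<in>I. real (card (G p)))" by (metis of_nat_le_iff of_nat_sum)
    then have "real (card (\<Union>p\<in>I. G p)) * t ^ ?m \<le> (\<Sum>p\<in>I. real (card (G p))) * t ^ ?m"
      using t by (intro mult_right_mono) auto
    also have "\<dots> \<le> N0" unfolding N0_def sum_distrib_right using G(2) by (intro sum_mono)
    finally have 1: "real (card (\<Union>p\<in>I. G p)) * t ^ ?m \<le> N0" .
    have 2: "M \<subseteq> (\<Union>y\<in>(\<Union>p\<in>I. G p). cball y (D0 * t))"
    proof
      fix x assume "x \<in> M"
      then obtain p where p: "p \<in> I" "x \<in> \<Phi> p ` ball (X p) (R p)" using cov' by blast
      then obtain y where y: "y \<in> G p" "x \<in> cball y (D p * t)" using G(3) by blast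
      have "D p * t \<le> D0 * t" using D_le[OF p(1)] t by (intro mult_right_mono) auto
      then have "x \<in> cball y (D0 * t)" using y(2) by simp
      then show "x \<in> (\<Union>y\<in>(\<Union>p\<in>I. G p). cball y (D0 * t))" using p(1) y(1) by blast
    qed
    show ?thesis using 1 2 G(1) I by (intro exI[of _ "\<Union>p\<in>I. G p"]) auto
  qed
  \<comment> \<open>Bounds the mean number of points in a ball of radius
    \<open>(D0 + 4) * r n\<close>: the intensity is at most n F, the volume at most W times the m-th
    power of the radius, and eventually \<open>real n * r n ^ CARD('m)\<close> is below 2
    lam.\<close>
  define C where "C = F * W * (D0 + 4) ^ ?m * (2 * lam)"
  have "eventually (\<lambda>n. real n * r n ^ ?m < 2 * lam) sequentially"
    using lim lam by (intro order_tendstoD(2)) auto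
  moreover have "eventually (\<lambda>n. real n * r n ^ ?m > lam / 2) sequentially"
    using lim lam by (intro order_tendstoD(1)) auto
  moreover have "eventually (\<lambda>n. r n < 1) sequentially" by (rule radius_tendsto_0[OF lim r]) auto
  ultimately have "eventually (\<lambda>n. expected_betti \<Omega> k (\<lambda>\<omega>. ball_union (P n \<omega>) (r n)) / of_nat n
     \<le> ennreal (2 * N0 * exp C / lam)) sequentially"
    using eventually_ge_at_top[of 1]
  proof eventually_elim
    case (elim n)
    let ?\<Lambda> = "density vol (\<lambda>x. ennreal (real n * f x))"
    have rn: "r n > 0" "r n \<le> 1" using r elim by auto
    have PP: "poisson_process \<Omega> ?\<Lambda> (P n)"
      using P[of n] elim by (simp add: poisson_process_with_intensity_def)
    have fin: "finite_measure ?\<Lambda>" using PP by (simp add: poisson_process_def)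
    obtain G where G: "finite G" "real (card G) * r n ^ ?m \<le> N0" "M \<subseteq> (\<Union>y\<in>G. cball y (D0 * r n))"
      using cover[OF rn] by blast
    have bnd: "measure ?\<Lambda> (M \<inter> cball y (D0 * r n + 4 * r n)) \<le> C" for y
    proof -
      have fm: "f \<in> borel_measurable vol" using f by (simp add: bounded_probability_density_def)
      have A: "M \<inter> cball y (D0 * r n + 4 * r n) \<in> sets vol" using Mb by (intro in_vol) auto
      have "measure ?\<Lambda> (M \<inter> cball y (D0 * r n + 4 * r n)) \<le> real n * F * (W * (D0 * r n + 4 * r n) ^ ?m)"
        using F W D0 rn by (intro density_measure_bounds(1)[OF fm A fin _ _ _ vol_ball]) auto
      also have "\<dots> = F * W * (D0 + 4) ^ ?m * (real n * r n ^ ?m)"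
        by (simp add: power_mult_distrib flip: distrib_right)
      also have "\<dots> \<le> C"
        unfolding C_def using F W D0 elim by (intro mult_left_mono) auto
      finally show ?thesis .
    qed
    have "expected_betti \<Omega> k (\<lambda>\<omega>. ball_union (P n \<omega>) (r n)) \<le> ennreal (real (card G) * exp C)"
    proof (rule expected_betti_le[OF PP rn(1) G(1), where D = "D0 * r n"])
      show "space ?\<Lambda> \<subseteq> (\<Union>y\<in>G. cball y (D0 * r n))" using G(3) sp by simp
      show "space ?\<Lambda> \<inter> cball y (D0 * r n + 4 * r n) \<in> sets ?\<Lambda>" for y
        using Mb sp by (auto intro!: in_vol)
      show "measure ?\<Lambda> (space ?\<Lambda> \<inter> cball y (D0 * r n + 4 * r n)) \<le> C" for y
        using bnd[of y] sp by simp
    qed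
    then have "expected_betti \<Omega> k (\<lambda>\<omega>. ball_union (P n \<omega>) (r n)) / of_nat n \<le> ennreal (real (card G) * exp C) / of_nat n"
      by (rule divide_right_mono_ennreal)
    also have "\<dots> = ennreal (real (card G) * exp C / real n)"
      using elim by (simp add: divide_ennreal ennreal_of_nat_eq_real_of_nat)
    also have "\<dots> \<le> ennreal (2 * N0 * exp C / lam)"
    proof (rule ennreal_leI)
      have n: "real n > 0" using elim by simp
      \<comment> \<open>Here the limit is used from below: it turns a number of balls of order
        \<open>1 / r n ^ CARD('m)\<close> into one of order n.\<close>
      have "real (card G) * (lam / 2) \<le> real (card G) * (real n * r n ^ ?m)"
        using elim by (intro mult_left_mono) auto
      also have "\<dots> = real n * (real (card G) * r n ^ ?m)" by simp
      also have "\<dots> \<le> real n * N0" using G(2) by (intro mult_left_mono) auto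
      finally have "real (card G) / real n \<le> 2 * N0 / lam" using n lam by (simp add: field_simps)
      then have "real (card G) / real n * exp C \<le> 2 * N0 / lam * exp C" by (intro mult_right_mono) auto
      then show "real (card G) * exp C / real n \<le> 2 * N0 * exp C / lam" by simp
    qed
    finally show ?case .
  qed
  then show ?thesis by blast
qed

lemma expected_betti_lower:
  fixes M :: "(real ^ 'd) set"
  assumes M: "closed_submanifold TYPE('m::finite) M" and vol: "riemannian_volume TYPE('m) M vol"
    and f: "bounded_probability_density vol f"
    and P: "\<And>n. n \<ge> 1 \<Longrightarrow> poisson_process_with_intensity \<Omega> vol (\<lambda>x. real n * f x) (P n)"
    and r: "\<And>n. n \<ge> 1 \<Longrightarrow> r n > 0" and lam: "lam > 0"
    and lim: "(\<lambda>n. real n * r n ^ CARD('m)) \<longlonglongrightarrow> lam"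
    and k: "1 \<le> k" "k < CARD('m)"
  shows "\<exists>\<delta>>0. eventually (\<lambda>n. ennreal \<delta> \<le> expected_betti \<Omega> k (\<lambda>\<omega>. ball_union (P n \<omega>) (r n)) / of_nat n) sequentially"
proof -
  let ?m = "CARD('m)"
  obtain \<phi> :: "real ^ 'm \<Rightarrow> real ^ 'd" and x0 \<rho> L \<sigma> V b K c
    where gc: "good_chart \<phi> x0 \<rho> L \<sigma> M V vol b" and cK: "compact K" and Ksub: "K \<subseteq> ball x0 (\<rho> / 2)"
      and Kpos: "measure lborel K > 0" and "c > 0 \<and> (\<forall>x\<in>K. c \<le> f (\<phi> x) \<and> c \<le> volume_element \<phi> x)"
    by (rule chart_with_mass[OF M vol f], rule that, assumption+)
  then have c: "c > 0" and fK: "\<And>x. x \<in> K \<Longrightarrow> c \<le> f (\<phi> x)" and vK: "\<And>x. x \<in> K \<Longrightarrow> c \<le> volume_element \<phi> x"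
    by auto
  interpret good_chart \<phi> x0 \<rho> L \<sigma> M V vol b by fact
  obtain e \<beta> N where "block_chart \<phi> x0 \<rho> L \<sigma> M V vol b k e \<beta> N" using block_chart_exists[OF k(2)] .
  then interpret block_chart \<phi> x0 \<rho> L \<sigma> M V vol b k e \<beta> N .
  obtain F where F: "F > 0" "\<And>x. x \<in> M \<Longrightarrow> f x \<le> F" using bounded_density_bound[OF f] space_vol by metis
  have fm: "f \<in> borel_measurable vol" using f by (simp add: bounded_probability_density_def)
  have half: "ball x0 (\<rho> / 2) \<subseteq> ball x0 \<rho>" "cball x0 (\<rho> / 2) \<subseteq> ball x0 \<rho>" using \<rho> by auto
  \<comment> \<open>The image of the closed inner ball is compact and disjoint from the closed
    remainder of \<open>M\<close>, so their distance is positive and eventually exceeds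
    \<open>2 * r n\<close>.\<close>
  obtain d0 where d0: "d0 > 0" "\<And>x y. x \<in> ball x0 (\<rho> / 2) \<Longrightarrow> y \<in> M - \<phi> ` ball x0 \<rho> \<Longrightarrow> d0 \<le> dist (\<phi> x) y"
  proof -
    have "compact (\<phi> ` cball x0 (\<rho> / 2))"
      using half(2) sub by (intro compact_continuous_image continuous_on_subset[OF continuous_on_chart]) auto
    moreover have "closed (M - \<phi> ` ball x0 \<rho>)"
    proof -
      obtain U where "open U" "\<phi> ` ball x0 \<rho> = M \<inter> U" using openin_image[OF open_ball sub] by (auto simp: openin_open)
      then have "M - \<phi> ` ball x0 \<rho> = M - U" by auto
      then show ?thesis using compact_M \<open>open U\<close> by (simp add: closed_Diff compact_imp_closed)
    qed
    moreover have "\<phi> ` cball x0 (\<rho> / 2) \<inter> (M - \<phi> ` ball x0 \<rho>) = {}" using half(2) by blast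
    ultimately obtain d where "d > 0" "\<forall>x\<in>\<phi> ` cball x0 (\<rho> / 2). \<forall>y\<in>M - \<phi> ` ball x0 \<rho>. d \<le> dist x y"
      using separate_compact_closed by metis
    then show thesis by (intro that[of d]) auto
  qed
  \<comment> \<open>In a block of side N s the part outside \<open>K\<close> then has measure at
    most \<eta> (N s)^m = s^m / 2. Even if all of it fell into a single subcube, half of that
    subcube would lie in \<open>K\<close>.\<close>
  define \<eta> where "\<eta> = 1 / (2 * real N ^ ?m)"
  have \<eta>: "\<eta> > 0" using N_pos by (simp add: \<eta>_def)
  obtain h0 where h0: "h0 > 0" and grid: "\<And>h. 0 < h \<Longrightarrow> h < h0 \<Longrightarrow>
     \<exists>G. finite G \<and> measure lborel K / 2 \<le> real (card G) * h ^ ?m \<and>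
       (\<forall>z\<in>G. grid_cube h z \<subseteq> ball x0 (\<rho> / 2) \<and> measure lborel (grid_cube h z - K) \<le> \<eta> * h ^ ?m)"
    using nearly_full_grid_cubes[OF cK Kpos open_ball Ksub \<eta>] by metis
  \<comment> \<open>Bounds for the mean number of points in a subcube. In \<open>c1\<close> one
    factor c stands for the density and one for the volume element, 1/2 for the share of
    \<open>K\<close> and lam / 2 for the limit; \<open>c2\<close> takes the corresponding upper
    bounds.\<close>
  define c1 where "c1 = c * c * \<beta> ^ ?m / 2 * (lam / 2)"
  define c2 where "c2 = F * b * \<beta> ^ ?m * (2 * lam)"
  \<comment> \<open>The exponent bounds the number of subcubes of a block, and the base is at most
    1.\<close>
  define p0 where "p0 = min (1 - exp (- c1)) (exp (- c2)) ^ (N ^ ?m)"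
  have c1: "c1 > 0" using c \<beta>(1) lam by (simp add: c1_def)
  have qb: "0 < min (1 - exp (- c1)) (exp (- c2))" "min (1 - exp (- c1)) (exp (- c2)) \<le> 1"
    using c1 by (auto simp: min_le_iff_disj)
  have p0: "p0 > 0" unfolding p0_def using qb(1) by simp
  \<comment> \<open>Blocks divided by n, times the probability for each: the blocks fill at least
    half the measure of \<open>K\<close>, and eventually each has volume below
    \<open>(real N * \<beta>) ^ CARD('m) * (2 * lam) / real n\<close>.\<close>
  define \<delta> where "\<delta> = measure lborel K / 2 / ((real N * \<beta>) ^ ?m * (2 * lam)) * p0"
  have \<delta>: "\<delta> > 0" using Kpos N_pos \<beta>(1) lam p0 by (simp add: \<delta>_def)
  have "eventually (\<lambda>n. real n * r n ^ ?m < 2 * lam) sequentially"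
    using lim lam by (intro order_tendstoD(2)) auto
  moreover have "eventually (\<lambda>n. real n * r n ^ ?m > lam / 2) sequentially"
    using lim lam by (intro order_tendstoD(1)) auto
  moreover have "eventually (\<lambda>n. r n < d0 / 2) sequentially" using d0 by (intro radius_tendsto_0[OF lim r]) auto
  moreover have "eventually (\<lambda>n. r n < h0 / (real N * \<beta>)) sequentially"
    using h0 N_pos \<beta>(1) by (intro radius_tendsto_0[OF lim r]) auto
  ultimately have "eventually (\<lambda>n. ennreal \<delta> \<le> expected_betti \<Omega> k (\<lambda>\<omega>. ball_union (P n \<omega>) (r n)) / of_nat n) sequentially"
    using eventually_ge_at_top[of 1]
  proof eventually_elim
    case (elim n)
    let ?\<Lambda> = "density vol (\<lambda>x. ennreal (real n * f x))"
    let ?s = "\<beta> * r n" and ?h = "real N * (\<beta> * r n)"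
    have rn: "r n > 0" using r elim by auto
    have s: "?s > 0" using rn \<beta>(1) by simp
    have h: "?h > 0" using s N_pos by simp
    have "r n * (real N * \<beta>) < h0" using elim(4) N_pos \<beta>(1) by (subst (asm) pos_less_divide_eq) auto
    then have h': "?h < h0" by (simp add: mult_ac)
    have PP: "poisson_process \<Omega> ?\<Lambda> (P n)"
      using P[of n] elim by (simp add: poisson_process_with_intensity_def)
    have fin: "finite_measure ?\<Lambda>" using PP by (simp add: poisson_process_def)
    obtain G where G: "finite G" "measure lborel K / 2 \<le> real (card G) * ?h ^ ?m"
      and GQ: "\<And>z. z \<in> G \<Longrightarrow> grid_cube ?h z \<subseteq> ball x0 (\<rho> / 2)"
      and GK: "\<And>z. z \<in> G \<Longrightarrow> measure lborel (grid_cube ?h z - K) \<le> \<eta> * ?h ^ ?m"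
      using grid[OF h h'] by blast
    have fin_blk: "finite (block_cubes N z)" and card_blk: "card (block_cubes N z) \<le> N ^ ?m" for z :: "int ^ 'm"
      using grid_cube_children[OF N_pos, of z] by (auto simp: block_cubes_def)
    have cube_sub: "grid_cube ?s z' \<subseteq> ball x0 \<rho>" if "z \<in> G" "z' \<in> block_cubes N z" for z z'
      using GQ[OF that(1)] that(2) block_eq[OF rn, of z] half(1) by blast
    have img: "\<phi> ` grid_cube ?s z' \<in> sets vol" if "z \<in> G" "z' \<in> block_cubes N z" for z z'
      using cube_sub[OF that] sub s by (intro image_in_sets_vol borel_grid_cube) auto
    have hi: "measure ?\<Lambda> (\<phi> ` grid_cube ?s z') \<le> c2" if z: "z \<in> G" "z' \<in> block_cubes N z" for z z'
    proof -
      have "emeasure vol (\<phi> ` grid_cube ?s z') \<le> ennreal b * emeasure lborel (grid_cube ?s z')"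
        using cube_sub[OF z] s by (intro emeasure_vol_image_le borel_grid_cube)
      also have "\<dots> = ennreal (b * ?s ^ ?m)" using b s by (simp add: emeasure_grid_cube ennreal_mult)
      finally have "measure ?\<Lambda> (\<phi> ` grid_cube ?s z') \<le> real n * F * (b * ?s ^ ?m)"
        using F(2) F(1) b s sets.sets_into_space[OF img[OF z]] space_vol
        by (intro density_measure_bounds(1)[OF fm img[OF z] fin]) auto
      also have "\<dots> = F * b * \<beta> ^ ?m * (real n * r n ^ ?m)" by (simp add: power_mult_distrib)
      also have "\<dots> \<le> c2" unfolding c2_def using F(1) b \<beta>(1) elim by (intro mult_left_mono) auto
      finally show ?thesis .
    qed
    have lo: "c1 \<le> measure ?\<Lambda> (\<phi> ` grid_cube ?s z')" if z: "z \<in> G" "z' \<in> block_cubes N z" for z z'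
    proof -
      let ?C = "grid_cube ?s z'"
      have Cb: "?C \<in> sets borel" and Kb: "K \<in> sets borel" using s cK by (auto simp: borel_compact)
      have Cfin: "emeasure lborel ?C \<noteq> \<infinity>" using s by (simp add: emeasure_grid_cube)
      have hm: "?h ^ ?m = real N ^ ?m * ?s ^ ?m" by (simp add: power_mult_distrib)
      have fmQ: "grid_cube ?h z - K \<in> fmeasurable lborel"
      proof (rule fmeasurableI2)
        show "grid_cube ?h z \<in> fmeasurable lborel" using h by (intro fmeasurableI) (auto simp: emeasure_grid_cube)
      qed (use h Kb in auto)
      have "?C - K \<subseteq> grid_cube ?h z - K" using z(2) block_eq[OF rn, of z] by blast
      then have "measure lborel (?C - K) \<le> measure lborel (grid_cube ?h z - K)"
        using fmQ Cb Kb by (intro measure_mono_fmeasurable) auto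
      also have "\<dots> \<le> \<eta> * ?h ^ ?m" by (rule GK[OF z(1)])
      also have "\<dots> = ?s ^ ?m / 2" unfolding hm \<eta>_def using N_pos by simp
      finally have small: "measure lborel (?C - K) \<le> ?s ^ ?m / 2" .
      have CKfin: "emeasure lborel (?C \<inter> K) \<noteq> \<infinity>" "emeasure lborel (?C - K) \<noteq> \<infinity>"
        using emeasure_mono[of "?C \<inter> K" ?C lborel] emeasure_mono[of "?C - K" ?C lborel] Cb Cfin
        by (auto simp: top_unique)
      have "measure lborel ((?C - K) \<union> (?C \<inter> K)) = measure lborel (?C - K) + measure lborel (?C \<inter> K)"
        using Cb Kb CKfin by (intro measure_Union) auto
      moreover have "(?C - K) \<union> (?C \<inter> K) = ?C" by blast
      moreover have "measure lborel ?C = ?s ^ ?m" using s by (simp add: measure_def emeasure_grid_cube)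
      ultimately have big: "?s ^ ?m / 2 \<le> measure lborel (?C \<inter> K)" using small by simp
      have sub': "?C \<inter> K \<subseteq> ball x0 \<rho>" using cube_sub[OF z] by auto
      have "ennreal (c * (?s ^ ?m / 2)) \<le> ennreal c * emeasure lborel (?C \<inter> K)"
        using big c s CKfin by (simp add: emeasure_eq_ennreal_measure ennreal_mult[symmetric] ennreal_leI)
      also have "\<dots> \<le> emeasure vol (\<phi> ` (?C \<inter> K))"
        using vK Cb Kb sub' by (intro emeasure_vol_image_ge) auto
      finally have "real n * c * (c * (?s ^ ?m / 2)) \<le> measure ?\<Lambda> (\<phi> ` ?C)"
        using fK c s sub sub' Cb Kb
        by (intro density_measure_bounds(2)[OF fm img[OF z] fin, of "\<phi> ` (?C \<inter> K)"] image_in_sets_vol) auto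
      moreover have "real n * c * (c * (?s ^ ?m / 2)) = c * c * \<beta> ^ ?m / 2 * (real n * r n ^ ?m)"
        by (simp add: power_mult_distrib)
      moreover have "c1 \<le> c * c * \<beta> ^ ?m / 2 * (real n * r n ^ ?m)"
        unfolding c1_def using c \<beta>(1) elim by (intro mult_left_mono) auto
      ultimately show ?thesis by linarith
    qed
    define E where "E z = {\<omega> \<in> space \<Omega>. \<forall>z'\<in>block_cubes N z.
       card (P n \<omega> \<inter> \<phi> ` grid_cube ?s z') = 0 \<longleftrightarrow> \<not> occupied (r n) z z'}" for z
    have E: "E z \<in> sets \<Omega>" "p0 \<le> measure \<Omega> (E z)" if z: "z \<in> G" for z
    proof -
      have "disjoint_family_on (\<lambda>z'. \<phi> ` grid_cube ?s z') (block_cubes N z)"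
        unfolding disjoint_family_on_def
        using inj_on_image_Int[OF inj_on_chart cube_sub[OF z] cube_sub[OF z]] grid_cube_disjoint
        by (metis image_empty)
      note conf = poisson_configuration_prob[OF PP fin_blk, where A = "\<lambda>z'. \<phi> ` grid_cube ?s z'",
          OF _ this c1 lo[OF z] hi[OF z], of "occupied (r n) z"]
      have im: "\<phi> ` grid_cube ?s z' \<in> sets ?\<Lambda>" if "z' \<in> block_cubes N z" for z' using img[OF z that] by simp
      show "E z \<in> sets \<Omega>" unfolding E_def using conf(1)[OF im] .
      have "p0 \<le> min (1 - exp (- c1)) (exp (- c2)) ^ card (block_cubes N z)"
        unfolding p0_def using qb card_blk by (intro power_decreasing) auto
      also have "\<dots> \<le> measure \<Omega> (E z)" unfolding E_def using conf(2)[OF im] .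
      finally show "p0 \<le> measure \<Omega> (E z)" .
    qed
    have pw: "(\<Sum>z\<in>G. indicator (E z) \<omega>) \<le> ennreal_of_enat (betti k (ball_union (P n \<omega>) (r n)))"
      if \<omega>: "\<omega> \<in> space \<Omega>" for \<omega>
    proof -
      let ?G = "{z \<in> G. \<omega> \<in> E z}"
      have P\<omega>: "finite (P n \<omega>)" "P n \<omega> \<subseteq> M" using PP \<omega> space_vol by (auto simp: poisson_process_def)
      have "enat (card ?G) \<le> betti k (ball_union (P n \<omega>) (r n))"
      proof (rule betti_ge_card_blocks[OF k(1) rn P\<omega> _ _ d0(2)])
        show "2 * r n < d0" using elim by simp
      qed (use G(1) GQ in \<open>auto simp: E_def\<close>)
      then have "ennreal_of_enat (enat (card ?G)) \<le> ennreal_of_enat (betti k (ball_union (P n \<omega>) (r n)))"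
        by (rule ennreal_of_enat_mono)
      moreover have "(\<Sum>z\<in>G. indicator (E z) \<omega>) = (of_nat (card ?G) :: ennreal)"
        using G(1) by (simp add: indicator_def sum.If_cases Int_def)
      ultimately show ?thesis by simp
    qed
    have "ennreal (real (card G) * p0) = (\<Sum>z\<in>G. ennreal p0)"
      using p0 by (simp add: ennreal_mult ennreal_of_nat_eq_real_of_nat)
    also have "\<dots> \<le> (\<Sum>z\<in>G. emeasure \<Omega> (E z))"
    proof (rule sum_mono)
      interpret prob_space \<Omega> using PP by (simp add: poisson_process_def)
      fix z assume "z \<in> G"
      then show "ennreal p0 \<le> emeasure \<Omega> (E z)" using E(2) by (simp add: emeasure_eq_measure ennreal_leI)
    qed
    also have "\<dots> = (\<Sum>z\<in>G. \<integral>\<^sup>+\<omega>. indicator (E z) \<omega> \<partial>\<Omega>)" using E(1) by simp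
    \<comment> \<open>Linearity of expectation, whatever the dependence between the blocks.\<close>
    also have "\<dots> = (\<integral>\<^sup>+\<omega>. (\<Sum>z\<in>G. indicator (E z) \<omega>) \<partial>\<Omega>)" using E(1) by (intro nn_integral_sum[symmetric]) auto
    also have "\<dots> \<le> expected_betti \<Omega> k (\<lambda>\<omega>. ball_union (P n \<omega>) (r n))"
      unfolding expected_betti_def using pw by (rule nn_integral_mono)
    finally have "ennreal (real (card G) * p0) / of_nat n \<le> expected_betti \<Omega> k (\<lambda>\<omega>. ball_union (P n \<omega>) (r n)) / of_nat n"
      by (rule divide_right_mono_ennreal)
    moreover have "ennreal (real (card G) * p0) / of_nat n = ennreal (real (card G) * p0 / real n)"
      using elim p0 by (simp add: divide_ennreal ennreal_of_nat_eq_real_of_nat)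
    moreover have "\<delta> \<le> real (card G) * p0 / real n"
    proof -
      have n: "real n > 0" using elim by simp
      have hm: "?h ^ ?m = (real N * \<beta>) ^ ?m * r n ^ ?m" by (simp add: power_mult_distrib)
      have NB: "(real N * \<beta>) ^ ?m > 0" using N_pos \<beta>(1) by simp
      have "real n * (measure lborel K / 2) \<le> real n * (real (card G) * ?h ^ ?m)"
        using G(2) by (intro mult_left_mono) auto
      also have "\<dots> = real (card G) * (real N * \<beta>) ^ ?m * (real n * r n ^ ?m)" by (simp add: hm)
      also have "\<dots> \<le> real (card G) * (real N * \<beta>) ^ ?m * (2 * lam)"
        using elim NB by (intro mult_left_mono) auto
      finally have "measure lborel K / 2 / ((real N * \<beta>) ^ ?m * (2 * lam)) \<le> real (card G) / real n"
        using n NB lam by (simp add: field_simps)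
      then have "measure lborel K / 2 / ((real N * \<beta>) ^ ?m * (2 * lam)) * p0 \<le> real (card G) / real n * p0"
        using p0 by (intro mult_right_mono) auto
      then show ?thesis by (simp add: \<delta>_def)
    qed
    then have "ennreal \<delta> \<le> ennreal (real (card G) * p0 / real n)" by (rule ennreal_leI)
    ultimately show ?case by (simp only:)
  qed
  then show ?thesis using \<delta> by blast
qed

theorem theorem4p3:
  fixes M :: "(real ^ 'd) set"
    and vol :: "(real ^ 'd) measure"
    and f :: "real ^ 'd \<Rightarrow> real"
    and \<Omega> :: "'w measure"
    and P :: "nat \<Rightarrow> 'w \<Rightarrow> (real ^ 'd) set"
    and r :: "nat \<Rightarrow> real"
    and lam :: real
    and k :: nat
  assumes "CARD('m::finite) < CARD('d)"
    and "closed_submanifold TYPE('m) M"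
    and "riemannian_volume TYPE('m) M vol"
    and "bounded_probability_density vol f"
    and "\<And>n. n \<ge> 1 \<Longrightarrow> poisson_process_with_intensity \<Omega> vol (\<lambda>x. real n * f x) (P n)"
    and "\<And>n. n \<ge> 1 \<Longrightarrow> r n > 0"
    and "lam > 0"
    and "(\<lambda>n. real n * r n ^ CARD('m)) \<longlonglongrightarrow> lam"
    and "1 \<le> k" and "k \<le> CARD('m) - 1"
  shows "0 < liminf (\<lambda>n. expected_betti \<Omega> k (\<lambda>\<omega>. ball_union (P n \<omega>) (r n)) / of_nat n)
    \<and> liminf (\<lambda>n. expected_betti \<Omega> k (\<lambda>\<omega>. ball_union (P n \<omega>) (r n)) / of_nat n)
        \<le> limsup (\<lambda>n. expected_betti \<Omega> k (\<lambda>\<omega>. ball_union (P n \<omega>) (r n)) / of_nat n)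
    \<and> limsup (\<lambda>n. expected_betti \<Omega> k (\<lambda>\<omega>. ball_union (P n \<omega>) (r n)) / of_nat n) < \<infinity>"
proof (intro conjI)
  let ?b = "\<lambda>n. expected_betti \<Omega> k (\<lambda>\<omega>. ball_union (P n \<omega>) (r n)) / of_nat n"
  \<comment> \<open>Since k >= 1, the truncated subtraction in the bound on k cannot hide a case
    with k = m.\<close>
  have "k < CARD('m)" using assms(9,10) by linarith
  then obtain \<delta> where \<delta>: "\<delta> > 0" "eventually (\<lambda>n. ennreal \<delta> \<le> ?b n) sequentially"
    using expected_betti_lower[OF assms(2-9)] by blast
  have "ennreal \<delta> \<le> liminf ?b" using \<delta>(2) by (rule Liminf_bounded)
  moreover have "0 < ennreal \<delta>" using \<delta>(1) by simp
  ultimately show "0 < liminf ?b" by (rule less_le_trans[rotated])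
  show "liminf ?b \<le> limsup ?b" by (rule Liminf_le_Limsup) simp
  obtain C where "eventually (\<lambda>n. ?b n \<le> ennreal C) sequentially"
    using expected_betti_upper[OF assms(2-8)] by blast
  then have "limsup ?b \<le> ennreal C" by (rule Limsup_bounded)
  also have "\<dots> < \<infinity>" by simp
  finally show "limsup ?b < \<infinity>" .
qed

end
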